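(* Every generalized Halin graph $G$ has a permanent-non-singular $(0,2)$-matrix.
   Context: Graphs are finite and simple. A generalized Halin graph is a graph obtained from a tree $T$ embedded in the plane (vertices of degree $2$ are allowed) by adding a cycle through all the leaves of $T$ in the cyclic order in which they appear in the plane embedding. For a graph $G$, fix an orientation $D$ of $G$. Let $A_G$ be the matrix whose rows are indexed by $E(G)$ and whose columns are indexed by $V(G)\cup E(G)$. For an edge $e$ oriented from $u$ to $v$ and $z\in V(G)\cup E(G)$: $A_G[e,z]=1$ if $z=v$ or $z\neq e$ is an edge incident to $v$; $A_G[e,z]=-1$ if $z=u$ or $z\neq e$ is an edge incident to $u$; and $A_G[e,z]=0$ otherwise. Write $A_G(z)$ for the column of $A_G$ indexed by $z$. An index function is a map $\eta:V(G)\cup E(G)\to\{0,1,2,\dots\}$; $A_G(\eta)$ denotes the matrix whose columns are columns of $A_G$, with each column $A_G(z)$ occurring exactly $\eta(z)$ times. When $\sum_z\eta(z)=|E(G)|$ this is a square matrix. An $(a,b)$-matrix of $G$ is a square matrix $A_G(\eta)$ with $\eta(v)\le a$ for every vertex $v$ and $\eta(e)\le b$ for every edge $e$. A square matrix is permanent-non-singular if its permanent is nonzero. (Reversing the orientation of an edge negates one row of $A_G$, so these notions do not depend on the chosen orientation.) *)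

theory Defs
  imports Main "HOL-Library.FuncSet" "HOL-Combinatorics.Orbits"
begin

section \<open>Finite simple graphs\<close>

definition simple_graph :: "'a set \<Rightarrow> 'a set set \<Rightarrow> bool" where
  "simple_graph V E \<longleftrightarrow> finite V \<and> (\<forall>e\<in>E. \<exists>u\<in>V. \<exists>v\<in>V. u \<noteq> v \<and> e = {u, v})"

definition neighbours :: "'a set set \<Rightarrow> 'a \<Rightarrow> 'a set" where
  "neighbours E v = {u. {v, u} \<in> E}"

definition connected_graph :: "'a set \<Rightarrow> 'a set set \<Rightarrow> bool" where
  "connected_graph V E \<longleftrightarrow> V \<noteq> {} \<and> (\<forall>u\<in>V. \<forall>v\<in>V. (\<lambda>x y. {x, y} \<in> E)\<^sup>*\<^sup>* u v)"

definition cycle_edges :: "'a list \<Rightarrow> 'a set set" where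
  "cycle_edges xs = {{xs ! i, xs ! (Suc i mod length xs)} |i. i < length xs}"

definition cycle_seq :: "'a list \<Rightarrow> bool" where
  "cycle_seq xs \<longleftrightarrow> 3 \<le> length xs \<and> distinct xs"

definition acyclic_graph :: "'a set set \<Rightarrow> bool" where
  "acyclic_graph E \<longleftrightarrow> \<not> (\<exists>xs. cycle_seq xs \<and> cycle_edges xs \<subseteq> E)"

definition tree_graph :: "'a set \<Rightarrow> 'a set set \<Rightarrow> bool" where
  "tree_graph V E \<longleftrightarrow> simple_graph V E \<and> connected_graph V E \<and> acyclic_graph E"

definition leaf :: "'a set set \<Rightarrow> 'a \<Rightarrow> bool" where
  "leaf E v \<longleftrightarrow> card (neighbours E v) = 1"


section \<open>Plane trees and generalized Halin graphs\<close>

text \<open>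
  A plane embedding is represented by its rotation system: \<open>rot v\<close> sends each neighbour of
  \<open>v\<close> to the next one in the cyclic order around \<open>v\<close>.  Up to orientation-preserving homeomorphism of the sphere,
  the plane embeddings of a tree correspond exactly to its rotation systems (every rotation
  system of a tree has genus 0).
\<close>

definition rotation_system :: "'a set \<Rightarrow> 'a set set \<Rightarrow> ('a \<Rightarrow> 'a \<Rightarrow> 'a) \<Rightarrow> bool" where
  "rotation_system V E rot \<longleftrightarrow> (\<forall>v\<in>V. cyclic_on (rot v) (neighbours E v))"

text \<open>
  An embedded tree has a single face.  Its boundary walk traverses each of the
  \<open>2 * card E\<close> directed edges once, following \<open>(u, v)\<close> by \<open>(v, rot v u)\<close>.  A leaf is the
  source of exactly one directed edge, so it is met once; the leaves listed in the order in
  which the walk meets them give the cyclic order in which they appear in the embedding.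
\<close>

definition face_step :: "('a \<Rightarrow> 'a \<Rightarrow> 'a) \<Rightarrow> 'a \<times> 'a \<Rightarrow> 'a \<times> 'a" where
  "face_step rot d = (snd d, rot (snd d) (fst d))"

definition boundary_walk :: "'a set set \<Rightarrow> ('a \<Rightarrow> 'a \<Rightarrow> 'a) \<Rightarrow> 'a \<times> 'a \<Rightarrow> 'a list" where
  "boundary_walk E rot d = map (\<lambda>k. fst ((face_step rot ^^ k) d)) [0..<2 * card E]"

definition leaves_in_order :: "'a set set \<Rightarrow> ('a \<Rightarrow> 'a \<Rightarrow> 'a) \<Rightarrow> 'a list \<Rightarrow> bool" where
  "leaves_in_order E rot xs \<longleftrightarrow>
     (\<exists>u v. {u, v} \<in> E \<and> xs = filter (leaf E) (boundary_walk E rot (u, v)))"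

definition generalized_halin :: "'a set \<Rightarrow> 'a set set \<Rightarrow> bool" where
  "generalized_halin V E \<longleftrightarrow>
     (\<exists>T rot xs. tree_graph V T \<and> rotation_system V T rot \<and>
        cycle_seq xs \<and> set xs = {v \<in> V. leaf T v} \<and> leaves_in_order T rot xs \<and>
        E = T \<union> cycle_edges xs)"


section \<open>The matrix of an oriented graph and its permanents\<close>

text \<open>An orientation maps each edge to the pair (tail, head).\<close>

definition orientation :: "'a set set \<Rightarrow> ('a set \<Rightarrow> 'a \<times> 'a) \<Rightarrow> bool" where
  "orientation E D \<longleftrightarrow> (\<forall>e\<in>E. e = {fst (D e), snd (D e)})"

text \<open>
  Columns are indexed by the disjoint union \<open>V <+> E\<close>.  In a simple graph an edge other than
  \<open>e\<close> contains at most one end of \<open>e\<close>, so the order of the tests is immaterial.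
\<close>

definition graph_matrix :: "('a set \<Rightarrow> 'a \<times> 'a) \<Rightarrow> 'a set \<Rightarrow> 'a + 'a set \<Rightarrow> int" where
  "graph_matrix D e z =
     (case z of
        Inl x \<Rightarrow> if x = snd (D e) then 1 else if x = fst (D e) then -1 else 0
      | Inr f \<Rightarrow> if f \<noteq> e \<and> snd (D e) \<in> f then 1
                 else if f \<noteq> e \<and> fst (D e) \<in> f then -1 else 0)"

text \<open>
  The column \<open>z\<close> of the original matrix is repeated \<open>\<eta> z\<close> times, the copies being indexed by
  \<open>(z, i)\<close> with \<open>i < \<eta> z\<close>.
\<close>

definition repeated_columns ::
    "'a set \<Rightarrow> 'a set set \<Rightarrow> ('a + 'a set \<Rightarrow> nat) \<Rightarrow> (('a + 'a set) \<times> nat) set" where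
  "repeated_columns V E \<eta> = (SIGMA z : V <+> E. {..<\<eta> z})"

definition repeated_matrix ::
    "('a set \<Rightarrow> 'a \<times> 'a) \<Rightarrow> 'a set \<Rightarrow> ('a + 'a set) \<times> nat \<Rightarrow> int" where
  "repeated_matrix D e c = graph_matrix D e (fst c)"

text \<open>
  The permanent of a square matrix whose rows and columns are indexed by finite sets \<open>R\<close> and
  \<open>C\<close> of equal size.
\<close>

definition permanent :: "'r set \<Rightarrow> 'c set \<Rightarrow> ('r \<Rightarrow> 'c \<Rightarrow> int) \<Rightarrow> int" where
  "permanent R C M = (\<Sum>\<sigma> \<in> {\<sigma> \<in> R \<rightarrow>\<^sub>E C. bij_betw \<sigma> R C}. \<Prod>r\<in>R. M r (\<sigma> r))"

definition ab_index ::
    "'a set \<Rightarrow> 'a set set \<Rightarrow> nat \<Rightarrow> nat \<Rightarrow> ('a + 'a set \<Rightarrow> nat) \<Rightarrow> bool" where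
  "ab_index V E a b \<eta> \<longleftrightarrow>
     (\<Sum>z \<in> V <+> E. \<eta> z) = card E \<and> (\<forall>v\<in>V. \<eta> (Inl v) \<le> a) \<and> (\<forall>e\<in>E. \<eta> (Inr e) \<le> b)"

definition has_perm_nonsingular_matrix ::
    "'a set \<Rightarrow> 'a set set \<Rightarrow> ('a set \<Rightarrow> 'a \<times> 'a) \<Rightarrow> nat \<Rightarrow> nat \<Rightarrow> bool" where
  "has_perm_nonsingular_matrix V E D a b \<longleftrightarrow>
     (\<exists>\<eta>. ab_index V E a b \<eta> \<and>
        permanent E (repeated_columns V E \<eta>) (repeated_matrix D) \<noteq> 0)"

end

theory Submission
  imports Defs "HOL-Library.Poly_Mapping" "HOL-Number_Theory.Cong"
begin

text \<open>
  The permanent of \<open>A\<^sub>G(\<eta>)\<close> is, up to a product of factorials, the coefficient of \<open>y\<^sup>\<eta>\<close> in the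
  product of the forms \<open>s\<^sub>v - s\<^sub>u\<close> over the edges \<open>uv\<close>, where \<open>s\<^sub>v\<close> is the sum of the variables
  \<open>y\<^sub>f\<close> over the edges \<open>f\<close> at \<open>v\<close>.  So some monomial with all exponents at most 2 has to
  survive, that is, the product has to be nonzero modulo the cubes of the variables.

  Modulo 3 the ideal of the cubes is stable under linear substitutions, because cubing is
  additive.  If \<open>G\<close> is connected and not bipartite, then the vertex sums \<open>s\<^sub>v\<close> may be prescribed freely
  modulo 3, and it suffices to treat the product of the differences \<open>X\<^sub>v - X\<^sub>u\<close> in vertex variables.
  There the edges far from the leaves are removed one at a time, and the rim together with the
  leaf edges is computed explicitly.  Only the wheels of odd length resist; for them an explicit
  substitution of edge variables works in characteristic 0.

  If \<open>G\<close> is bipartite, two leaf-ended paths hanging consecutively from one vertex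
  have lengths of different parity, since their ends are adjacent on the rim.  Looking at a
  deepest leaf, one finds either a vertex with two consecutive hanging paths of lengths 1
  and 2, or a vertex all of whose hanging paths have length 2 or 3, with length 3 occurring.
  In both cases the edges near that vertex give an explicit nonzero coefficient, and all other
  edges are handled by a triangular argument along the rim and down the tree.
\<close>

section \<open>Polynomials modulo the cubes of the variables\<close>

text \<open>In vertex variables the degrees match exactly: |E| = |V| - 1 + n for n leaves, the
  squares of the leaf variables absorb the n rim edges and the n leaf edges, and each inner tree
  edge takes its lower end. The rim and leaf edges alone give the squared leaf variables the
  coefficient 1 + (-1)^n. So even n is easy, while odd n needs one more vertex \<open>p\<close> at
  which some but not all leaves hang; a wheel has no such vertex. Bipartite graphs escape the method
  because the sum of the s_v over one colour class equals the sum over the other, so the vertex sums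
  are dependent. In characteristic 0 a sum of variables no longer has cube 0; the two remaining
  cases therefore substitute only multiples of single variables. The explicit coefficients found
  there, 6 * (-2)^m for odd wheels and -3 for neighbouring paths of lengths 1 and 2, are divisible
  by 3, so these computations would prove nothing modulo 3.\<close>

definition cubefree :: "('v \<Rightarrow>\<^sub>0 nat) \<Rightarrow> bool" where
  "cubefree \<mu> \<longleftrightarrow> (\<forall>v. Poly_Mapping.lookup \<mu> v \<le> 2)"

lemma cubefree_addD: "cubefree (\<mu> + \<nu>) \<Longrightarrow> cubefree \<mu>"
  unfolding cubefree_def lookup_add by (meson add_leD1)

text \<open>This is congruence modulo the ideal generated by the cubes of the variables: the ideal
  is monomial, so membership means that all cubefree coefficients vanish.\<close>

definition cube_cong :: "(('v \<Rightarrow>\<^sub>0 nat) \<Rightarrow>\<^sub>0 int) \<Rightarrow> (('v \<Rightarrow>\<^sub>0 nat) \<Rightarrow>\<^sub>0 int) \<Rightarrow> bool" where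
  "cube_cong p q \<longleftrightarrow> (\<forall>\<mu>. cubefree \<mu> \<longrightarrow> Poly_Mapping.lookup p \<mu> = Poly_Mapping.lookup q \<mu>)"

text \<open>Every divisor of a cubefree monomial is cubefree, so a cubefree coefficient of a product
  sees only cubefree coefficients of the left factor.\<close>

lemma cube_cong_mult_right:
  assumes "cube_cong p q"
  shows "cube_cong (p * r) (q * r)"
proof -
  have "Poly_Mapping.lookup ((p - q) * r) \<mu> = 0" if \<mu>: "cubefree \<mu>" for \<mu>
  proof -
    have "Poly_Mapping.lookup (p - q) l * (\<Sum>k. Poly_Mapping.lookup r k when \<mu> = l + k) = 0" for l
    proof (cases "cubefree l")
      case True
      then show ?thesis using assms by (simp add: cube_cong_def lookup_minus)
    next
      case False
      then have "\<mu> \<noteq> l + k" for k using \<mu> cubefree_addD by blast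
      then show ?thesis by simp
    qed
    then show ?thesis by (simp add: lookup_mult Sum_any.expand_set del: mult_eq_0_iff)
  qed
  then show ?thesis by (simp add: cube_cong_def lookup_minus left_diff_distrib)
qed

quotient_type 'v tpoly = "('v \<Rightarrow>\<^sub>0 nat) \<Rightarrow>\<^sub>0 int" / cube_cong
  by (rule equivpI) (auto simp: reflp_def symp_def transp_def cube_cong_def)

instantiation tpoly :: (type) comm_ring_1
begin

lift_definition zero_tpoly :: "'a tpoly" is 0 .
lift_definition one_tpoly :: "'a tpoly" is 1 .
lift_definition plus_tpoly :: "'a tpoly \<Rightarrow> 'a tpoly \<Rightarrow> 'a tpoly" is "(+)"
  by (simp add: cube_cong_def lookup_add)
lift_definition minus_tpoly :: "'a tpoly \<Rightarrow> 'a tpoly \<Rightarrow> 'a tpoly" is "(-)"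
  by (simp add: cube_cong_def lookup_minus)
lift_definition uminus_tpoly :: "'a tpoly \<Rightarrow> 'a tpoly" is uminus
  by (simp add: cube_cong_def)
lift_definition times_tpoly :: "'a tpoly \<Rightarrow> 'a tpoly \<Rightarrow> 'a tpoly" is "(*)"
proof -
  fix p p' q q' :: "('a \<Rightarrow>\<^sub>0 nat) \<Rightarrow>\<^sub>0 int"
  assume "cube_cong p p'" "cube_cong q q'"
  then have "cube_cong (p * q) (p' * q)" "cube_cong (q * p') (q' * p')"
    by (simp_all add: cube_cong_mult_right)
  then show "cube_cong (p * q) (p' * q')"
    by (simp add: cube_cong_def mult.commute)
qed

instance
proof
  show "(0 :: 'a tpoly) \<noteq> 1"
  proof (transfer, unfold cube_cong_def, intro notI)
    assume "\<forall>\<mu>. cubefree \<mu> \<longrightarrow> Poly_Mapping.lookup (0 :: ('a \<Rightarrow>\<^sub>0 nat) \<Rightarrow>\<^sub>0 int) \<mu> = Poly_Mapping.lookup 1 \<mu>"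
    from this[rule_format, of 0] show False by (simp add: cubefree_def)
  qed
qed (transfer; simp add: cube_cong_def algebra_simps)+

end

text \<open>Coefficients with an exponent above 2 are not invariants of the class, and
  \<open>Abs_poly_mapping\<close> is meaningful only on finite support; both situations get the
  default 0.\<close>

lift_definition tcoeff :: "('v \<Rightarrow> nat) \<Rightarrow> 'v tpoly \<Rightarrow> int" is
  "\<lambda>\<eta> p. if finite {v. \<eta> v \<noteq> 0} \<and> (\<forall>v. \<eta> v \<le> 2) then Poly_Mapping.lookup p (Abs_poly_mapping \<eta>) else 0"
  by (auto simp: cube_cong_def cubefree_def)

lift_definition tvar :: "'v \<Rightarrow> 'v tpoly" is "\<lambda>v. Poly_Mapping.single (Poly_Mapping.single v 1) 1" .

lemma tvar_cube: "tvar v ^ 3 = 0"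
proof -
  have "tvar v * tvar v * tvar v = 0"
    by transfer (auto simp: mult_single cube_cong_def cubefree_def lookup_single lookup_add when_def
        simp flip: single_add)
  then show ?thesis by (simp add: power3_eq_cube)
qed

lemma tcoeff_add: "tcoeff \<eta> (p + q) = tcoeff \<eta> p + tcoeff \<eta> q"
  by transfer (simp add: lookup_add)

lemma tcoeff_zero: "tcoeff \<eta> 0 = 0"
  by transfer simp

lemma tcoeff_uminus: "tcoeff \<eta> (- p) = - tcoeff \<eta> p"
  by transfer simp

lemma tcoeff_sum: "tcoeff \<eta> (sum f A) = (\<Sum>a\<in>A. tcoeff \<eta> (f a))"
  by (induction A rule: infinite_finite_induct) (auto simp: tcoeff_add tcoeff_zero)

lemma tcoeff_of_nat_mult: "tcoeff \<eta> (of_nat k * p) = int k * tcoeff \<eta> p"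
  by (induction k) (simp_all add: tcoeff_add tcoeff_zero algebra_simps)

lemma tcoeff_of_int_mult: "tcoeff \<eta> (of_int k * p) = k * tcoeff \<eta> p"
  by (cases k) (simp_all add: tcoeff_of_nat_mult tcoeff_uminus del: of_nat_Suc)

lemma of_int_dvd_tcoeff: "of_int m dvd p \<Longrightarrow> m dvd tcoeff \<eta> p"
  by (auto simp: dvd_def tcoeff_of_int_mult)

lemma tcoeff_prod_tvar:
  assumes "finite R" and "finite {v. \<eta> v \<noteq> 0}" and "\<forall>v. \<eta> v \<le> 2"
  shows "tcoeff \<eta> (\<Prod>r\<in>R. tvar (\<sigma> r)) = of_bool (\<forall>v. card {r \<in> R. \<sigma> r = v} = \<eta> v)"
proof -
  define \<mu> where "\<mu> = (\<Sum>r\<in>R. Poly_Mapping.single (\<sigma> r) (1 :: nat))"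
  have "(\<Prod>r\<in>R. tvar (\<sigma> r)) = abs_tpoly (\<Prod>r\<in>R. Poly_Mapping.single (Poly_Mapping.single (\<sigma> r) 1) 1)"
    using \<open>finite R\<close> by induction (auto simp: one_tpoly_def times_tpoly.abs_eq tvar.abs_eq)
  also have "(\<Prod>r\<in>R. Poly_Mapping.single (Poly_Mapping.single (\<sigma> r) (1::nat)) (1 :: int)) = Poly_Mapping.single \<mu> 1"
    unfolding \<mu>_def using \<open>finite R\<close> by induction (auto simp: mult_single)
  finally have "tcoeff \<eta> (\<Prod>r\<in>R. tvar (\<sigma> r)) = (1 when \<mu> = Abs_poly_mapping \<eta>)"
    using assms by (simp add: tcoeff.abs_eq lookup_single)
  moreover have "Poly_Mapping.lookup \<mu> v = card {r \<in> R. \<sigma> r = v}" for v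
    using \<open>finite R\<close> by (simp add: \<mu>_def lookup_sum lookup_single when_def sum.If_cases Int_def)
  then have "\<mu> = Abs_poly_mapping \<eta> \<longleftrightarrow> (\<forall>v. card {r \<in> R. \<sigma> r = v} = \<eta> v)"
    using assms by (auto simp: poly_mapping_eq_iff fun_eq_iff)
  ultimately show ?thesis by simp
qed

text \<open>The explicit computations below end in an integer times a product of squared variables.
  The coefficient of that monomial turns divisibility in the ring into divisibility in the
  integers.\<close>

lemma dvd_squares_tvar:
  assumes "finite A" and "of_int m dvd of_int k * (\<Prod>v\<in>A. tvar v ^ 2)"
  shows "m dvd k"
proof -
  let ?\<eta> = "\<lambda>v. if v \<in> A then 2 else 0 :: nat"
  \<comment> \<open>Each square is spread over the two indices \<open>(v, 0)\<close> and
    \<open>(v, 1)\<close> to fit \<open>tcoeff_prod_tvar\<close>.\<close>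
  have "(\<Prod>v\<in>A. tvar v ^ 2) = (\<Prod>r\<in>A \<times> {0, 1 :: nat}. tvar (fst r))"
    by (simp add: prod.cartesian_product' power2_eq_square)
  moreover have "{r \<in> A \<times> {0, 1 :: nat}. fst r = v} = (if v \<in> A then {v} \<times> {0, 1} else {})" for v
    by auto
  ultimately have "tcoeff ?\<eta> (\<Prod>v\<in>A. tvar v ^ 2) = 1"
    using assms(1) by (simp add: tcoeff_prod_tvar)
  then show ?thesis
    using of_int_dvd_tcoeff[OF assms(2), of ?\<eta>] by (simp add: tcoeff_of_int_mult)
qed

section \<open>Coefficients of products of linear forms\<close>

text \<open>
  The coefficient of the monomial with exponents \<open>\<eta>\<close> in the product over \<open>r \<in> R\<close> of the
  linear forms with coefficients \<open>M r f\<close>.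
\<close>

definition form_coeff :: "'r set \<Rightarrow> 'f set \<Rightarrow> ('r \<Rightarrow> 'f \<Rightarrow> int) \<Rightarrow> ('f \<Rightarrow> nat) \<Rightarrow> int" where
  "form_coeff R F M \<eta> =
     (\<Sum>\<sigma> | \<sigma> \<in> R \<rightarrow>\<^sub>E F \<and> (\<forall>f\<in>F. card {r \<in> R. \<sigma> r = f} = \<eta> f). \<Prod>r\<in>R. M r (\<sigma> r))"

text \<open>Only 0 is divisible by 0, so \<open>m = 0\<close> asks for a nonzero coefficient, and
  \<open>m = 3\<close> for one that survives modulo 3. One predicate serves both
  characteristics.\<close>

definition good :: "int \<Rightarrow> 'r set \<Rightarrow> 'f set \<Rightarrow> ('r \<Rightarrow> 'f \<Rightarrow> int) \<Rightarrow> bool" where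
  "good m R F M \<longleftrightarrow> (\<exists>\<eta>. (\<forall>f\<in>F. \<eta> f \<le> 2) \<and> \<not> m dvd form_coeff R F M \<eta>)"

lemma goodI: "(\<And>f. f \<in> F \<Longrightarrow> \<eta> f \<le> 2) \<Longrightarrow> \<not> m dvd form_coeff R F M \<eta> \<Longrightarrow> good m R F M"
  by (auto simp: good_def)

lemma good_imp_good_0: "good m R F M \<Longrightarrow> good 0 R F M"
  unfolding good_def by (metis dvd_0_left_iff dvd_0_right)

lemma prod_forms_expand:
  fixes a :: "'f \<Rightarrow> 'c :: comm_ring_1"
  assumes "finite R" "finite F"
  shows "(\<Prod>r\<in>R. \<Sum>f\<in>F. of_int (M r f) * a f) =
    (\<Sum>\<sigma>\<in>R \<rightarrow>\<^sub>E F. of_int (\<Prod>r\<in>R. M r (\<sigma> r)) * (\<Prod>f\<in>F. a f ^ card {r \<in> R. \<sigma> r = f}))"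
proof -
  have "(\<Prod>r\<in>R. a (\<sigma> r)) = (\<Prod>f\<in>F. a f ^ card {r \<in> R. \<sigma> r = f})" if "\<sigma> \<in> R \<rightarrow>\<^sub>E F" for \<sigma>
  proof -
    have "(\<Prod>r\<in>R. a (\<sigma> r)) = (\<Prod>f\<in>F. \<Prod>r\<in>{r \<in> R. \<sigma> r = f}. a (\<sigma> r))"
      using assms that by (subst prod.group) auto
    then show ?thesis by simp
  qed
  then show ?thesis
    using assms by (simp add: prod_sum_PiE prod.distrib)
qed

text \<open>If all coefficients with exponents at most 2 were divisible by \<open>m\<close>, every
  group of terms with equal exponents would be a multiple of \<open>m\<close>, either through its
  coefficient or through the cube of some value. Divisibility by \<open>of_int m\<close> stands in
  for passing to a quotient ring.\<close>

lemma goodI_ring: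
  fixes a :: "'f \<Rightarrow> 'c :: comm_ring_1"
  assumes fin: "finite R" "finite F"
    and cube: "\<And>f. f \<in> F \<Longrightarrow> of_int m dvd a f ^ 3"
    and ndvd: "\<not> of_int m dvd (\<Prod>r\<in>R. \<Sum>f\<in>F. of_int (M r f) * a f)"
  shows "good m R F M"
proof (rule ccontr)
  assume bad: "\<not> good m R F M"
  define cnt where "cnt \<sigma> = restrict (\<lambda>f. card {r \<in> R. \<sigma> r = f}) F" for \<sigma> :: "'a \<Rightarrow> 'f"
  let ?g = "\<lambda>\<sigma>. of_int (\<Prod>r\<in>R. M r (\<sigma> r)) * (\<Prod>f\<in>F. a f ^ card {r \<in> R. \<sigma> r = f})"
  have fin': "finite (R \<rightarrow>\<^sub>E F)" using fin by (simp add: finite_PiE)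
  have "of_int m dvd (\<Sum>\<sigma>\<in>{\<sigma> \<in> R \<rightarrow>\<^sub>E F. cnt \<sigma> = \<eta>}. ?g \<sigma>)" if "\<eta> \<in> cnt ` (R \<rightarrow>\<^sub>E F)" for \<eta>
  proof (cases "\<forall>f\<in>F. \<eta> f \<le> 2")
    case True
    have "{\<sigma> \<in> R \<rightarrow>\<^sub>E F. cnt \<sigma> = \<eta>} =
        {\<sigma>. \<sigma> \<in> R \<rightarrow>\<^sub>E F \<and> (\<forall>f\<in>F. card {r \<in> R. \<sigma> r = f} = \<eta> f)}"
      using that by (auto simp: cnt_def fun_eq_iff)
    then have "(\<Sum>\<sigma>\<in>{\<sigma> \<in> R \<rightarrow>\<^sub>E F. cnt \<sigma> = \<eta>}. ?g \<sigma>) =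
        of_int (form_coeff R F M \<eta>) * (\<Prod>f\<in>F. a f ^ \<eta> f)"
      by (simp add: form_coeff_def sum_distrib_right)
    moreover have "m dvd form_coeff R F M \<eta>"
      using True bad by (auto simp: good_def)
    then have "of_int m dvd (of_int (form_coeff R F M \<eta>) :: 'c)"
      by (auto simp: dvd_def)
    ultimately show ?thesis by simp
  next
    case False
    then obtain f where f: "f \<in> F" "3 \<le> \<eta> f" by force
    have "of_int m dvd ?g \<sigma>" if "\<sigma> \<in> {\<sigma> \<in> R \<rightarrow>\<^sub>E F. cnt \<sigma> = \<eta>}" for \<sigma>
    proof -
      have "3 \<le> card {r \<in> R. \<sigma> r = f}" using that f by (auto simp: cnt_def)
      then have "a f ^ 3 dvd a f ^ card {r \<in> R. \<sigma> r = f}" by (rule le_imp_power_dvd)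
      then have "of_int m dvd (\<Prod>f\<in>F. a f ^ card {r \<in> R. \<sigma> r = f})"
        using cube[OF f(1)] f(1) fin(2) by (meson dvd_prodI dvd_trans)
      then show ?thesis by simp
    qed
    then show ?thesis by (intro dvd_sum) blast
  qed
  then have "of_int m dvd (\<Sum>\<eta>\<in>cnt ` (R \<rightarrow>\<^sub>E F). \<Sum>\<sigma>\<in>{\<sigma> \<in> R \<rightarrow>\<^sub>E F. cnt \<sigma> = \<eta>}. ?g \<sigma>)"
    by (rule dvd_sum)
  also have "\<dots> = (\<Sum>\<sigma>\<in>R \<rightarrow>\<^sub>E F. ?g \<sigma>)"
    using fin' by (intro sum.group) auto
  finally show False
    using ndvd fin by (simp add: prod_forms_expand)
qed

text \<open>An arbitrary orientation determines the forms only up to sign, so they have to match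
  \<open>l i\<close> only up to sign. The index set lets the product be arranged along the rim
  instead of over a set of edges.\<close>

lemma goodI_ring_indexed:
  fixes a :: "'f \<Rightarrow> 'c :: comm_ring_1"
  assumes fin: "finite I" "finite F" and inj: "inj_on row I" and R: "R = row ` I"
    and cube: "\<And>f. f \<in> F \<Longrightarrow> of_int m dvd a f ^ 3"
    and form: "\<And>i. i \<in> I \<Longrightarrow> (\<Sum>f\<in>F. of_int (M (row i) f) * a f) \<in> {l i, - l i}"
    and ndvd: "\<not> of_int m dvd (\<Prod>i\<in>I. l i)"
  shows "good m R F M"
proof (rule goodI_ring)
  have "\<exists>s\<in>{1, -1}. (\<Prod>i\<in>J. \<Sum>f\<in>F. of_int (M (row i) f) * a f) = s * (\<Prod>i\<in>J. l i)"
    if "J \<subseteq> I" for J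
    using finite_subset[OF that fin(1)] that
  proof induction
    case (insert i J)
    then obtain s where "s \<in> {1, -1}"
      "(\<Prod>i\<in>J. \<Sum>f\<in>F. of_int (M (row i) f) * a f) = s * (\<Prod>i\<in>J. l i)" by blast
    then show ?case using insert form[of i] by auto
  qed auto
  from this[of I] have "\<not> of_int m dvd (\<Prod>i\<in>I. \<Sum>f\<in>F. of_int (M (row i) f) * a f)"
    using ndvd by auto
  then show "\<not> of_int m dvd (\<Prod>r\<in>R. \<Sum>f\<in>F. of_int (M r f) * a f)"
    by (simp add: R prod.reindex[OF inj])
qed (use assms in auto)

lemma good_cong:
  assumes "good m R F M" and "\<And>r f. r \<in> R \<Longrightarrow> f \<in> F \<Longrightarrow> [M r f = M' r f] (mod m)"
  shows "good m R F M'"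
proof -
  have "[form_coeff R F M \<eta> = form_coeff R F M' \<eta>] (mod m)" for \<eta>
    unfolding form_coeff_def using assms(2) by (intro cong_sum cong_prod) auto
  then show ?thesis
    using assms(1) by (auto simp: good_def cong_0_iff[symmetric] intro: cong_trans)
qed

lemma good_superset:
  assumes "good m R F M" "F \<subseteq> F'" "finite R"
  shows "good m R F' M"
proof -
  from assms obtain \<eta> where \<eta>: "\<forall>f\<in>F. \<eta> f \<le> 2" "\<not> m dvd form_coeff R F M \<eta>"
    by (auto simp: good_def)
  define \<eta>' where "\<eta>' f = (if f \<in> F then \<eta> f else 0)" for f
  have "\<sigma> \<in> R \<rightarrow>\<^sub>E F' \<and> (\<forall>f\<in>F'. card {r \<in> R. \<sigma> r = f} = \<eta>' f) \<longleftrightarrow>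
      \<sigma> \<in> R \<rightarrow>\<^sub>E F \<and> (\<forall>f\<in>F. card {r \<in> R. \<sigma> r = f} = \<eta> f)" (is "?L \<longleftrightarrow> ?R") for \<sigma>
  proof
    assume L: ?L
    have "\<sigma> r \<in> F" if "r \<in> R" for r
    proof (rule ccontr)
      assume "\<sigma> r \<notin> F"
      moreover have "\<sigma> r \<in> F'" using L that by auto
      ultimately have "card {r' \<in> R. \<sigma> r' = \<sigma> r} = 0" using L by (auto simp: \<eta>'_def)
      then show False using that \<open>finite R\<close> by auto
    qed
    then show ?R using L assms(2) by (auto simp: \<eta>'_def)
  next
    assume R: ?R
    have "card {r \<in> R. \<sigma> r = f} = 0" if "f \<notin> F" for f
      using R that \<open>finite R\<close> by auto
    then show ?L using R assms(2) by (auto simp: \<eta>'_def)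
  qed
  then have "form_coeff R F' M \<eta>' = form_coeff R F M \<eta>"
    by (simp add: form_coeff_def)
  then show ?thesis using \<eta> by (intro goodI[of _ \<eta>']) (auto simp: \<eta>'_def)
qed

text \<open>Replacing each variable \<open>f\<close> by the linear form with coefficients
  \<open>B f\<close> turns the forms of \<open>M\<close> into those of \<open>N\<close>. A surviving
  coefficient for \<open>N\<close> is then detected in \<open>tpoly\<close>, and
  \<open>goodI_ring\<close> applies as soon as the substituted forms have cubes divisible by
  \<open>m\<close>.\<close>

lemma good_substitution:
  assumes "good m R G N" and fin: "finite R" "finite F" "finite G"
    and N: "\<And>r g. r \<in> R \<Longrightarrow> g \<in> G \<Longrightarrow> [N r g = (\<Sum>f\<in>F. M r f * B f g)] (mod m)"
    and cube: "\<And>f. f \<in> F \<Longrightarrow> of_int m dvd (\<Sum>g\<in>G. of_int (B f g) * tvar g) ^ 3"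
  shows "good m R F M"
proof (rule goodI_ring[OF fin(1,2) cube])
  let ?N = "\<lambda>r g. \<Sum>f\<in>F. M r f * B f g"
  have "good m R G ?N" using assms(1) N by (rule good_cong)
  then obtain \<eta> where \<eta>: "\<forall>g\<in>G. \<eta> g \<le> 2" "\<not> m dvd form_coeff R G ?N \<eta>"
    by (auto simp: good_def)
  define \<eta>' where "\<eta>' g = (if g \<in> G then \<eta> g else 0)" for g
  have \<eta>': "finite {v. \<eta>' v \<noteq> 0}" "\<forall>v. \<eta>' v \<le> 2"
    using \<eta>(1) fin(3) by (auto simp: \<eta>'_def)
  have "(\<Prod>r\<in>R. \<Sum>f\<in>F. of_int (M r f) * (\<Sum>g\<in>G. of_int (B f g) * tvar g)) =
      (\<Prod>r\<in>R. \<Sum>g\<in>G. of_int (?N r g) * tvar g)"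
    by (rule prod.cong) (simp_all add: sum_distrib_left sum_distrib_right mult.assoc sum.swap[of _ G])
  also have "\<dots> = (\<Sum>\<sigma>\<in>R \<rightarrow>\<^sub>E G. of_int (\<Prod>r\<in>R. ?N r (\<sigma> r)) * (\<Prod>r\<in>R. tvar (\<sigma> r)))"
    using fin by (simp add: prod_sum_PiE prod.distrib)
  finally have *: "(\<Prod>r\<in>R. \<Sum>f\<in>F. of_int (M r f) * (\<Sum>g\<in>G. of_int (B f g) * tvar g)) = \<dots>" .
  have "tcoeff \<eta>' (\<Sum>\<sigma>\<in>R \<rightarrow>\<^sub>E G. of_int (\<Prod>r\<in>R. ?N r (\<sigma> r)) * (\<Prod>r\<in>R. tvar (\<sigma> r))) =
      (\<Sum>\<sigma>\<in>R \<rightarrow>\<^sub>E G. (\<Prod>r\<in>R. ?N r (\<sigma> r)) * of_bool (\<forall>v. card {r \<in> R. \<sigma> r = v} = \<eta>' v))"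
    by (simp only: tcoeff_sum tcoeff_of_int_mult tcoeff_prod_tvar[OF fin(1) \<eta>'])
  also have "\<dots> = (\<Sum>\<sigma>\<in>R \<rightarrow>\<^sub>E G. if \<forall>g\<in>G. card {r \<in> R. \<sigma> r = g} = \<eta> g then (\<Prod>r\<in>R. ?N r (\<sigma> r)) else 0)"
  proof (rule sum.cong)
    fix \<sigma> assume \<sigma>: "\<sigma> \<in> R \<rightarrow>\<^sub>E G"
    have "{r \<in> R. \<sigma> r = v} = {}" if "v \<notin> G" for v using \<sigma> that by auto
    then have "(\<forall>v. card {r \<in> R. \<sigma> r = v} = \<eta>' v) \<longleftrightarrow> (\<forall>g\<in>G. card {r \<in> R. \<sigma> r = g} = \<eta> g)"
      unfolding \<eta>'_def by (metis card.empty)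
    then show "(\<Prod>r\<in>R. ?N r (\<sigma> r)) * of_bool (\<forall>v. card {r \<in> R. \<sigma> r = v} = \<eta>' v) =
        (if \<forall>g\<in>G. card {r \<in> R. \<sigma> r = g} = \<eta> g then (\<Prod>r\<in>R. ?N r (\<sigma> r)) else 0)" by simp
  qed simp
  also have "\<dots> = form_coeff R G ?N \<eta>"
    using fin by (simp add: form_coeff_def sum.inter_filter[symmetric] finite_PiE)
  finally have "\<not> m dvd tcoeff \<eta>' (\<Sum>\<sigma>\<in>R \<rightarrow>\<^sub>E G. of_int (\<Prod>r\<in>R. ?N r (\<sigma> r)) * (\<Prod>r\<in>R. tvar (\<sigma> r)))"
    using \<eta>(2) by simp
  then show "\<not> of_int m dvd (\<Prod>r\<in>R. \<Sum>f\<in>F. of_int (M r f) * (\<Sum>g\<in>G. of_int (B f g) * tvar g))"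
    unfolding * by (rule contrapos_nn) (rule of_int_dvd_tcoeff)
qed

lemma three_dvd_cube_sum:
  fixes x :: "'i \<Rightarrow> 'c :: comm_ring_1"
  assumes "\<And>i. i \<in> A \<Longrightarrow> x i ^ 3 = 0"
  shows "of_int 3 dvd (\<Sum>i\<in>A. x i) ^ 3"
  using assms
proof (induction A rule: infinite_finite_induct)
  case (insert i A)
  have "(x i + s) ^ 3 = x i ^ 3 + of_int 3 * (x i ^ 2 * s + x i * s ^ 2) + s ^ 3" for s
    by (simp add: power3_eq_cube power2_eq_square algebra_simps)
  then show ?case using insert by (simp del: of_int_numeral)
qed auto

lemma good_3_substitution:
  assumes "good 3 R G N" "finite R" "finite F" "finite G"
    and "\<And>r g. r \<in> R \<Longrightarrow> g \<in> G \<Longrightarrow> [N r g = (\<Sum>f\<in>F. M r f * B f g)] (mod 3)"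
  shows "good 3 R F M"
proof (rule good_substitution[where G = G and N = N and B = B])
  show "of_int 3 dvd (\<Sum>g\<in>G. of_int (B f g) * tvar g) ^ 3" for f
    by (rule three_dvd_cube_sum) (simp add: power_mult_distrib tvar_cube)
qed (use assms in auto)

text \<open>In characteristic 0 the mixed terms in the cube of a sum remain. Sending each variable
  \<open>f\<close> to the multiple \<open>b f\<close> of the single variable \<open>h f\<close>
  still preserves vanishing cubes.\<close>

lemma good_0_identification:
  assumes "good 0 R G N" "finite R" "finite F" "finite G" and h: "h ` F \<subseteq> G"
    and N: "\<And>r g. r \<in> R \<Longrightarrow> g \<in> G \<Longrightarrow> N r g = (\<Sum>f | f \<in> F \<and> h f = g. M r f * b f)"
  shows "good 0 R F M"
proof (rule good_substitution[where G = G and N = N and B = "\<lambda>f g. if h f = g then b f else 0"])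
  fix f assume "f \<in> F"
  then have "(\<Sum>g\<in>G. of_int (if h f = g then b f else 0) * tvar g) = of_int (b f) * tvar (h f)"
    using h \<open>finite G\<close> by (subst sum.remove[of _ "h f"]) (auto intro!: sum.neutral split: if_splits)
  then show "of_int 0 dvd (\<Sum>g\<in>G. of_int (if h f = g then b f else 0) * tvar g) ^ 3"
    by (simp add: power_mult_distrib tvar_cube)
next
  fix r g assume "r \<in> R" "g \<in> G"
  have "(\<Sum>f\<in>F. M r f * (if h f = g then b f else 0)) = (\<Sum>f\<in>F. if h f = g then M r f * b f else 0)"
    by (rule sum.cong) auto
  then show "[N r g = (\<Sum>f\<in>F. M r f * (if h f = g then b f else 0))] (mod 0)"
    using N[OF \<open>r \<in> R\<close> \<open>g \<in> G\<close>] \<open>finite F\<close> by (simp add: sum.inter_filter)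
qed (use assms in auto)

text \<open>Double counting: the constant weight yields degrees, a general weight the exchange
  argument in \<open>good_leading\<close>.\<close>

lemma sum_card_fibres:
  assumes "finite R" "finite F"
  shows "(\<Sum>f\<in>F. card {r \<in> R. \<sigma> r = f} * w f) = (\<Sum>r | r \<in> R \<and> \<sigma> r \<in> F. w (\<sigma> r) :: nat)"
proof -
  have "(\<Sum>r | r \<in> R \<and> \<sigma> r \<in> F. w (\<sigma> r)) =
      (\<Sum>f\<in>F. \<Sum>r\<in>{r \<in> {r \<in> R. \<sigma> r \<in> F}. \<sigma> r = f}. w (\<sigma> r))"
    using assms by (intro sum.group[symmetric]) auto
  also have "\<dots> = (\<Sum>f\<in>F. card {r \<in> R. \<sigma> r = f} * w f)"
  proof (rule sum.cong)
    fix f assume "f \<in> F"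
    then have "{r \<in> {r \<in> R. \<sigma> r \<in> F}. \<sigma> r = f} = {r \<in> R. \<sigma> r = f}" by auto
    then show "(\<Sum>r\<in>{r \<in> {r \<in> R. \<sigma> r \<in> F}. \<sigma> r = f}. w (\<sigma> r)) = card {r \<in> R. \<sigma> r = f} * w f"
      by simp
  qed simp
  finally show ?thesis by simp
qed

lemma form_coeff_degree:
  assumes "finite R" "finite F" "form_coeff R F M \<eta> \<noteq> 0"
  shows "(\<Sum>f\<in>F. \<eta> f) = card R"
proof -
  obtain \<sigma> where "\<sigma> \<in> {\<sigma>. \<sigma> \<in> R \<rightarrow>\<^sub>E F \<and> (\<forall>f\<in>F. card {r \<in> R. \<sigma> r = f} = \<eta> f)}"
    using assms(3) unfolding form_coeff_def by (rule sum.not_neutral_contains_not_neutral)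
  then have \<sigma>: "\<sigma> \<in> R \<rightarrow>\<^sub>E F" "\<And>f. f \<in> F \<Longrightarrow> card {r \<in> R. \<sigma> r = f} = \<eta> f" by simp_all
  then have "(\<Sum>f\<in>F. \<eta> f) = (\<Sum>f\<in>F. card {r \<in> R. \<sigma> r = f} * 1)" by simp
  also have "\<dots> = (\<Sum>r | r \<in> R \<and> \<sigma> r \<in> F. 1)"
    by (rule sum_card_fibres[OF assms(1,2)])
  also have "{r. r \<in> R \<and> \<sigma> r \<in> F} = R" using \<sigma>(1) by auto
  finally show ?thesis by simp
qed

text \<open>
  A monomial using the variables in \<open>F1\<close> exactly \<open>card R1\<close> times can only take them from the
  forms in \<open>R1\<close>, so its coefficient factors.
\<close>

lemma good_triangular:
  assumes m: "m = 0 \<or> prime m"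
    and fin: "finite R1" "finite R2" "finite F1" "finite F2"
    and disj: "R1 \<inter> R2 = {}" "F1 \<inter> F2 = {}"
    and zero: "\<And>r f. r \<in> R2 \<Longrightarrow> f \<in> F1 \<Longrightarrow> M r f = 0"
    and good: "good m R1 F1 M" "good m R2 F2 M"
  shows "good m (R1 \<union> R2) (F1 \<union> F2) M"
proof -
  obtain \<eta>1 where \<eta>1: "\<forall>f\<in>F1. \<eta>1 f \<le> 2" "\<not> m dvd form_coeff R1 F1 M \<eta>1"
    using good(1) by (auto simp: good_def)
  obtain \<eta>2 where \<eta>2: "\<forall>f\<in>F2. \<eta>2 f \<le> 2" "\<not> m dvd form_coeff R2 F2 M \<eta>2"
    using good(2) by (auto simp: good_def)
  define \<eta> where "\<eta> f = (if f \<in> F1 then \<eta>1 f else \<eta>2 f)" for f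
  define S1 where "S1 = {\<sigma>. \<sigma> \<in> R1 \<rightarrow>\<^sub>E F1 \<and> (\<forall>f\<in>F1. card {r \<in> R1. \<sigma> r = f} = \<eta>1 f)}"
  define S2 where "S2 = {\<sigma>. \<sigma> \<in> R2 \<rightarrow>\<^sub>E F2 \<and> (\<forall>f\<in>F2. card {r \<in> R2. \<sigma> r = f} = \<eta>2 f)}"
  define S where "S = {\<sigma>. \<sigma> \<in> R1 \<union> R2 \<rightarrow>\<^sub>E F1 \<union> F2 \<and>
      (\<forall>f\<in>F1 \<union> F2. card {r \<in> R1 \<union> R2. \<sigma> r = f} = \<eta> f)}"
  let ?p = "\<lambda>\<sigma>. \<Prod>r\<in>R1 \<union> R2. M r (\<sigma> r)"
  have finS: "finite S" unfolding S_def
    by (rule finite_subset[of _ "R1 \<union> R2 \<rightarrow>\<^sub>E F1 \<union> F2"]) (use fin in \<open>auto intro!: finite_PiE\<close>)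
  have sum1: "(\<Sum>f\<in>F1. \<eta>1 f) = card R1"
  proof (rule form_coeff_degree[OF fin(1,3)])
    show "form_coeff R1 F1 M \<eta>1 \<noteq> 0" using \<eta>1(2) by auto
  qed
  have split: "\<sigma> ` R1 \<subseteq> F1 \<and> \<sigma> ` R2 \<subseteq> F2" if "\<sigma> \<in> S" "?p \<sigma> \<noteq> 0" for \<sigma>
  proof -
    have nz: "M r (\<sigma> r) \<noteq> 0" if "r \<in> R1 \<union> R2" for r using \<open>?p \<sigma> \<noteq> 0\<close> that fin by auto
    have 2: "\<sigma> r \<in> F2" if "r \<in> R2" for r
      using nz[of r] zero[OF that] \<open>\<sigma> \<in> S\<close> that by (auto simp: S_def PiE_def Pi_def)
    have "(\<Sum>f\<in>F1. \<eta>1 f) = (\<Sum>f\<in>F1. card {r \<in> R1 \<union> R2. \<sigma> r = f} * 1)"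
      using \<open>\<sigma> \<in> S\<close> by (intro sum.cong) (auto simp: S_def \<eta>_def)
    also have "\<dots> = card {r. r \<in> R1 \<union> R2 \<and> \<sigma> r \<in> F1}"
      using sum_card_fibres[of "R1 \<union> R2" F1 \<sigma> "\<lambda>_. 1"] fin by simp
    finally have "card {r. r \<in> R1 \<union> R2 \<and> \<sigma> r \<in> F1} = card R1" using sum1 by simp
    moreover have "{r. r \<in> R1 \<union> R2 \<and> \<sigma> r \<in> F1} \<subseteq> R1" using 2 disj by auto
    ultimately have "{r. r \<in> R1 \<union> R2 \<and> \<sigma> r \<in> F1} = R1"
      using fin card_subset_eq by blast
    then show ?thesis using 2 by auto
  qed
  let ?S' = "{\<sigma> \<in> S. \<sigma> ` R1 \<subseteq> F1 \<and> \<sigma> ` R2 \<subseteq> F2}"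
  let ?merge = "\<lambda>(\<sigma>1, \<sigma>2). \<lambda>r. if r \<in> R1 then \<sigma>1 r else if r \<in> R2 then \<sigma>2 r else undefined"
  have "form_coeff (R1 \<union> R2) (F1 \<union> F2) M \<eta> = (\<Sum>\<sigma>\<in>S. ?p \<sigma>)"
    by (simp add: form_coeff_def S_def)
  also have "\<dots> = (\<Sum>\<sigma>\<in>?S'. ?p \<sigma>)"
  proof (rule sum.mono_neutral_right[OF finS])
    show "\<forall>\<sigma>\<in>S - ?S'. ?p \<sigma> = 0" using split by blast
  qed blast
  also have "\<dots> = (\<Sum>(\<sigma>1, \<sigma>2)\<in>S1 \<times> S2. (\<Prod>r\<in>R1. M r (\<sigma>1 r)) * (\<Prod>r\<in>R2. M r (\<sigma>2 r)))"
  proof (rule sum.reindex_bij_witness[where i = ?merge and j = "\<lambda>\<sigma>. (restrict \<sigma> R1, restrict \<sigma> R2)"])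
    fix \<sigma> assume \<sigma>: "\<sigma> \<in> ?S'"
    show "?merge (restrict \<sigma> R1, restrict \<sigma> R2) = \<sigma>"
      using \<sigma> by (auto simp: S_def fun_eq_iff PiE_def extensional_def)
    have c1: "{r \<in> R1. restrict \<sigma> R1 r = f} = {r \<in> R1 \<union> R2. \<sigma> r = f}" if "f \<in> F1" for f
      using \<sigma> that disj by auto
    have c2: "{r \<in> R2. restrict \<sigma> R2 r = f} = {r \<in> R1 \<union> R2. \<sigma> r = f}" if "f \<in> F2" for f
      using \<sigma> that disj by auto
    have c: "card {r \<in> R1 \<union> R2. \<sigma> r = f} = \<eta> f" if "f \<in> F1 \<union> F2" for f
      using \<sigma> that unfolding S_def by blast
    have "card {r \<in> R1. restrict \<sigma> R1 r = f} = \<eta>1 f" if "f \<in> F1" for f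
      unfolding c1[OF that] using c[of f] that by (simp add: \<eta>_def)
    moreover have "card {r \<in> R2. restrict \<sigma> R2 r = f} = \<eta>2 f" if "f \<in> F2" for f
    proof -
      have "f \<notin> F1" using that disj by blast
      then show ?thesis unfolding c2[OF that] using c[of f] that by (simp add: \<eta>_def)
    qed
    moreover have "restrict \<sigma> R1 \<in> R1 \<rightarrow>\<^sub>E F1" "restrict \<sigma> R2 \<in> R2 \<rightarrow>\<^sub>E F2" using \<sigma> by auto
    ultimately show "(restrict \<sigma> R1, restrict \<sigma> R2) \<in> S1 \<times> S2"
      unfolding S1_def S2_def by blast
    show "(case (restrict \<sigma> R1, restrict \<sigma> R2) of
        (\<sigma>1, \<sigma>2) \<Rightarrow> (\<Prod>r\<in>R1. M r (\<sigma>1 r)) * (\<Prod>r\<in>R2. M r (\<sigma>2 r))) = ?p \<sigma>"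
      using disj fin by (simp add: prod.union_disjoint)
  next
    fix \<tau> assume "\<tau> \<in> S1 \<times> S2"
    then obtain \<sigma>1 \<sigma>2 where \<tau>: "\<tau> = (\<sigma>1, \<sigma>2)" and \<sigma>: "\<sigma>1 \<in> S1" "\<sigma>2 \<in> S2" by auto
    have P: "\<sigma>1 \<in> R1 \<rightarrow>\<^sub>E F1" "\<sigma>2 \<in> R2 \<rightarrow>\<^sub>E F2" using \<sigma> by (auto simp: S1_def S2_def)
    show "(restrict (?merge \<tau>) R1, restrict (?merge \<tau>) R2) = \<tau>"
      using P disj by (auto simp: \<tau> fun_eq_iff PiE_def extensional_def)
    have c1: "{r \<in> R1 \<union> R2. ?merge \<tau> r = f} = {r \<in> R1. \<sigma>1 r = f}" if "f \<in> F1" for f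
    proof -
      have "\<sigma>2 r \<noteq> f" if "r \<in> R2" for r
        using P(2) that \<open>f \<in> F1\<close> disj by (metis PiE_mem disjoint_iff)
      then show ?thesis by (auto simp: \<tau> split: if_splits)
    qed
    have c2: "{r \<in> R1 \<union> R2. ?merge \<tau> r = f} = {r \<in> R2. \<sigma>2 r = f}" if "f \<in> F2" for f
    proof -
      have "\<sigma>1 r \<noteq> f" if "r \<in> R1" for r
        using P(1) that \<open>f \<in> F2\<close> disj by (metis PiE_mem disjoint_iff)
      moreover have "r \<notin> R1" if "r \<in> R2" for r using that disj by blast
      ultimately show ?thesis by (auto simp: \<tau> split: if_splits)
    qed
    have "card {r \<in> R1 \<union> R2. ?merge \<tau> r = f} = \<eta> f" if "f \<in> F1 \<union> F2" for f
    proof (cases "f \<in> F1")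
      case True
      then show ?thesis unfolding c1[OF True] using \<sigma>(1) by (simp add: \<eta>_def S1_def)
    next
      case False
      then have "f \<in> F2" using that by blast
      then show ?thesis unfolding c2[OF \<open>f \<in> F2\<close>] using \<sigma>(2) False by (simp add: \<eta>_def S2_def)
    qed
    moreover have "?merge \<tau> \<in> R1 \<union> R2 \<rightarrow>\<^sub>E F1 \<union> F2" using P by (auto simp: \<tau> PiE_def Pi_def extensional_def)
    ultimately have "?merge \<tau> \<in> S" unfolding S_def by blast
    moreover have "?merge \<tau> ` R1 \<subseteq> F1" "?merge \<tau> ` R2 \<subseteq> F2" using P disj by (auto simp: \<tau>)
    ultimately show "?merge \<tau> \<in> ?S'" by blast
  qed
  also have "\<dots> = form_coeff R1 F1 M \<eta>1 * form_coeff R2 F2 M \<eta>2"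
    by (simp add: form_coeff_def S1_def S2_def sum_product sum.cartesian_product)
  \<comment> \<open>A product of two non-multiples of \<open>m\<close> is again a non-multiple
    because \<open>m\<close> is 0 or prime.\<close>
  finally have "\<not> m dvd form_coeff (R1 \<union> R2) (F1 \<union> F2) M \<eta>"
    using m \<eta>1(2) \<eta>2(2) by (auto simp: prime_dvd_mult_iff)
  then show ?thesis using \<eta>1(1) \<eta>2(1) by (intro goodI[of _ \<eta>]) (auto simp: \<eta>_def)
qed

text \<open>
  The variables \<open>var r\<close> have maximal weight in their forms, so that the product of these
  variables arises in exactly one way.
\<close>

lemma good_leading:
  fixes w :: "'f \<Rightarrow> nat"
  assumes m: "m = 0 \<or> prime m" and fin: "finite R"
    and lead: "\<And>r. r \<in> R \<Longrightarrow> \<not> m dvd M r (var r)"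
    and less: "\<And>r r'. r \<in> R \<Longrightarrow> r' \<in> R \<Longrightarrow> M r (var r') \<noteq> 0 \<Longrightarrow> var r' \<noteq> var r \<Longrightarrow> w (var r') < w (var r)"
    and two: "\<And>f. card {r \<in> R. var r = f} \<le> 2"
  shows "good m R (var ` R) M"
proof -
  define \<eta> where "\<eta> f = card {r \<in> R. var r = f}" for f
  define S where "S = {\<sigma>. \<sigma> \<in> R \<rightarrow>\<^sub>E var ` R \<and> (\<forall>f\<in>var ` R. card {r \<in> R. \<sigma> r = f} = \<eta> f)}"
  have finS: "finite S" unfolding S_def
    by (rule finite_subset[of _ "R \<rightarrow>\<^sub>E var ` R"]) (use fin in \<open>auto intro!: finite_PiE\<close>)
  have eq: "\<sigma> = restrict var R" if \<sigma>: "\<sigma> \<in> S" and nz: "(\<Prod>r\<in>R. M r (\<sigma> r)) \<noteq> 0" for \<sigma>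
  proof -
    have im: "\<sigma> r \<in> var ` R" if "r \<in> R" for r using \<sigma> that by (auto simp: S_def)
    have le: "w (\<sigma> r) \<le> w (var r)" "\<sigma> r \<noteq> var r \<Longrightarrow> w (\<sigma> r) < w (var r)" if r: "r \<in> R" for r
    proof -
      obtain r' where "r' \<in> R" "\<sigma> r = var r'" using im[OF r] by auto
      moreover have "M r (\<sigma> r) \<noteq> 0" using nz fin r by auto
      ultimately show "w (\<sigma> r) \<le> w (var r)" "\<sigma> r \<noteq> var r \<Longrightarrow> w (\<sigma> r) < w (var r)"
        using less[of r r'] r by (metis order_refl less_imp_le)+
    qed
    \<comment> \<open>Both maps have the same fibre sizes, hence the same total weight; no row
      exceeds the weight of \<open>var r\<close>, so every row attains it.\<close>
    have "(\<Sum>r\<in>R. w (\<sigma> r)) = (\<Sum>r | r \<in> R \<and> \<sigma> r \<in> var ` R. w (\<sigma> r))"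
      using im by (intro sum.cong) auto
    also have "\<dots> = (\<Sum>f\<in>var ` R. card {r \<in> R. \<sigma> r = f} * w f)"
      using fin by (simp add: sum_card_fibres)
    also have "\<dots> = (\<Sum>f\<in>var ` R. card {r \<in> R. var r = f} * w f)"
      using \<sigma> by (intro sum.cong) (auto simp: S_def \<eta>_def)
    also have "\<dots> = (\<Sum>r | r \<in> R \<and> var r \<in> var ` R. w (var r))"
      using fin by (simp add: sum_card_fibres)
    also have "\<dots> = (\<Sum>r\<in>R. w (var r))" by (intro sum.cong) auto
    finally have "\<forall>r\<in>R. w (\<sigma> r) = w (var r)"
      using sum_mono_inv[of "\<lambda>r. w (\<sigma> r)" R "\<lambda>r. w (var r)"] le(1) fin by blast
    then have "\<forall>r\<in>R. \<sigma> r = var r" using le(2) by force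
    then show ?thesis using \<sigma> by (auto simp: S_def fun_eq_iff PiE_def extensional_def)
  qed
  have "restrict var R \<in> S"
    unfolding S_def \<eta>_def by (auto intro!: arg_cong[of _ _ card])
  then have "(\<Sum>\<sigma>\<in>S. \<Prod>r\<in>R. M r (\<sigma> r)) = (\<Sum>\<sigma>\<in>{restrict var R}. \<Prod>r\<in>R. M r (\<sigma> r))"
    using eq finS by (intro sum.mono_neutral_right) auto
  then have "form_coeff R (var ` R) M \<eta> = (\<Prod>r\<in>R. M r (var r))"
    by (simp add: form_coeff_def S_def)
  moreover have "\<not> m dvd (\<Prod>r\<in>R. M r (var r))"
    using m lead fin by (auto simp: prime_dvd_prod_iff)
  ultimately show ?thesis using two by (intro goodI[of _ \<eta>]) (auto simp: \<eta>_def)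
qed

text \<open>Once each row is multiplied by its sign, all entries are nonnegative. The terms of the
  coefficient then cannot cancel, and the term of \<open>var\<close> is positive.\<close>

lemma good_positive:
  assumes fin: "finite R" "finite F"
    and sg: "\<And>r. r \<in> R \<Longrightarrow> sg r \<in> {1, -1 :: int}"
    and nonneg: "\<And>r f. r \<in> R \<Longrightarrow> f \<in> F \<Longrightarrow> 0 \<le> sg r * M r f"
    and var: "\<And>r. r \<in> R \<Longrightarrow> var r \<in> F" "\<And>r. r \<in> R \<Longrightarrow> M r (var r) \<noteq> 0"
    and two: "\<And>f. card {r \<in> R. var r = f} \<le> 2"
  shows "good 0 R F M"
proof -
  define \<eta> where "\<eta> f = card {r \<in> R. var r = f}" for f
  define S where "S = {\<sigma>. \<sigma> \<in> R \<rightarrow>\<^sub>E F \<and> (\<forall>f\<in>F. card {r \<in> R. \<sigma> r = f} = \<eta> f)}"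
  have finS: "finite S" unfolding S_def
    by (rule finite_subset[of _ "R \<rightarrow>\<^sub>E F"]) (use fin in \<open>auto intro!: finite_PiE\<close>)
  have "restrict var R \<in> S"
    unfolding S_def \<eta>_def using var by (auto intro!: arg_cong[of _ _ card])
  moreover have "0 < (\<Prod>r\<in>R. sg r * M r (restrict var R r))"
    using var nonneg sg by (intro prod_pos) (force simp: less_le)
  moreover have "0 \<le> (\<Prod>r\<in>R. sg r * M r (\<sigma> r))" if "\<sigma> \<in> S" for \<sigma>
    using that nonneg by (intro prod_nonneg) (auto simp: S_def)
  ultimately have "0 < (\<Sum>\<sigma>\<in>S. \<Prod>r\<in>R. sg r * M r (\<sigma> r))"
    using finS by (intro sum_pos2[of S "restrict var R"])
  also have "\<dots> = (\<Prod>r\<in>R. sg r) * form_coeff R F M \<eta>"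
    by (simp add: form_coeff_def S_def prod.distrib sum_distrib_left)
  finally have "form_coeff R F M \<eta> \<noteq> 0" by auto
  then show ?thesis using two by (intro goodI[of _ \<eta>]) (auto simp: \<eta>_def)
qed

section \<open>From coefficients to permanents\<close>

text \<open>This is the coefficient of y_f in s_v - s_u for \<open>e\<close> directed from u to v.
  For \<open>f = e\<close> the two terms cancel, so the column of \<open>e\<close> needs no
  exception as in \<open>graph_matrix\<close>.\<close>

definition edge_form :: "('a set \<Rightarrow> 'a \<times> 'a) \<Rightarrow> 'a set \<Rightarrow> 'a set \<Rightarrow> int" where
  "edge_form D e f = of_bool (snd (D e) \<in> f) - of_bool (fst (D e) \<in> f)"

lemma simple_graph_edgeE:
  assumes "simple_graph V E" "e \<in> E"
  obtains u v where "u \<in> V" "v \<in> V" "u \<noteq> v" "e = {u, v}"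
  using assms unfolding simple_graph_def by blast

lemma simple_graph_edge_eq:
  assumes "simple_graph V E" "f \<in> E" "a \<in> f" "b \<in> f" "a \<noteq> b"
  shows "f = {a, b}"
proof -
  obtain u v where "f = {u, v}" using simple_graph_edgeE[OF assms(1,2)] .
  then show ?thesis using assms(3-5) by auto
qed

lemma graph_matrix_edge:
  assumes "simple_graph V E" "orientation E D" "e \<in> E" "f \<in> E"
  shows "graph_matrix D e (Inr f) = edge_form D e f"
proof -
  have e: "e = {fst (D e), snd (D e)}" using assms by (auto simp: orientation_def)
  moreover have "fst (D e) \<noteq> snd (D e)"
    using e assms(1,3) unfolding simple_graph_def by (metis doubleton_eq_iff insert_absorb2)
  moreover have "f = e" if "fst (D e) \<in> f" "snd (D e) \<in> f"
    using simple_graph_edge_eq[OF assms(1,4) that] calculation by metis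
  moreover have "fst (D e) \<in> e" "snd (D e) \<in> e" using e by auto
  ultimately show ?thesis by (auto simp: graph_matrix_def edge_form_def)
qed

text \<open>Forgetting the copy numbers of the columns sends the bijections of the permanent to the
  maps counted by \<open>form_coeff\<close>. All fibres have the same size \<open>K\<close>, the
  number of ways to permute copies of equal columns.\<close>

lemma permanent_repeated_columns:
  fixes V :: "'a set" and \<eta> :: "'a set \<Rightarrow> nat"
  assumes fin: "finite E"
  defines "C \<equiv> repeated_columns V E (case_sum (\<lambda>_. 0) \<eta>)"
  obtains K where "K > 0" and
    "permanent E C (repeated_matrix D) = int K * form_coeff E E (\<lambda>e f. graph_matrix D e (Inr f)) \<eta>"
proof -
  define pr where "pr c = projr (fst c)" for c :: "('a + 'a set) \<times> nat"
  have C_eq: "C = (\<Union>f\<in>E. (\<lambda>i. (Inr f, i)) ` {..<\<eta> f})"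
    by (auto simp: C_def repeated_columns_def)
  have finC: "finite C" using fin by (auto simp: C_eq)
  have prC: "fst c = Inr (pr c)" "pr c \<in> E" if "c \<in> C" for c
    using that by (auto simp: C_eq pr_def)
  have cardC: "card {c \<in> C. pr c = f} = \<eta> f" if "f \<in> E" for f
  proof -
    have "{c \<in> C. pr c = f} = (\<lambda>i. (Inr f, i)) ` {..<\<eta> f}" using that by (auto simp: C_eq pr_def)
    then show ?thesis by (simp add: card_image inj_on_def)
  qed
  define S where "S = {\<sigma> \<in> E \<rightarrow>\<^sub>E C. bij_betw \<sigma> E C}"
  define U where "U = {\<tau>. \<tau> \<in> E \<rightarrow>\<^sub>E E \<and> (\<forall>f\<in>E. card {e \<in> E. \<tau> e = f} = \<eta> f)}"
  define q where "q \<sigma> = restrict (\<lambda>e. pr (\<sigma> e)) E" for \<sigma> :: "'a set \<Rightarrow> ('a + 'a set) \<times> nat"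
  \<comment> \<open>\<open>P\<close> permutes the copies of each column among themselves; its order
    is the product of the factorials of the exponents.\<close>
  define P where "P = {\<pi> \<in> C \<rightarrow>\<^sub>E C. bij_betw \<pi> C C \<and> (\<forall>c\<in>C. fst (\<pi> c) = fst c)}"
  have finS: "finite S" unfolding S_def
    by (rule finite_subset[of _ "E \<rightarrow>\<^sub>E C"]) (use fin finC in \<open>auto intro!: finite_PiE\<close>)
  have finU: "finite U" unfolding U_def
    by (rule finite_subset[of _ "E \<rightarrow>\<^sub>E E"]) (use fin in \<open>auto intro!: finite_PiE\<close>)
  have finP: "finite P" unfolding P_def
    by (rule finite_subset[of _ "C \<rightarrow>\<^sub>E C"]) (use finC in \<open>auto intro!: finite_PiE\<close>)
  have "restrict id C \<in> P" by (auto simp: P_def bij_betw_def inj_on_def)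
  then have "card P > 0" using finP by (auto simp: card_gt_0_iff)
  have qU: "q ` S \<subseteq> U"
  proof
    fix \<tau> assume "\<tau> \<in> q ` S"
    then obtain \<sigma> where \<sigma>: "\<tau> = q \<sigma>" "\<sigma> \<in> E \<rightarrow>\<^sub>E C" "bij_betw \<sigma> E C" by (auto simp: S_def)
    have "card {e \<in> E. \<tau> e = f} = \<eta> f" if "f \<in> E" for f
    proof -
      have "{c \<in> C. pr c = f} = \<sigma> ` {e \<in> E. \<tau> e = f}"
        using \<sigma> unfolding bij_betw_def q_def by auto
      moreover have "inj_on \<sigma> {e \<in> E. \<tau> e = f}"
        using \<sigma>(3) by (auto simp: bij_betw_def inj_on_def)
      ultimately show ?thesis using cardC[OF that] by (simp add: card_image)
    qed
    moreover have "\<tau> \<in> E \<rightarrow>\<^sub>E E"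
      using prC(2)[OF PiE_mem[OF \<sigma>(2)]] by (auto simp: \<sigma>(1) q_def)
    ultimately show "\<tau> \<in> U" by (simp add: U_def)
  qed
  have fibre: "card {\<sigma> \<in> S. q \<sigma> = \<tau>} = card P" if \<tau>: "\<tau> \<in> U" for \<tau>
  proof -
    have "\<exists>h. bij_betw h {e \<in> E. \<tau> e = f} {..<\<eta> f}" if "f \<in> E" for f
    proof (rule finite_same_card_bij)
      show "card {e \<in> E. \<tau> e = f} = card {..<\<eta> f}" using \<tau> that unfolding U_def by simp
    qed (use fin in simp_all)
    then obtain h where h: "\<And>f. f \<in> E \<Longrightarrow> bij_betw (h f) {e \<in> E. \<tau> e = f} {..<\<eta> f}"
      by metis
    \<comment> \<open>One bijection above \<open>\<tau>\<close>. Composing with its inverse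
      identifies the whole fibre with \<open>P\<close>.\<close>
    define \<sigma>0 where "\<sigma>0 = restrict (\<lambda>e. (Inr (\<tau> e) :: 'a + 'a set, h (\<tau> e) e)) E"
    have \<tau>E: "\<tau> e \<in> E" if "e \<in> E" for e using \<tau> that by (auto simp: U_def)
    have "inj_on \<sigma>0 E"
    proof (rule inj_onI)
      fix e e' assume "e \<in> E" "e' \<in> E" "\<sigma>0 e = \<sigma>0 e'"
      then show "e = e'"
        using h[OF \<tau>E, of e] by (auto simp: \<sigma>0_def bij_betw_def inj_on_def)
    qed
    moreover have "\<sigma>0 ` E = C"
    proof
      show "\<sigma>0 ` E \<subseteq> C"
      proof
        fix c assume "c \<in> \<sigma>0 ` E"
        then obtain e where "e \<in> E" "c = \<sigma>0 e" by auto
        moreover then have "h (\<tau> e) e < \<eta> (\<tau> e)"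
          using h[OF \<tau>E, of e] by (auto simp: bij_betw_def)
        ultimately show "c \<in> C" using \<tau>E by (auto simp: C_eq \<sigma>0_def)
      qed
      show "C \<subseteq> \<sigma>0 ` E"
      proof
        fix c assume "c \<in> C"
        then obtain f i where c: "f \<in> E" "i < \<eta> f" "c = (Inr f, i)" by (auto simp: C_eq)
        then have "i \<in> h f ` {e \<in> E. \<tau> e = f}"
          using bij_betw_imp_surj_on[OF h[OF c(1)]] by simp
        then obtain e where "e \<in> E" "\<tau> e = f" "h f e = i" by auto
        then show "c \<in> \<sigma>0 ` E" using c by (auto simp: \<sigma>0_def image_iff)
      qed
    qed
    ultimately have bij0: "bij_betw \<sigma>0 E C" by (simp add: bij_betw_def)
    define g where "g = inv_into E \<sigma>0"
    have g: "g c \<in> E" "\<sigma>0 (g c) = c" if "c \<in> C" for c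
      using that bij0 unfolding g_def bij_betw_def by (auto intro: inv_into_into f_inv_into_f)
    have g0: "g (\<sigma>0 e) = e" if "e \<in> E" for e
      using that bij0 unfolding g_def bij_betw_def by auto
    have bijg: "bij_betw g C E" unfolding g_def by (rule bij_betw_inv_into[OF bij0])
    have fst0: "fst (\<sigma>0 e) = Inr (\<tau> e)" if "e \<in> E" for e using that by (simp add: \<sigma>0_def)
    have "bij_betw (\<lambda>\<sigma>. restrict (\<sigma> \<circ> g) C) {\<sigma> \<in> S. q \<sigma> = \<tau>} P"
    proof (rule bij_betw_byWitness[where f' = "\<lambda>\<pi>. restrict (\<pi> \<circ> \<sigma>0) E"])
      show "\<forall>\<sigma>\<in>{\<sigma> \<in> S. q \<sigma> = \<tau>}. restrict (restrict (\<sigma> \<circ> g) C \<circ> \<sigma>0) E = \<sigma>"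
        using bij0 g0 by (auto simp: S_def fun_eq_iff PiE_def extensional_def bij_betw_def)
      show "\<forall>\<pi>\<in>P. restrict (restrict (\<pi> \<circ> \<sigma>0) E \<circ> g) C = \<pi>"
        using g by (auto simp: P_def fun_eq_iff PiE_def extensional_def)
      show "(\<lambda>\<sigma>. restrict (\<sigma> \<circ> g) C) ` {\<sigma> \<in> S. q \<sigma> = \<tau>} \<subseteq> P"
      proof (rule image_subsetI)
        fix \<sigma> assume "\<sigma> \<in> {\<sigma> \<in> S. q \<sigma> = \<tau>}"
        then have \<sigma>: "\<sigma> \<in> E \<rightarrow>\<^sub>E C" "bij_betw \<sigma> E C" "\<And>e. e \<in> E \<Longrightarrow> pr (\<sigma> e) = \<tau> e"
          by (auto simp: S_def q_def)
        have "bij_betw (restrict (\<sigma> \<circ> g) C) C C"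
          using bij_betw_trans[OF bijg \<sigma>(2)] by (simp add: bij_betw_restrict_eq)
        moreover have "fst (restrict (\<sigma> \<circ> g) C c) = fst c" if "c \<in> C" for c
        proof -
          have "\<sigma> (g c) \<in> C" using \<sigma>(1) g(1)[OF that] by auto
          then have "fst (\<sigma> (g c)) = Inr (\<tau> (g c))" using prC(1) \<sigma>(3) g(1)[OF that] by metis
          also have "\<dots> = fst c" using fst0[OF g(1)[OF that]] g(2)[OF that] by simp
          finally show ?thesis using that by simp
        qed
        moreover have "restrict (\<sigma> \<circ> g) C \<in> C \<rightarrow>\<^sub>E C" using \<sigma>(1) g(1) by auto
        ultimately show "restrict (\<sigma> \<circ> g) C \<in> P" by (simp add: P_def)
      qed
      show "(\<lambda>\<pi>. restrict (\<pi> \<circ> \<sigma>0) E) ` P \<subseteq> {\<sigma> \<in> S. q \<sigma> = \<tau>}"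
      proof (rule image_subsetI)
        fix \<pi> assume "\<pi> \<in> P"
        then have \<pi>: "\<pi> \<in> C \<rightarrow>\<^sub>E C" "bij_betw \<pi> C C" "\<And>c. c \<in> C \<Longrightarrow> fst (\<pi> c) = fst c"
          by (auto simp: P_def)
        have s0: "\<sigma>0 e \<in> C" if "e \<in> E" for e using that bij0 by (auto simp: bij_betw_def)
        have "bij_betw (restrict (\<pi> \<circ> \<sigma>0) E) E C"
          using bij_betw_trans[OF bij0 \<pi>(2)] by (simp add: bij_betw_restrict_eq)
        moreover have "restrict (\<pi> \<circ> \<sigma>0) E \<in> E \<rightarrow>\<^sub>E C" using \<pi>(1) s0 by auto
        moreover have "q (restrict (\<pi> \<circ> \<sigma>0) E) e = \<tau> e" for e
          using \<pi>(3)[OF s0, of e] fst0[of e] \<tau> by (auto simp: q_def pr_def U_def)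
        ultimately show "restrict (\<pi> \<circ> \<sigma>0) E \<in> {\<sigma> \<in> S. q \<sigma> = \<tau>}" by (auto simp: S_def)
      qed
    qed
    then show ?thesis by (rule bij_betw_same_card)
  qed
  have "permanent E C (repeated_matrix D) = (\<Sum>\<sigma>\<in>S. \<Prod>e\<in>E. graph_matrix D e (Inr (q \<sigma> e)))"
    unfolding permanent_def S_def
  proof (intro sum.cong prod.cong refl)
    fix \<sigma> e assume "\<sigma> \<in> {\<sigma> \<in> E \<rightarrow>\<^sub>E C. bij_betw \<sigma> E C}" "e \<in> E"
    then have "\<sigma> e \<in> C" by auto
    then show "repeated_matrix D e (\<sigma> e) = graph_matrix D e (Inr (q \<sigma> e))"
      using prC(1)[of "\<sigma> e"] \<open>e \<in> E\<close> by (simp add: repeated_matrix_def q_def)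
  qed
  also have "\<dots> = (\<Sum>\<tau>\<in>U. \<Sum>\<sigma>\<in>{\<sigma> \<in> S. q \<sigma> = \<tau>}. \<Prod>e\<in>E. graph_matrix D e (Inr (q \<sigma> e)))"
    by (rule sum.group[OF finS finU qU, symmetric])
  also have "\<dots> = (\<Sum>\<tau>\<in>U. int (card P) * (\<Prod>e\<in>E. graph_matrix D e (Inr (\<tau> e))))"
    using fibre by (intro sum.cong) auto
  also have "\<dots> = int (card P) * form_coeff E E (\<lambda>e f. graph_matrix D e (Inr f)) \<eta>"
    by (simp add: form_coeff_def U_def sum_distrib_left)
  finally show ?thesis using that \<open>card P > 0\<close> by blast
qed

lemma simple_graph_finite_edges: "simple_graph V E \<Longrightarrow> finite E"
proof (rule finite_subset)
  assume G: "simple_graph V E"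
  show "E \<subseteq> Pow V" by (auto elim!: simple_graph_edgeE[OF G])
  show "finite (Pow V)" using G by (simp add: simple_graph_def)
qed

lemma has_perm_nonsingular_matrixI:
  assumes "simple_graph V E" "orientation E D" "good 0 E E (edge_form D)"
  shows "has_perm_nonsingular_matrix V E D 0 2"
proof -
  have fin: "finite E" "finite V"
    using assms(1) simple_graph_finite_edges by (auto simp: simple_graph_def)
  have "good 0 E E (\<lambda>e f. graph_matrix D e (Inr f))"
    using assms(3) by (rule good_cong) (simp add: graph_matrix_edge[OF assms(1,2)])
  then obtain \<eta> where \<eta>: "\<forall>f\<in>E. \<eta> f \<le> 2" "form_coeff E E (\<lambda>e f. graph_matrix D e (Inr f)) \<eta> \<noteq> 0"
    by (auto simp: good_def)
  let ?\<zeta> = "case_sum (\<lambda>_. 0) \<eta> :: 'a + 'a set \<Rightarrow> nat"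
  obtain K where "K > 0" "permanent E (repeated_columns V E ?\<zeta>) (repeated_matrix D) =
      int K * form_coeff E E (\<lambda>e f. graph_matrix D e (Inr f)) \<eta>"
    using permanent_repeated_columns[OF fin(1)] .
  then have "permanent E (repeated_columns V E ?\<zeta>) (repeated_matrix D) \<noteq> 0" using \<eta>(2) by simp
  moreover have "(\<Sum>f\<in>E. \<eta> f) = card E"
    by (rule form_coeff_degree[OF fin(1) fin(1) \<eta>(2)])
  then have "ab_index V E 0 2 ?\<zeta>"
    using \<eta>(1) fin by (simp add: ab_index_def sum.Plus)
  ultimately show ?thesis unfolding has_perm_nonsingular_matrix_def by blast
qed


section \<open>Rooted trees\<close>

text \<open>Trees enter the later arguments mainly through parents and depths.
  \<open>edge_par\<close> carries acyclicity: there are no edges other than those from a vertex to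
  its parent. The value of \<open>par\<close> at the root is unspecified.\<close>

locale rooted_tree =
  fixes V :: "'a set" and T :: "'a set set" and r :: 'a and par :: "'a \<Rightarrow> 'a" and dep :: "'a \<Rightarrow> nat"
  assumes finV: "finite V" and rV: "r \<in> V" and dep_r: "dep r = 0"
    and edgeV: "{u, v} \<in> T \<Longrightarrow> u \<in> V \<and> v \<in> V \<and> u \<noteq> v"
    and edge_pair: "e \<in> T \<Longrightarrow> \<exists>u v. e = {u, v}"
    and par: "v \<in> V \<Longrightarrow> v \<noteq> r \<Longrightarrow> par v \<in> V \<and> {v, par v} \<in> T \<and> dep v = Suc (dep (par v))"
    and edge_par: "{u, v} \<in> T \<Longrightarrow> u \<noteq> r \<and> par u = v \<or> v \<noteq> r \<and> par v = u"

text \<open>Depth is the distance from the root and the parent is a neighbour one step closer. Any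
  further edge would close a cycle with the ancestor paths of its two ends, cut where they first
  meet.\<close>

lemma tree_graph_rooted:
  assumes tree: "tree_graph V T" and r: "r \<in> V"
  shows "\<exists>par dep. rooted_tree V T r par dep"
proof -
  have sg: "simple_graph V T" and con: "connected_graph V T" and acyc: "acyclic_graph T"
    using tree by (auto simp: tree_graph_def)
  let ?adj = "\<lambda>x y. {x, y} \<in> T"
  have edge: "u \<in> V \<and> v \<in> V \<and> u \<noteq> v" if uv: "{u, v} \<in> T" for u v
  proof -
    obtain x y where "x \<in> V" "y \<in> V" "x \<noteq> y" "{u, v} = {x, y}"
      using simple_graph_edgeE[OF sg uv] .
    then show ?thesis by (auto simp: doubleton_eq_iff)
  qed
  define dep where "dep v = (LEAST k. (?adj ^^ k) r v)" for v
  have dep: "(?adj ^^ dep v) r v" if "v \<in> V" for v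
  proof -
    have "?adj\<^sup>*\<^sup>* r v" using con r that by (auto simp: connected_graph_def)
    then obtain k where "(?adj ^^ k) r v" by (auto dest: rtranclp_imp_relpowp)
    then show ?thesis unfolding dep_def by (rule LeastI)
  qed
  have dep_le: "dep v \<le> k" if "(?adj ^^ k) r v" for v k
    unfolding dep_def using that by (rule Least_le)
  have dep_r: "dep r = 0" using dep_le[of 0 r] by simp
  have "\<exists>u. u \<in> V \<and> {v, u} \<in> T \<and> dep v = Suc (dep u)" if v: "v \<in> V" "v \<noteq> r" for v
  proof -
    have "dep v \<noteq> 0" using dep[OF v(1)] v(2) by (metis relpowp_0_E)
    then obtain k where k: "dep v = Suc k" using not0_implies_Suc by blast
    then obtain u where u: "(?adj ^^ k) r u" "{u, v} \<in> T"
      using dep[OF v(1)] by (auto elim: relpowp_Suc_E)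
    then have uV: "u \<in> V" using edge by blast
    have "(?adj ^^ Suc (dep u)) r v" using dep[OF uV] u(2) by (rule relpowp_Suc_I)
    then have "dep v = Suc (dep u)" using dep_le[of "Suc (dep u)" v] dep_le[OF u(1)] k by linarith
    then show ?thesis using uV u(2) by (auto simp: insert_commute)
  qed
  then obtain par where par: "\<And>v. v \<in> V \<Longrightarrow> v \<noteq> r \<Longrightarrow> par v \<in> V \<and> {v, par v} \<in> T \<and> dep v = Suc (dep (par v))"
    by metis
  have anc: "(par ^^ k) v \<in> V \<and> dep ((par ^^ k) v) = dep v - k" if "v \<in> V" "k \<le> dep v" for v k
    using that(2)
  proof (induction k)
    case (Suc k)
    then have "(par ^^ k) v \<noteq> r" using dep_r by auto
    then show ?case using Suc par[of "(par ^^ k) v"] by auto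
  qed (simp add: that)
  have anc_edge: "{(par ^^ k) v, (par ^^ Suc k) v} \<in> T" if "v \<in> V" "k < dep v" for v k
  proof -
    have "(par ^^ k) v \<noteq> r" using anc[of v k] that dep_r by auto
    then show ?thesis using par[of "(par ^^ k) v"] anc[of v k] that by auto
  qed
  have "u \<noteq> r \<and> par u = v \<or> v \<noteq> r \<and> par v = u" if uv: "{u, v} \<in> T" for u v
  proof (rule ccontr)
    assume not_par: "\<not> ?thesis"
    have u: "u \<in> V" and v: "v \<in> V" and "u \<noteq> v" using edge[OF uv] by auto
    have root: "(par ^^ dep x) x = r" if "x \<in> V" for x
      using anc[OF that, of "dep x"] dep[of "(par ^^ dep x) x"] by auto
    \<comment> \<open>The first point on the way up from \<open>u\<close> that is also an ancestor
      of \<open>v\<close>; minimality makes the cycle below simple.\<close>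
    define i where "i = (LEAST i. i \<le> dep u \<and> (\<exists>j\<le>dep v. (par ^^ i) u = (par ^^ j) v))"
    have ex: "dep u \<le> dep u \<and> (\<exists>j\<le>dep v. (par ^^ dep u) u = (par ^^ j) v)"
      using root[OF u] root[OF v] by auto
    then have "i \<le> dep u \<and> (\<exists>j\<le>dep v. (par ^^ i) u = (par ^^ j) v)"
      unfolding i_def by (rule LeastI)
    then obtain j where i: "i \<le> dep u" and j: "j \<le> dep v" and ij: "(par ^^ i) u = (par ^^ j) v" by blast
    have min: "(par ^^ k) u \<noteq> (par ^^ l) v" if "k < i" "l \<le> dep v" for k l
      using not_less_Least[of k "\<lambda>i. i \<le> dep u \<and> (\<exists>j\<le>dep v. (par ^^ i) u = (par ^^ j) v)"] that i
      unfolding i_def[symmetric] by auto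
    \<comment> \<open>Up from \<open>u\<close> to the meeting point and down to \<open>v\<close>;
      the meeting point is contributed by the first part only.\<close>
    define xs where "xs = map (\<lambda>k. (par ^^ k) u) [0..<Suc i] @ rev (map (\<lambda>k. (par ^^ k) v) [0..<j])"
    have len: "length xs = Suc (i + j)" by (simp add: xs_def)
    have nth1: "xs ! t = (par ^^ t) u" if "t \<le> i" for t
      using that by (auto simp: xs_def nth_append simp del: upt_Suc)
    have nth2: "xs ! t = (par ^^ (i + j - t)) v" if "i \<le> t" "t \<le> i + j" for t
    proof (cases "t = i")
      case True
      then show ?thesis using nth1[of i] ij by simp
    next
      case False
      then have "t - Suc i < j" using that by linarith
      then have "xs ! t = (par ^^ (j - Suc (t - Suc i))) v"
        using that False by (auto simp: xs_def nth_append rev_nth simp del: upt_Suc)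
      moreover have "j - Suc (t - Suc i) = i + j - t" using that False by linarith
      ultimately show ?thesis by simp
    qed
    have inj: "inj_on (\<lambda>k. (par ^^ k) x) {..dep x}" if "x \<in> V" for x
    proof (rule inj_onI)
      fix k l assume "k \<in> {..dep x}" "l \<in> {..dep x}" "(par ^^ k) x = (par ^^ l) x"
      then have "dep x - k = dep x - l" using anc[OF that] by (metis atMost_iff)
      then show "k = l" using \<open>k \<in> {..dep x}\<close> \<open>l \<in> {..dep x}\<close> by auto
    qed
    have "distinct xs"
    proof -
      have "(par ^^ k) u \<noteq> (par ^^ l) v" if "k \<le> i" "l < j" for k l
      proof (cases "k = i")
        case True
        then show ?thesis using ij inj_onD[OF inj[OF v], of j l] that j by auto
      next
        case False
        then show ?thesis using min[of k l] that j by auto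
      qed
      moreover have "inj_on (\<lambda>k. (par ^^ k) u) {0..<Suc i}"
        using i by (intro inj_on_subset[OF inj[OF u]]) auto
      moreover have "inj_on (\<lambda>k. (par ^^ k) v) {0..<j}"
        using j by (intro inj_on_subset[OF inj[OF v]]) auto
      ultimately show ?thesis
        unfolding xs_def by (auto simp: distinct_map less_Suc_eq_le simp del: upt_Suc)
    qed
    \<comment> \<open>The three cases excluded here are those with i + j < 2, in which the list
      would be too short for a cycle.\<close>
    moreover have "i + j \<noteq> 0"
    proof
      assume "i + j = 0"
      then have "i = 0" "j = 0" by simp_all
      then show False using ij \<open>u \<noteq> v\<close> by simp
    qed
    moreover have "\<not> (i = 1 \<and> j = 0)"
    proof
      assume *: "i = 1 \<and> j = 0"
      then have "par u = v" using ij by simp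
      moreover have "u \<noteq> r" using * i dep_r by auto
      ultimately show False using not_par by blast
    qed
    moreover have "\<not> (i = 0 \<and> j = 1)"
    proof
      assume *: "i = 0 \<and> j = 1"
      then have "par v = u" using ij by simp
      moreover have "v \<noteq> r" using * j dep_r by auto
      ultimately show False using not_par by blast
    qed
    ultimately have "cycle_seq xs" unfolding cycle_seq_def len by linarith
    moreover have "cycle_edges xs \<subseteq> T"
    proof
      fix e assume "e \<in> cycle_edges xs"
      then obtain t where t: "t < length xs" "e = {xs ! t, xs ! (Suc t mod length xs)}"
        by (auto simp: cycle_edges_def)
      consider "t < i" | "i \<le> t" "t < i + j" | "t = i + j" using t len by linarith
      then show "e \<in> T"
      proof cases
        case 1
        then show ?thesis using t len nth1[of t] nth1[of "Suc t"] anc_edge[OF u, of t] i by auto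
      next
        case 2
        have "i + j - t = Suc (i + j - Suc t)" using 2 by linarith
        moreover have "{(par ^^ (i + j - Suc t)) v, (par ^^ Suc (i + j - Suc t)) v} \<in> T"
          using 2 j by (intro anc_edge[OF v]) linarith
        ultimately show ?thesis
          using 2 t len nth2[of t] nth2[of "Suc t"] by (auto simp: insert_commute simp del: funpow.simps)
      next
        case 3
        then show ?thesis using t len nth1[of 0] nth2[of "i + j"] uv by (auto simp: insert_commute)
      qed
    qed
    ultimately show False using acyc by (auto simp: acyclic_graph_def)
  qed
  then have "rooted_tree V T r par dep"
  proof (unfold_locales)
    show "\<exists>u v. e = {u, v}" if "e \<in> T" for e using simple_graph_edgeE[OF sg that] by blast
  qed (use sg edge par r dep_r in \<open>simp_all add: simple_graph_def\<close>)
  then show ?thesis by blast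
qed

section \<open>Vertices as variables modulo 3\<close>

text \<open>The form X_v - X_u in vertex variables; substituting the vertex sums s_v for X_v turns
  it into \<open>edge_form\<close>.\<close>

definition vertex_form :: "('a set \<Rightarrow> 'a \<times> 'a) \<Rightarrow> 'a set \<Rightarrow> 'a \<Rightarrow> int" where
  "vertex_form D e v = of_bool (snd (D e) = v) - of_bool (fst (D e) = v)"

lemma orientationD: "orientation E D \<Longrightarrow> e \<in> E \<Longrightarrow> e = {fst (D e), snd (D e)}"
  unfolding orientation_def by blast

lemma orientation_cases:
  assumes "orientation E D" "{a, b} \<in> E"
  obtains "D {a, b} = (a, b)" | "D {a, b} = (b, a)"
proof -
  obtain x y where xy: "D {a, b} = (x, y)" by (cases "D {a, b}")
  then have "{a, b} = {x, y}" using orientationD[OF assms] by simp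
  then have "a = x \<and> b = y \<or> a = y \<and> b = x" by (simp add: doubleton_eq_iff)
  then show ?thesis using that xy by blast
qed

text \<open>This says that \<open>g\<close> lies in the image of the unsigned vertex-edge incidence
  matrix over the field with three elements.\<close>

definition realizable :: "'a set \<Rightarrow> 'a set set \<Rightarrow> ('a \<Rightarrow> int) \<Rightarrow> bool" where
  "realizable V E g \<longleftrightarrow> (\<exists>b. \<forall>x\<in>V. [(\<Sum>f | f \<in> E \<and> x \<in> f. b f) = g x] (mod 3))"

lemma realizable_lin:
  assumes "realizable V E g" "realizable V E h"
  shows "realizable V E (\<lambda>x. g x + k * h x)"
proof -
  obtain b c where b: "\<forall>x\<in>V. [(\<Sum>f | f \<in> E \<and> x \<in> f. b f) = g x] (mod 3)"
    and c: "\<forall>x\<in>V. [(\<Sum>f | f \<in> E \<and> x \<in> f. c f) = h x] (mod 3)"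
    using assms by (auto simp: realizable_def)
  have "[(\<Sum>f | f \<in> E \<and> x \<in> f. b f + k * c f) = g x + k * h x] (mod 3)" if "x \<in> V" for x
    using b c that by (auto simp: sum.distrib sum_distrib_left[symmetric] intro!: cong_add cong_mult)
  then show ?thesis by (auto simp: realizable_def)
qed

lemma realizable_cong:
  assumes "realizable V E g" "\<And>x. x \<in> V \<Longrightarrow> [g x = h x] (mod 3)"
  shows "realizable V E h"
  using assms unfolding realizable_def by (meson cong_trans)

text \<open>Weights 1, -1, 1, ... on the successive edges of the walk telescope and leave only its
  ends.\<close>

lemma realizable_walk:
  assumes fin: "finite E"
    and walk: "((\<lambda>x y. {x, y} \<in> E \<and> x \<noteq> y) ^^ k) u w"
  shows "realizable V E (\<lambda>x. of_bool (x = u) - (-1) ^ k * of_bool (x = w))"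
  using walk
proof (induction k arbitrary: w)
  case 0
  then have "u = w" by simp
  then show ?case by (auto simp: realizable_def intro!: exI[of _ "\<lambda>_. 0"])
next
  case (Suc k)
  then obtain v where v: "((\<lambda>x y. {x, y} \<in> E \<and> x \<noteq> y) ^^ k) u v" "{v, w} \<in> E" "v \<noteq> w"
    by (auto elim: relpowp_Suc_E)
  have "(\<Sum>f | f \<in> E \<and> x \<in> f. of_bool (f = {v, w})) = of_bool (x = v) + (of_bool (x = w) :: int)" for x
  proof -
    have "(\<Sum>f | f \<in> E \<and> x \<in> f. of_bool (f = {v, w})) = (of_bool (x \<in> {v, w}) :: int)"
      using fin v(2) by (simp add: of_bool_def)
    then show ?thesis using v(3) by auto
  qed
  then have "realizable V E (\<lambda>x. of_bool (x = v) + of_bool (x = w))"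
    by (auto simp: realizable_def intro!: exI[of _ "\<lambda>f. of_bool (f = {v, w})"])
  from realizable_lin[OF Suc.IH[OF v(1)] this, of "(-1) ^ k"] show ?case
    by (simp add: algebra_simps)
qed

text \<open>The even walk and the edge between its ends realize both the difference and the sum of
  the unit vectors at \<open>a\<close> and \<open>b\<close>, hence twice the unit vector at
  \<open>a\<close>, and 2 is invertible modulo 3. Walks from \<open>a\<close> then realize every
  unit vector, so a substitution of edge variables can imitate free vertex variables.\<close>

lemma good_3_vertex_form:
  assumes G: "simple_graph V E" and con: "connected_graph V E" and D: "orientation E D"
    and odd: "{a, b} \<in> E" "even k" "((\<lambda>x y. {x, y} \<in> E) ^^ k) a b"
    and good: "good 3 E V (vertex_form D)"
  shows "good 0 E E (edge_form D)"
proof -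
  have fin: "finite E" "finite V"
    using G simple_graph_finite_edges by (auto simp: simple_graph_def)
  have edge: "u \<in> V \<and> v \<in> V \<and> u \<noteq> v" if uv: "{u, v} \<in> E" for u v
  proof -
    obtain x y where "x \<in> V" "y \<in> V" "x \<noteq> y" "{u, v} = {x, y}"
      using simple_graph_edgeE[OF G uv] .
    then show ?thesis by (auto simp: doubleton_eq_iff)
  qed
  have adj: "(\<lambda>x y. {x, y} \<in> E \<and> x \<noteq> y) = (\<lambda>x y. {x, y} \<in> E)"
    using edge by (auto simp: fun_eq_iff)
  note walk = realizable_walk[OF fin(1), unfolded adj, where V = V]
  let ?\<delta> = "\<lambda>v x. of_bool (x = v) :: int"
  have a: "realizable V E (?\<delta> a)"
  proof -
    have "realizable V E (\<lambda>x. ?\<delta> a x + ?\<delta> b x)"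
      using walk[of 1 a b] odd(1) by (simp add: eq_OO)
    moreover have "realizable V E (\<lambda>x. ?\<delta> a x - ?\<delta> b x)"
      using walk[OF odd(3)] odd(2) by simp
    ultimately have "realizable V E (\<lambda>x. (?\<delta> a x + ?\<delta> b x) + 1 * (?\<delta> a x - ?\<delta> b x))"
      by (rule realizable_lin)
    then have 2: "realizable V E (\<lambda>x. 2 * ?\<delta> a x)" by (rule realizable_cong) simp
    \<comment> \<open>Doubling once more gives 4, which is 1 modulo 3.\<close>
    have "realizable V E (\<lambda>x. 2 * ?\<delta> a x + 1 * (2 * ?\<delta> a x))"
      by (rule realizable_lin[OF 2 2])
    then show ?thesis by (rule realizable_cong) (simp add: cong_def)
  qed
  have "realizable V E (?\<delta> v)" if "v \<in> V" for v
  proof -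
    have "(\<lambda>x y. {x, y} \<in> E)\<^sup>*\<^sup>* a v"
      using con edge[OF odd(1)] that by (auto simp: connected_graph_def)
    then obtain l where "((\<lambda>x y. {x, y} \<in> E) ^^ l) a v" by (auto dest: rtranclp_imp_relpowp)
    note l = walk[OF this]
    have "realizable V E (\<lambda>x. ?\<delta> a x - (?\<delta> a x - (-1) ^ l * ?\<delta> v x))"
      using realizable_lin[OF a l, of "-1"] by simp
    then have r: "realizable V E (\<lambda>x. (-1) ^ l * ?\<delta> v x)" by simp
    \<comment> \<open>With s = (-1)^l, the multiplier s - 1 turns the factor s into s + (s - 1) * s
      = s^2 = 1.\<close>
    have "realizable V E (\<lambda>x. (-1) ^ l * ?\<delta> v x + ((-1) ^ l - 1) * ((-1) ^ l * ?\<delta> v x))"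
      by (rule realizable_lin[OF r r])
    moreover have "(-1) ^ l * y + ((-1) ^ l - 1) * ((-1) ^ l * y) = y" for y :: int
      by (cases "even l") auto
    ultimately show ?thesis by simp
  qed
  then have "\<forall>v\<in>V. \<exists>b. \<forall>x\<in>V. [(\<Sum>f | f \<in> E \<and> x \<in> f. b f) = ?\<delta> v x] (mod 3)"
    unfolding realizable_def by blast
  from bchoice[OF this] obtain B' where
    "\<forall>v\<in>V. \<forall>x\<in>V. [(\<Sum>f | f \<in> E \<and> x \<in> f. B' v f) = ?\<delta> v x] (mod 3)" by blast
  then have B: "[(\<Sum>f | f \<in> E \<and> x \<in> f. B' v f) = ?\<delta> v x] (mod 3)" if "v \<in> V" "x \<in> V" for v x
    using that by blast
  have inc: "(\<Sum>f | f \<in> E \<and> x \<in> f. b f) = (\<Sum>f\<in>E. of_bool (x \<in> f) * b f)" for x and b :: "'a set \<Rightarrow> int"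
    by (subst sum.inter_filter[OF fin(1)]) (auto intro!: sum.cong)
  have "good 3 E E (edge_form D)"
  proof (rule good_3_substitution[OF good fin(1) fin(1) fin(2), where B = "\<lambda>f v. B' v f"])
    fix e v assume e: "e \<in> E" and v: "v \<in> V"
    have "fst (D e) \<in> V" "snd (D e) \<in> V"
      using edge[of "fst (D e)" "snd (D e)"] e orientationD[OF D e] by simp_all
    then have "[(\<Sum>f | f \<in> E \<and> snd (D e) \<in> f. B' v f) - (\<Sum>f | f \<in> E \<and> fst (D e) \<in> f. B' v f) =
        ?\<delta> v (snd (D e)) - ?\<delta> v (fst (D e))] (mod 3)"
      using B v by (intro cong_diff) auto
    also have "(\<Sum>f | f \<in> E \<and> snd (D e) \<in> f. B' v f) - (\<Sum>f | f \<in> E \<and> fst (D e) \<in> f. B' v f) =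
        (\<Sum>f\<in>E. edge_form D e f * B' v f)"
      unfolding edge_form_def left_diff_distrib sum_subtractf inc ..
    finally show "[vertex_form D e v = (\<Sum>f\<in>E. edge_form D e f * B' v f)] (mod 3)"
      by (simp add: vertex_form_def cong_sym)
  qed
  then show ?thesis by (rule good_imp_good_0)
qed

text \<open>Vertices are coloured by whether an even walk from \<open>r\<close> reaches them. If the
  ends of an edge are reached by walks of equal parity, these combine to an even walk between the
  ends.\<close>

lemma two_colouring_or_odd_walk:
  assumes G: "connected_graph V E" and edgeV: "\<And>u v. {u, v} \<in> E \<Longrightarrow> u \<in> V \<and> v \<in> V"
  obtains a b k where "{a, b} \<in> E" "even k" "((\<lambda>x y. {x, y} \<in> E) ^^ k) a b"
  | col :: "'a \<Rightarrow> bool" where "\<And>u v. {u, v} \<in> E \<Longrightarrow> col u \<noteq> col v"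
proof (cases "\<exists>a b k. {a, b} \<in> E \<and> even k \<and> ((\<lambda>x y. {x, y} \<in> E) ^^ k) a b")
  case True
  then show ?thesis using that(1) by blast
next
  case False
  let ?adj = "\<lambda>x y. {x, y} \<in> E"
  obtain r where r: "r \<in> V" using G by (auto simp: connected_graph_def)
  have rev: "(?adj ^^ k) y x" if "(?adj ^^ k) x y" for k x y
    using that
  proof (induction k arbitrary: y)
    case (Suc k)
    then obtain z where "(?adj ^^ k) x z" "{z, y} \<in> E" by (auto elim: relpowp_Suc_E)
    then show ?case using Suc.IH relpowp_Suc_I2[of ?adj y z k x] by (auto simp: insert_commute)
  qed simp
  have parity: "even (k + l) \<longrightarrow> {u, v} \<notin> E" if "(?adj ^^ k) r u" "(?adj ^^ l) r v" for u v k l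
  proof -
    have "(?adj ^^ (k + l)) u v" using rev[OF that(1)] that(2) by (auto simp: relpowp_add)
    then show ?thesis using False by blast
  qed
  define col where "col v \<longleftrightarrow> (\<exists>k. even k \<and> (?adj ^^ k) r v)" for v
  have "col u \<noteq> col v" if uv: "{u, v} \<in> E" for u v
  proof -
    have ex: "\<exists>k. (?adj ^^ k) r x" if "x \<in> V" for x
    proof -
      have "?adj\<^sup>*\<^sup>* r x" using G r that by (simp add: connected_graph_def)
      then show ?thesis by (auto dest: rtranclp_imp_relpowp)
    qed
    obtain k l where kl: "(?adj ^^ k) r u" "(?adj ^^ l) r v" using ex edgeV[OF uv] by blast
    show ?thesis
    proof
      assume eq: "col u = col v"
      show False
      proof (cases "col u")
        case True
        then obtain k' l' where "even k'" "(?adj ^^ k') r u" "even l'" "(?adj ^^ l') r v"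
          using eq unfolding col_def by blast
        then show False using parity[of k' u l' v] uv by simp
      next
        case False
        then have "odd k" "odd l" using eq kl unfolding col_def by blast+
        then show False using parity[OF kl] uv by simp
      qed
    qed
  qed
  then show ?thesis using that(2) by blast
qed

section \<open>Trees with a cycle through the leaves\<close>

context rooted_tree
begin

definition low :: "'a set \<Rightarrow> 'a" where
  "low e = (SOME u. u \<in> V \<and> u \<noteq> r \<and> e = {u, par u})"

lemma low: "e \<in> T \<Longrightarrow> low e \<in> V \<and> low e \<noteq> r \<and> e = {low e, par (low e)}"
proof -
  assume "e \<in> T"
  then obtain u v where e: "e = {u, v}" "{u, v} \<in> T" using edge_pair by blast
  then have "\<exists>u. u \<in> V \<and> u \<noteq> r \<and> e = {u, par u}"
    using edge_par[OF e(2)] edgeV[OF e(2)] by (auto simp: insert_commute)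
  then show ?thesis unfolding low_def by (rule someI_ex)
qed

lemma dep_par: "v \<in> V \<Longrightarrow> v \<noteq> r \<Longrightarrow> dep (par v) < dep v"
  using par[of v] by simp

lemma low_eq: "v \<in> V \<Longrightarrow> v \<noteq> r \<Longrightarrow> low {v, par v} = v"
proof -
  assume v: "v \<in> V" "v \<noteq> r"
  define u where "u = low {v, par v}"
  have u: "u \<in> V" "u \<noteq> r" "{v, par v} = {u, par u}"
    unfolding u_def using low[of "{v, par v}"] par[OF v] by blast+
  have "\<not> (v = par u \<and> par v = u)" using dep_par[OF v] dep_par[OF u(1,2)] by auto
  then have "u = v" using u(3) unfolding doubleton_eq_iff by blast
  then show ?thesis by (simp add: u_def)
qed

lemma inj_on_low: "inj_on low T"
  by (metis inj_onI low)

text \<open>Each edge is led by its lower end, because its other end is shallower, and distinct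
  edges have distinct lower ends.\<close>

lemma good_3_interior_vertices:
  assumes D: "orientation E D" and R: "R \<subseteq> T" "T \<subseteq> E"
  shows "good 3 R (low ` R) (vertex_form D)"
proof (rule good_leading[where w = dep])
  have "T \<subseteq> Pow V"
  proof
    fix e assume "e \<in> T"
    then obtain u where "u \<in> V" "u \<noteq> r" "e = {u, par u}" using low by blast
    then show "e \<in> Pow V" using par[of u] by simp
  qed
  then have "finite T" using finV by (simp add: finite_subset)
  then show fin: "finite R" using R(1) finite_subset by blast
  show "card {e \<in> R. low e = f} \<le> 2" for f
  proof -
    have "card {e \<in> R. low e = f} \<le> Suc 0"
      using fin inj_on_low R(1) by (subst card_le_Suc0_iff_eq) (auto simp: inj_on_def)
    then show ?thesis by simp
  qed
  fix e assume e: "e \<in> R"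
  then have eT: "e \<in> T" using R by blast
  define u where "u = low e"
  have u: "u \<in> V" "u \<noteq> r" "e = {u, par u}" unfolding u_def using low[OF eT] by blast+
  have vf: "vertex_form D e x = of_bool (u = x) - of_bool (par u = x) \<or>
      vertex_form D e x = of_bool (par u = x) - of_bool (u = x)" for x
  proof -
    have uE: "{u, par u} \<in> E" using eT R(2) u(3) by auto
    show ?thesis using orientation_cases[OF D uE] unfolding u(3) by cases (simp_all add: vertex_form_def)
  qed
  have neq: "par u \<noteq> u" "dep (par u) < dep u" using dep_par[OF u(1,2)] by auto
  show "\<not> 3 dvd vertex_form D e (low e)"
    using vf[of u] neq unfolding u_def[symmetric] by auto
  show "dep (low e') < dep (low e)" if "e' \<in> R" "vertex_form D e (low e') \<noteq> 0" "low e' \<noteq> low e" for e'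
  proof -
    have "low e' = par u" using vf[of "low e'"] that(2,3) unfolding u_def[symmetric] by (auto split: if_splits)
    then show ?thesis using neq unfolding u_def[symmetric] by simp
  qed
qed simp

end

text \<open>\<open>lam\<close> runs periodically through the leaves, so that rim indices rarely need
  reduction modulo \<open>n\<close>. The cyclic order of the leaves is arbitrary at this stage; the
  embedding is brought in by \<open>consecutive_chains\<close>.\<close>

locale halin =
  fixes V :: "'a set" and T :: "'a set set" and lam :: "nat \<Rightarrow> 'a" and n :: nat
  assumes tree: "tree_graph V T" and n3: "3 \<le> n" and per: "lam (i mod n) = lam i"
    and inj: "inj_on lam {..<n}" and leaves: "lam ` {..<n} = {v \<in> V. leaf T v}"
begin

definition rho :: "nat \<Rightarrow> 'a set" where
  "rho i = {lam i, lam (Suc i)}"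

definition E :: "'a set set" where
  "E = T \<union> rho ` {..<n}"

definition L :: "'a set" where
  "L = lam ` {..<n}"

definition stem :: "'a \<Rightarrow> 'a" where
  "stem v = (THE u. {v, u} \<in> T)"

lemma sgT: "simple_graph V T"
  using tree by (simp add: tree_graph_def)

lemma edgeT: "{u, v} \<in> T \<Longrightarrow> u \<in> V \<and> v \<in> V \<and> u \<noteq> v"
proof -
  assume uv: "{u, v} \<in> T"
  obtain x y where "x \<in> V" "y \<in> V" "x \<noteq> y" "{u, v} = {x, y}"
    using simple_graph_edgeE[OF sgT uv] .
  then show ?thesis by (auto simp: doubleton_eq_iff)
qed

lemma lam_eq: "lam i = lam j \<longleftrightarrow> i mod n = j mod n"
proof
  assume "lam i = lam j"
  then have "lam (i mod n) = lam (j mod n)" by (simp add: per)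
  then show "i mod n = j mod n" using inj n3 by (auto simp: inj_on_def)
qed (metis per)

lemma lam_L [simp]: "lam i \<in> L"
proof -
  have "i mod n < n" using n3 by simp
  then show ?thesis unfolding L_def using per[of i] by (metis imageI lessThan_iff)
qed

lemma L_lam: "v \<in> L \<Longrightarrow> \<exists>i<n. v = lam i"
  by (auto simp: L_def)

lemma L_leaf: "v \<in> L \<longleftrightarrow> v \<in> V \<and> leaf T v"
  unfolding L_def leaves by simp

lemma lam_V [simp]: "lam i \<in> V"
  using L_leaf lam_L by blast

lemma lam_Suc [simp]: "lam (Suc i) \<noteq> lam i" "lam i \<noteq> lam (Suc i)"
  using n3 by (auto simp: lam_eq mod_Suc)

lemma lam_Suc_Suc [simp]: "lam (Suc (Suc i)) \<noteq> lam i" "lam i \<noteq> lam (Suc (Suc i))"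
  using n3 by (auto simp: lam_eq mod_Suc split: if_splits)

lemma lam_n [simp]: "lam n = lam 0" "lam (i + n) = lam i" "lam (n + i) = lam i"
  by (auto simp: lam_eq)

text \<open>A match with exchanged ends would force \<open>lam (Suc (Suc j)) = lam j\<close>, which
  \<open>3 \<le> n\<close> excludes.\<close>

lemma rho_eq: "rho i = rho j \<longleftrightarrow> i mod n = j mod n"
proof
  assume "rho i = rho j"
  then consider "lam i = lam j" | "lam i = lam (Suc j)" "lam (Suc i) = lam j"
    by (auto simp: rho_def doubleton_eq_iff)
  then show "i mod n = j mod n"
  proof cases
    case 2
    then have "lam (Suc (Suc j)) = lam (Suc i)" by (auto simp: lam_eq) (metis mod_Suc_eq)
    then show ?thesis using 2 lam_Suc_Suc by metis
  qed (simp add: lam_eq)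
next
  assume "i mod n = j mod n"
  moreover then have "Suc i mod n = Suc j mod n" by (metis mod_Suc_eq)
  ultimately show "rho i = rho j" by (simp add: rho_def lam_eq[symmetric])
qed

lemma rho_E [simp]: "rho i \<in> E"
proof -
  have "rho i = rho (i mod n)" "i mod n < n" using n3 by (auto simp: rho_eq)
  then show ?thesis unfolding E_def by blast
qed

lemma inj_on_rho: "inj_on rho {..<n}"
  by (auto simp: inj_on_def rho_eq)

lemma stem: "v \<in> L \<Longrightarrow> {v, u} \<in> T \<longleftrightarrow> u = stem v"
proof -
  assume "v \<in> L"
  then have "card (neighbours T v) = 1" by (simp add: L_leaf leaf_def)
  then obtain w where w: "neighbours T v = {w}" by (auto simp: card_1_singleton_iff)
  then have w': "{v, u} \<in> T \<longleftrightarrow> u = w" for u by (auto simp: neighbours_def)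
  then have "stem v = w" unfolding stem_def by simp
  then show ?thesis using w' by simp
qed

lemma stem_T: "v \<in> L \<Longrightarrow> {v, stem v} \<in> T"
  by (simp add: stem)

lemma card_L: "card L = n"
  unfolding L_def using inj by (simp add: card_image)

text \<open>Two adjacent leaves would already be the whole tree, but there are at least three
  leaves.\<close>

lemma stem_notin_L: "v \<in> L \<Longrightarrow> stem v \<notin> L"
proof
  assume v: "v \<in> L" and w: "stem v \<in> L"
  have vw: "{v, stem v} \<in> T" by (rule stem_T[OF v])
  obtain par dep where "rooted_tree V T v par dep"
    using tree_graph_rooted[OF tree] v L_leaf by blast
  then interpret rooted_tree V T v par dep .
  have "x = v \<or> x = stem v" if "x \<in> V" for x
    using that
  proof (induction "dep x" arbitrary: x rule: less_induct)
    case less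
    show ?case
    proof (cases "x = v")
      case False
      then have px: "par x \<in> V" "{par x, x} \<in> T" "dep (par x) < dep x"
        using par[OF less.prems] by (auto simp: insert_commute)
      then have "par x = v \<or> par x = stem v" using less.hyps by blast
      then show ?thesis using px(2) stem[OF v] stem[OF w] vw by (metis insert_commute)
    qed simp
  qed
  then have "L \<subseteq> {v, stem v}" using L_leaf by blast
  then have "card L \<le> card {v, stem v}" by (rule card_mono[rotated]) simp
  also have "\<dots> \<le> 2" by (simp add: card_insert_le_m1)
  finally show False using card_L n3 by simp
qed

lemma stem_V: "v \<in> L \<Longrightarrow> stem v \<in> V"
  using stem_T edgeT by blast

lemma rho_T: "rho i \<notin> T"
  using stem[OF lam_L, of i "lam (Suc i)"] stem_notin_L[OF lam_L, of i] lam_L[of "Suc i"]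
  unfolding rho_def by metis

lemma T_cases:
  assumes "e \<in> T"
  obtains v where "v \<in> L" "e = {v, stem v}"
  | u v where "u \<in> V" "v \<in> V" "u \<notin> L" "v \<notin> L" "e = {u, v}"
proof -
  obtain u v where e: "u \<in> V" "v \<in> V" "e = {u, v}" using simple_graph_edgeE[OF sgT assms] .
  consider "u \<in> L" | "v \<in> L" | "u \<notin> L" "v \<notin> L" by blast
  then show ?thesis
  proof cases
    case 1
    then show ?thesis using that(1)[of u] stem[of u v] e assms by simp
  next
    case 2
    moreover have "e = {v, u}" using e by auto
    ultimately show ?thesis using that(1)[of v] stem[of v u] assms by simp
  next
    case 3
    then show ?thesis using that(2) e by blast
  qed
qed

lemma simple_graph_E: "simple_graph V E"
  unfolding simple_graph_def
proof (intro conjI ballI)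
  show "finite V" using sgT by (simp add: simple_graph_def)
  fix e assume "e \<in> E"
  then consider "e \<in> T" | i where "e = rho i" by (auto simp: E_def)
  then show "\<exists>u\<in>V. \<exists>v\<in>V. u \<noteq> v \<and> e = {u, v}"
  proof cases
    case 1
    then show ?thesis by (rule simple_graph_edgeE[OF sgT]) blast
  next
    case (2 i)
    then show ?thesis by (intro bexI[of _ "lam i"] bexI[of _ "lam (Suc i)"]) (auto simp: rho_def)
  qed
qed

lemma finE: "finite E" and finV: "finite V"
  using simple_graph_E simple_graph_finite_edges by (auto simp: simple_graph_def)

lemma finL: "finite L" and L_V: "L \<subseteq> V"
  using L_leaf by (auto simp: L_def)

lemma connected_E: "connected_graph V E"
proof -
  have "(\<lambda>x y. {x, y} \<in> E)\<^sup>*\<^sup>* u v" if "(\<lambda>x y. {x, y} \<in> T)\<^sup>*\<^sup>* u v" for u v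
    by (rule mono_rtranclp[rule_format, OF _ that]) (simp add: E_def)
  then show ?thesis using tree by (auto simp: tree_graph_def connected_graph_def)
qed

lemma edgeE: "{u, v} \<in> E \<Longrightarrow> u \<in> V \<and> v \<in> V \<and> u \<noteq> v"
proof -
  assume uv: "{u, v} \<in> E"
  obtain x y where "x \<in> V" "y \<in> V" "x \<noteq> y" "{u, v} = {x, y}"
    using simple_graph_edgeE[OF simple_graph_E uv] .
  then show ?thesis by (auto simp: doubleton_eq_iff)
qed

lemma inj_on_stem_edge: "inj_on (\<lambda>i. {lam i, stem (lam i)}) {..<n}"
proof (rule inj_onI)
  fix i j assume ij: "i \<in> {..<n}" "j \<in> {..<n}" "{lam i, stem (lam i)} = {lam j, stem (lam j)}"
  have "lam i \<noteq> stem (lam j)" using stem_notin_L[of "lam j"] lam_L by metis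
  then have "lam i = lam j" using ij(3) by (auto simp: doubleton_eq_iff)
  then show "i = j" using ij by (simp add: lam_eq)
qed

text \<open>Summing over \<open>F\<close> only amounts to setting the vertex variables outside
  \<open>F\<close> to 0; the sign is that of the orientation.\<close>

lemma vertex_form_sum:
  assumes "orientation E D" "{a, b} \<in> E" "finite F"
  shows "(\<Sum>v\<in>F. of_int (vertex_form D {a, b} v) * tvar v) \<in>
     {(if a \<in> F then tvar a else 0) - (if b \<in> F then tvar b else 0),
      - ((if a \<in> F then tvar a else 0) - (if b \<in> F then tvar b else 0))}"
proof -
  have *: "(\<Sum>v\<in>F. of_int (of_bool (c = v) - of_bool (d = v)) * tvar v) =
      (if c \<in> F then tvar c else 0) - (if d \<in> F then tvar d else 0)" for c d
  proof -
    have "(\<Sum>v\<in>F. of_int (of_bool (c = v)) * tvar v) = (\<Sum>v\<in>F. if v = c then tvar v else 0)" for c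
      by (rule sum.cong) auto
    then show ?thesis using assms(3) by (simp add: left_diff_distrib sum_subtractf)
  qed
  show ?thesis using orientation_cases[OF assms(1,2)]
    by cases (simp_all add: vertex_form_def * del: of_int_diff)
qed

end

section \<open>Rim and leaf edges in vertex variables\<close>

lemma peel_upwards:
  fixes x :: "nat \<Rightarrow> 'c :: comm_ring_1"
  assumes "\<And>i. x i ^ 3 = 0"
  shows "x 0 * (\<Prod>i<Suc k. x i) * (\<Prod>i<k. x (Suc i) - x i) = (\<Prod>i<Suc k. x i ^ 2)"
proof (induction k)
  case (Suc k)
  have "x 0 * (\<Prod>i<Suc (Suc k). x i) * (\<Prod>i<Suc k. x (Suc i) - x i) =
      (x 0 * (\<Prod>i<Suc k. x i) * (\<Prod>i<k. x (Suc i) - x i)) * (x (Suc k) * (x (Suc k) - x k))"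
    by (simp add: algebra_simps)
  \<comment> \<open>\<open>x k\<close> is already saturated, so the factor
    \<open>x (Suc k) - x k\<close> can contribute only its first term.\<close>
  also have "\<dots> = (\<Prod>i<k. x i ^ 2) * (x k ^ 2 * x (Suc k) ^ 2 - x k ^ 3 * x (Suc k))"
    unfolding Suc by (simp add: algebra_simps power2_eq_square power3_eq_cube)
  finally show ?case by (simp add: assms algebra_simps)
qed (simp add: power2_eq_square)

text \<open>Here the last variable is the saturated one, so every difference contributes its second
  term, each time with a sign.\<close>

lemma peel_downwards:
  fixes x :: "nat \<Rightarrow> 'c :: comm_ring_1"
  assumes "\<And>i. x i ^ 3 = 0"
  shows "x k * (\<Prod>i<Suc k. x i) * (\<Prod>i<k. x (Suc i) - x i) = (-1) ^ k * (\<Prod>i<Suc k. x i ^ 2)"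
  using assms
proof (induction k arbitrary: x)
  case (Suc k)
  have IH: "x (Suc k) * (\<Prod>i<Suc k. x (Suc i)) * (\<Prod>i<k. x (Suc (Suc i)) - x (Suc i)) =
      (-1) ^ k * (\<Prod>i<Suc k. x (Suc i) ^ 2)"
    using Suc.IH[of "\<lambda>i. x (Suc i)"] Suc.prems by simp
  have "x (Suc k) * (\<Prod>i<Suc (Suc k). x i) * (\<Prod>i<Suc k. x (Suc i) - x i) =
      (x (Suc k) * (\<Prod>i<Suc k. x (Suc i)) * (\<Prod>i<k. x (Suc (Suc i)) - x (Suc i))) *
      (x 0 * (x 1 - x 0))"
    unfolding prod.lessThan_Suc_shift[of _ "Suc k"] prod.lessThan_Suc_shift[of _ k]
    by (simp add: algebra_simps)
  also have "\<dots> = (-1) ^ k * (\<Prod>i<k. x (Suc (Suc i)) ^ 2) * (x 1 ^ 3 * x 0 - x 1 ^ 2 * x 0 ^ 2)"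
    unfolding IH unfolding prod.lessThan_Suc_shift[of _ k]
    by (simp add: algebra_simps power2_eq_square power3_eq_cube)
  finally show ?case
    unfolding prod.lessThan_Suc_shift[of _ "Suc k"] prod.lessThan_Suc_shift[of _ k]
    by (simp add: Suc.prems algebra_simps)
qed (simp add: power2_eq_square)

context halin
begin

text \<open>With the interior variables set to 0 the leaf edges become single leaf variables.
  Opening the rim product at its closing edge gives the coefficient 1 - (-1)^(n-1), which is 2 for
  even \<open>n\<close>. The inner tree edges contain no leaf and form the second triangular
  block.\<close>

lemma good_3_even:
  assumes D: "orientation E D" and n: "even n"
  shows "good 3 E V (vertex_form D)"
proof -
  obtain par dep where "rooted_tree V T (lam 0) par dep"
    using tree_graph_rooted[OF tree lam_V] by blast
  then interpret rooted_tree V T "lam 0" par dep .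
  define row where "row = case_sum rho (\<lambda>i. {lam i, stem (lam i)})"
  define I where "I = {..<n} <+> {..<n}"
  define l :: "nat + nat \<Rightarrow> 'a tpoly"
    where "l = case_sum (\<lambda>i. tvar (lam (Suc i)) - tvar (lam i)) (\<lambda>i. tvar (lam i))"
  define R where "R = {e \<in> T. e \<inter> L = {}}"
  have inj_row: "inj_on row I"
  proof -
    have "rho i \<noteq> {lam j, stem (lam j)}" for i j using rho_T[of i] stem_T[OF lam_L[of j]] by metis
    then show ?thesis
      using inj_onD[OF inj_on_rho] inj_onD[OF inj_on_stem_edge]
      unfolding I_def row_def by (intro inj_onI) (auto; metis)
  qed
  have rowE: "row i \<in> E" if "i \<in> I" for i
  proof (cases i)
    case (Inl j)
    then show ?thesis by (simp add: row_def)
  next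
    case (Inr j)
    then show ?thesis using stem_T[OF lam_L] by (simp add: row_def E_def)
  qed
  have 1: "good 3 (row ` I) L (vertex_form D)"
  proof (rule goodI_ring_indexed[OF _ finL inj_row refl, where a = tvar and l = l])
    show "of_int 3 dvd tvar v ^ 3" for v :: 'a by (simp add: tvar_cube)
    show "(\<Sum>v\<in>L. of_int (vertex_form D (row i) v) * tvar v) \<in> {l i, - l i}" if "i \<in> I" for i
    proof (cases i)
      case (Inl j)
      then show ?thesis
        using vertex_form_sum[OF D, of "lam j" "lam (Suc j)" L] rho_E[of j] finL
        by (auto simp: row_def l_def rho_def)
    next
      case (Inr j)
      then show ?thesis
        using vertex_form_sum[OF D, of "lam j" "stem (lam j)" L] rowE[OF that] finL
          stem_notin_L[OF lam_L, of j]
        by (auto simp: row_def l_def)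
    qed
    define x where "x i = tvar (lam i)" for i
    obtain k where k: "n = Suc k" "odd k" using n n3 by (cases n) auto
    have x3: "x i ^ 3 = 0" for i by (simp add: x_def tvar_cube)
    have xn: "x (Suc k) = x 0" using k by (simp add: x_def lam_n(1)[unfolded k])
    have "(\<Prod>i\<in>I. l i) = (\<Prod>i<Suc k. x (Suc i) - x i) * (\<Prod>i<Suc k. x i)"
      unfolding I_def k by (simp add: prod.Plus l_def x_def)
    \<comment> \<open>The closing factor \<open>x 0 - x k\<close> is split; each half is an open
      path saturated at one end.\<close>
    also have "\<dots> = x 0 * (\<Prod>i<Suc k. x i) * (\<Prod>i<k. x (Suc i) - x i) -
        x k * (\<Prod>i<Suc k. x i) * (\<Prod>i<k. x (Suc i) - x i)"
      using xn by (simp add: algebra_simps)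
    also have "\<dots> = of_int 2 * (\<Prod>i<n. x i ^ 2)"
      using peel_upwards[of x k, OF x3] peel_downwards[of x k, OF x3] k by simp
    also have "(\<Prod>i<n. x i ^ 2) = (\<Prod>v\<in>L. tvar v ^ 2)"
      unfolding L_def x_def by (simp add: prod.reindex[OF inj])
    finally show "\<not> of_int 3 dvd (\<Prod>i\<in>I. l i)"
      using dvd_squares_tvar[OF finL, of 3 2] by auto
  qed (simp add: I_def)
  have 2: "good 3 R (low ` R) (vertex_form D)"
    by (rule good_3_interior_vertices[OF D]) (auto simp: R_def E_def)
  have R_low: "low e \<in> e" "low e \<in> V" "low e \<notin> L" if "e \<in> R" for e
    using low[of e] that unfolding R_def by blast+
  have "good 3 (row ` I \<union> R) (L \<union> low ` R) (vertex_form D)"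
  proof (rule good_triangular[OF _ _ _ finL _ _ _ _ 1 2])
    show "row ` I \<inter> R = {}"
      using rho_T by (auto simp: I_def row_def R_def)
    show "finite R" using finE by (rule finite_subset[rotated]) (auto simp: R_def E_def)
    then show "finite (low ` R)" by simp
    show "vertex_form D e v = 0" if "e \<in> R" "v \<in> L" for e v
    proof -
      have "e \<in> E" using that by (auto simp: R_def E_def)
      then have "fst (D e) \<in> e" "snd (D e) \<in> e" using orientationD[OF D] by blast+
      then show ?thesis using that by (auto simp: vertex_form_def R_def)
    qed
  qed (use R_low in \<open>auto simp: I_def\<close>)
  moreover have "row ` I \<union> R = E"
  proof
    show "row ` I \<union> R \<subseteq> E" using rowE by (auto simp: R_def E_def)
    show "E \<subseteq> row ` I \<union> R"
    proof
      fix e assume "e \<in> E"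
      then consider i where "i < n" "e = rho i" | "e \<in> T" by (auto simp: E_def)
      then show "e \<in> row ` I \<union> R"
      proof cases
        case (1 i)
        then show ?thesis by (auto simp: row_def I_def intro!: image_eqI[of _ _ "Inl i"])
      next
        case 2
        then show ?thesis
        proof (cases rule: T_cases)
          case (1 v)
          then obtain i where "i < n" "v = lam i" using L_lam by blast
          then show ?thesis using 1 by (auto simp: row_def I_def intro!: image_eqI[of _ _ "Inr i"])
        next
          case (2 u v)
          then show ?thesis using \<open>e \<in> T\<close> by (auto simp: R_def)
        qed
      qed
    qed
  qed
  moreover have "L \<union> low ` R \<subseteq> V" using L_V R_low by auto
  ultimately show ?thesis using good_superset finE by metis
qed

end

text \<open>The auxiliary factor \<open>x 0 + x k\<close> turns the closing rim factor into
  \<open>x 0 ^ 2 - x k ^ 2\<close>. The first square dies against the leaf factor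
  \<open>x 0\<close>, where \<open>\<tau> 0 = 0\<close>. The second dies against \<open>x k\<close>
  and so forces \<open>t\<close> from the leaf factor \<open>x k - t\<close>; now
  \<open>t ^ 2\<close> is present and erases every other \<open>\<tau> i\<close>, and what remains
  is an open path saturated at \<open>x k\<close>.\<close>

lemma cyclic_product_boundary:
  fixes x \<tau> :: "nat \<Rightarrow> 'c :: comm_ring_1"
  assumes x: "\<And>i. x i ^ 3 = 0" and t: "t ^ 3 = 0" and \<tau>: "\<And>i. \<tau> i = 0 \<or> \<tau> i = t"
    and ends: "\<tau> 0 = 0" "\<tau> k = t" "0 < k"
  shows "(\<Prod>i<k. x (Suc i) - x i) * (x 0 - x k) * (\<Prod>i<Suc k. x i - \<tau> i) * t * (x 0 + x k) =
    (-1) ^ k * (t ^ 2 * (\<Prod>i<Suc k. x i ^ 2))"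
proof -
  define P where "P = (\<Prod>i<k. x (Suc i) - x i)"
  have 0: "x 0 ^ 2 * (\<Prod>i<k. x i - \<tau> i) = 0"
  proof -
    obtain l where l: "k = Suc l" using ends(3) by (cases k) auto
    have "x 0 ^ 2 * (\<Prod>i<k. x i - \<tau> i) = x 0 ^ 3 * (\<Prod>i<l. x (Suc i) - \<tau> (Suc i))"
      unfolding l prod.lessThan_Suc_shift ends(1) by (simp add: power2_eq_square power3_eq_cube mult_ac)
    then show ?thesis by (simp add: x)
  qed
  have t2: "t ^ 2 * \<tau> i = 0" for i
    using \<tau>[of i] t by (auto simp: power2_eq_square power3_eq_cube)
  have k: "t ^ 2 * (\<Prod>i<j. x i - \<tau> i) = t ^ 2 * (\<Prod>i<j. x i)" for j
  proof (induction j)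
    case (Suc j)
    have "t ^ 2 * (\<Prod>i<Suc j. x i - \<tau> i) = (t ^ 2 * (\<Prod>i<j. x i - \<tau> i)) * (x j - \<tau> j)"
      by (simp add: mult_ac)
    also have "\<dots> = t ^ 2 * (\<Prod>i<Suc j. x i) - (t ^ 2 * \<tau> j) * (\<Prod>i<j. x i)"
      unfolding Suc by (simp add: algebra_simps)
    finally show ?case by (simp add: t2)
  qed simp
  have "P * (x 0 - x k) * (\<Prod>i<Suc k. x i - \<tau> i) * t * (x 0 + x k) =
      P * (x k - t) * t * (x 0 ^ 2 * (\<Prod>i<k. x i - \<tau> i)) -
      P * t * (x k ^ 3 - x k ^ 2 * t) * (\<Prod>i<k. x i - \<tau> i)"
    using ends(2) by (simp add: algebra_simps power2_eq_square power3_eq_cube)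
  also have "\<dots> = P * x k ^ 2 * (t ^ 2 * (\<Prod>i<k. x i - \<tau> i))"
    unfolding 0 x by (simp add: algebra_simps power2_eq_square)
  also have "\<dots> = t ^ 2 * (x k * (\<Prod>i<Suc k. x i) * P)"
    unfolding k by (simp add: algebra_simps power2_eq_square)
  also have "\<dots> = (-1) ^ k * (t ^ 2 * (\<Prod>i<Suc k. x i ^ 2))"
    unfolding P_def peel_downwards[of x k, OF x] by (simp add: mult_ac)
  finally show ?thesis unfolding P_def .
qed

context halin
begin

text \<open>Adding the variable of \<open>p\<close> and the edge above \<open>p\<close> to the rim
  and leaf edges breaks the cancellation that occurs for odd \<open>n\<close>. The labelling starts
  just after a run of leaves at \<open>p\<close>, which supplies the two boundary values of
  \<open>\<tau>\<close>.\<close>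

lemma good_3_boundary:
  assumes D: "orientation E D" and rooted: "rooted_tree V T r par dep"
    and p: "p \<in> V" "p \<notin> L" "p \<noteq> r" "par p \<notin> L"
    and nb: "\<And>x. {p, x} \<in> T \<Longrightarrow> x = par p \<or> x \<in> L"
    and ends: "stem (lam (n - 1)) = p" "stem (lam 0) \<noteq> p"
  shows "good 3 E V (vertex_form D)"
proof -
  interpret rooted_tree V T r par dep by (rule rooted)
  define row where "row = case_sum rho (case_sum (\<lambda>i. {lam i, stem (lam i)}) (\<lambda>_ :: unit. {p, par p}))"
  define I where "I = {..<n} <+> ({..<n} <+> {()})"
  define t where "t = tvar p"
  define \<tau> where "\<tau> i = (if stem (lam i) = p then t else 0)" for i
  define x where "x i = tvar (lam i)" for i
  define l where "l = case_sum (\<lambda>i. x (Suc i) - x i) (case_sum (\<lambda>i. x i - \<tau> i) (\<lambda>_ :: unit. t))"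
  define F where "F = insert p L"
  define R where "R = {e \<in> T. e \<inter> F = {}}"
  have finF: "finite F" by (simp add: F_def finL)
  have pT: "{p, par p} \<in> T" using par[OF p(1,3)] by blast
  have inj_row: "inj_on row I"
  proof -
    have "rho i \<noteq> {lam j, stem (lam j)}" for i j using rho_T[of i] stem_T[OF lam_L[of j]] by metis
    moreover have "rho i \<noteq> {p, par p}" for i using rho_T[of i] pT by metis
    moreover have "{lam i, stem (lam i)} \<noteq> {p, par p}" for i
      using p(2,4) lam_L[of i] by (metis doubleton_eq_iff)
    ultimately show ?thesis
      using inj_onD[OF inj_on_rho] inj_onD[OF inj_on_stem_edge]
      unfolding I_def row_def by (intro inj_onI) (auto; metis)
  qed
  have rowE: "row i \<in> E" if "i \<in> I" for i
    using that stem_T[OF lam_L] pT by (auto simp: I_def row_def) (auto simp: E_def)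
  have 1: "good 3 (row ` I) F (vertex_form D)"
  proof (rule goodI_ring_indexed[OF _ finF inj_row refl, where a = tvar and l = l])
    show "of_int 3 dvd tvar v ^ 3" for v :: 'a by (simp add: tvar_cube)
    show "(\<Sum>v\<in>F. of_int (vertex_form D (row i) v) * tvar v) \<in> {l i, - l i}" if i: "i \<in> I" for i
    proof -
      consider j where "i = Inl j" | j where "i = Inr (Inl j)" | "i = Inr (Inr ())"
        using i by (auto simp: I_def)
      then show ?thesis
      proof cases
        case (1 j)
        then show ?thesis
          using vertex_form_sum[OF D, of "lam j" "lam (Suc j)" F] rho_E[of j] finF
          by (auto simp: row_def l_def rho_def x_def F_def)
      next
        case (2 j)
        then show ?thesis
          using vertex_form_sum[OF D, of "lam j" "stem (lam j)" F] rowE[OF i] finF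
            stem_notin_L[OF lam_L, of j]
          by (auto simp: row_def l_def x_def \<tau>_def t_def F_def)
      next
        case 3
        then show ?thesis
          using vertex_form_sum[OF D, of p "par p" F] rowE[OF i] finF p par[OF p(1,3)] dep_par[OF p(1,3)]
          by (auto simp: row_def l_def t_def F_def)
      qed
    qed
    obtain k where k: "n = Suc k" "0 < k" using n3 by (cases n) auto
    have x3: "x i ^ 3 = 0" for i by (simp add: x_def tvar_cube)
    have xn: "x (Suc k) = x 0" using k by (simp add: x_def lam_n(1)[unfolded k])
    \<comment> \<open>The rows have total degree 2n + 1; the extra factor lifts them to the top
      monomial of degree 2n + 2, and non-divisibility of this multiple passes back to the product of
      the rows.\<close>
    have "(\<Prod>i\<in>I. l i) * (x 0 + x k) =
        (\<Prod>i<k. x (Suc i) - x i) * (x 0 - x k) * (\<Prod>i<Suc k. x i - \<tau> i) * t * (x 0 + x k)"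
      unfolding I_def k by (simp add: prod.Plus l_def xn mult_ac)
    also have "\<dots> = (-1) ^ k * (t ^ 2 * (\<Prod>i<Suc k. x i ^ 2))"
    proof (rule cyclic_product_boundary)
      show "t ^ 3 = 0" by (simp add: t_def tvar_cube)
    qed (use x3 ends k in \<open>auto simp: \<tau>_def\<close>)
    also have "(\<Prod>i<Suc k. x i ^ 2) = (\<Prod>v\<in>L. tvar v ^ 2)"
      unfolding L_def x_def k(1)[symmetric] by (simp add: prod.reindex[OF inj])
    also have "t ^ 2 * \<dots> = (\<Prod>v\<in>F. tvar v ^ 2)"
      using p(2) finL by (simp add: F_def t_def)
    finally have eq: "(\<Prod>i\<in>I. l i) * (x 0 + x k) = of_int ((-1) ^ k) * (\<Prod>v\<in>F. tvar v ^ 2)"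
      by simp
    show "\<not> of_int 3 dvd (\<Prod>i\<in>I. l i)"
    proof
      assume "of_int 3 dvd (\<Prod>i\<in>I. l i)"
      then have "of_int 3 dvd (\<Prod>i\<in>I. l i) * (x 0 + x k)" by (rule dvd_mult2)
      then have "(3 :: int) dvd (-1) ^ k" unfolding eq by (rule dvd_squares_tvar[OF finF])
      then show False by (cases "even k") auto
    qed
  qed (simp add: I_def)
  have 2: "good 3 R (low ` R) (vertex_form D)"
    by (rule good_3_interior_vertices[OF D]) (auto simp: R_def E_def)
  have R_low: "low e \<in> e" "low e \<in> V" "low e \<notin> F" if "e \<in> R" for e
    using low[of e] that unfolding R_def by blast+
  have "good 3 (row ` I \<union> R) (F \<union> low ` R) (vertex_form D)"
  proof (rule good_triangular[OF _ _ _ finF _ _ _ _ 1 2])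
    show "row ` I \<inter> R = {}"
      using rho_T by (auto simp: I_def row_def R_def F_def)
    show "finite R" using finE by (rule finite_subset[rotated]) (auto simp: R_def E_def)
    then show "finite (low ` R)" by simp
    show "vertex_form D e v = 0" if "e \<in> R" "v \<in> F" for e v
    proof -
      have "e \<in> E" using that by (auto simp: R_def E_def)
      then have "fst (D e) \<in> e" "snd (D e) \<in> e" using orientationD[OF D] by blast+
      then show ?thesis using that by (auto simp: vertex_form_def R_def)
    qed
  qed (use R_low in \<open>auto simp: I_def\<close>)
  moreover have "row ` I \<union> R = E"
  proof
    show "row ` I \<union> R \<subseteq> E" using rowE by (auto simp: R_def E_def)
    show "E \<subseteq> row ` I \<union> R"
    proof
      fix e assume "e \<in> E"
      then consider i where "i < n" "e = rho i" | "e \<in> T" by (auto simp: E_def)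
      then show "e \<in> row ` I \<union> R"
      proof cases
        case (1 i)
        then show ?thesis by (auto simp: row_def I_def intro!: image_eqI[of _ _ "Inl i"])
      next
        case 2
        then show ?thesis
        proof (cases rule: T_cases)
          case (1 v)
          then obtain i where "i < n" "v = lam i" using L_lam by blast
          then show ?thesis using 1 by (auto simp: row_def I_def intro!: image_eqI[of _ _ "Inr (Inl i)"])
        next
          case (2 u v)
          show ?thesis
          proof (cases "p \<in> e")
            case True
            then obtain w where w: "e = {p, w}" "w \<notin> L" using 2 by auto
            then have "e = {p, par p}" using nb \<open>e \<in> T\<close> by blast
            then show ?thesis by (auto simp: row_def I_def intro!: image_eqI[of _ _ "Inr (Inr ())"])
          next
            case False
            then show ?thesis using \<open>e \<in> T\<close> 2 by (auto simp: R_def F_def)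
          qed
        qed
      qed
    qed
  qed
  moreover have "F \<union> low ` R \<subseteq> V" using L_V R_low p by (auto simp: F_def)
  ultimately show ?thesis using good_superset finE by metis
qed

end

section \<open>Odd wheels in characteristic 0\<close>

lemma wheel_product:
  fixes x z W :: "nat \<Rightarrow> 'c :: comm_ring_1"
  assumes x: "\<And>j. x j ^ 3 = 0" and z: "\<And>j. z j ^ 3 = 0" and y: "y ^ 3 = 0"
    and W: "W 0 = y" "\<And>j. j < m \<Longrightarrow> W (Suc j) = z j - x j"
  defines "f \<equiv> \<lambda>j. (z j + x j) * (z j - x j) * (z j + x j - W j) * ((z j - x j) - (z j + x j))"
  shows "y * (\<Prod>j<m. f j) * ((z m + x m) * (z m - x m + y) * (z m + x m - W m) *
      ((z m - x m + y) - (z m + x m)) * (y - (z m - x m + y))) =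
    of_int (6 * (-2) ^ m) * (y ^ 2 * (\<Prod>j<Suc m. x j ^ 2 * z j ^ 2))"
proof -
  define H where "H i = y * (\<Prod>j<i. f j)" for i
  define B where "B i = (-2) ^ i * (y ^ 2 * (\<Prod>j<i. x j ^ 2 * z j ^ 2))" for i
  have x3: "x j * (x j * x j) = 0" "x j * (x j * (x j * u)) = 0" for j u
    using x[of j] by (simp_all add: power3_eq_cube mult.assoc[symmetric])
  have z3: "z j * (z j * z j) = 0" "z j * (z j * (z j * u)) = 0" for j u
    using z[of j] by (simp_all add: power3_eq_cube mult.assoc[symmetric])
  have By: "B i * y = 0" for i
  proof -
    have "B i * y = (-2) ^ i * (y ^ 3 * (\<Prod>j<i. x j ^ 2 * z j ^ 2))"
      unfolding B_def power3_eq_cube power2_eq_square by (simp add: mult_ac)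
    then show ?thesis by (simp add: y)
  qed
  \<comment> \<open>The part already multiplied out acts on the rest only through its products with
    \<open>y\<close> and with \<open>W i\<close>, the value at the last leaf treated. Both products
    equal \<open>B i\<close>, which is annihilated by \<open>W i\<close> and by
    \<open>y\<close>.\<close>
  have inv: "H i * y = B i \<and> H i * W i = B i \<and> B i * W i = 0" if "i \<le> m" for i
    using that
  proof (induction i)
    case 0
    then show ?case using By[of 0] by (simp add: H_def B_def W power2_eq_square)
  next
    case (Suc i)
    then have IH: "H i * y = B i" "H i * W i = B i" "B i * W i = 0" and Wi: "W (Suc i) = z i - x i"
      using W by auto
    have f: "f i = 2 * x i * (x i ^ 2 - z i ^ 2) * (z i + x i - W i)"
      unfolding f_def by (simp add: algebra_simps power2_eq_square)
    have BS: "B (Suc i) = - 2 * B i * (x i ^ 2 * z i ^ 2)"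
      by (simp add: B_def algebra_simps)
    have "H (Suc i) * y = H i * y * f i" by (simp add: H_def algebra_simps)
    also have "\<dots> = 2 * x i * (x i ^ 2 - z i ^ 2) * ((z i + x i) * B i - B i * W i)"
      unfolding IH(1) f by (simp add: algebra_simps)
    also have "\<dots> = B (Suc i)"
      unfolding IH BS by (simp add: algebra_simps power2_eq_square x3 z3)
    finally have 1: "H (Suc i) * y = B (Suc i)" .
    have "H (Suc i) * W (Suc i) = H i * f i * (z i - x i)" by (simp add: H_def Wi algebra_simps)
    also have "\<dots> = 2 * x i * (x i ^ 2 - z i ^ 2) * ((z i + x i) * (z i - x i) * H i - (z i - x i) * (H i * W i))"
      unfolding f by (simp add: algebra_simps)
    also have "\<dots> = B (Suc i)"
      unfolding IH BS by (simp add: algebra_simps power2_eq_square x3 z3)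
    finally have 2: "H (Suc i) * W (Suc i) = B (Suc i)" .
    have "B (Suc i) * W (Suc i) = 0"
      unfolding BS Wi by (simp add: algebra_simps power2_eq_square x3 z3)
    then show ?case using 1 2 by simp
  qed
  define X Z U where "X = x m" and "Z = z m" and "U = W m"
  have H: "H m * y = B m" "H m * U = B m" "B m * U = 0" using inv[of m] by (auto simp: U_def)
  have XZ: "X * (X * X) = 0" "X * (X * (X * u)) = 0" "Z * (Z * Z) = 0" "Z * (Z * (Z * u)) = 0" for u
    unfolding X_def Z_def by (rule x3 z3)+
  \<comment> \<open>The last block is grouped by the products of \<open>H m\<close> with
    \<open>y\<close> and \<open>U\<close>, so that the invariant evaluates every term.\<close>
  have "H m * ((Z + X) * (Z - X + y) * (Z + X - U) * ((Z - X + y) - (Z + X)) * (y - (Z - X + y))) =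
      (X ^ 2 - Z ^ 2) * (2 * X * (X ^ 2 - Z ^ 2) * H m + (Z - 3 * X) * (Z + X) * (H m * y)
        + (Z - X) * (2 * X) * (H m * U) - (Z - 3 * X) * ((H m * y) * U) + (Z + X) * ((H m * y) * y)
        - ((H m * y) * y) * U)"
    by (simp add: algebra_simps power2_eq_square)
  also have "\<dots> = (X ^ 2 - Z ^ 2) * (2 * X * (X ^ 2 - Z ^ 2) * H m + (Z - 3 * X) * (Z + X) * B m
        + (Z - X) * (2 * X) * B m)"
    unfolding H By by simp
  also have "\<dots> = 6 * B m * (X ^ 2 * Z ^ 2)"
    by (simp add: algebra_simps power2_eq_square XZ)
  finally show ?thesis
    unfolding H_def B_def X_def Z_def U_def by (simp add: algebra_simps)
qed

lemma prod_odd_interval: "(\<Prod>i<Suc (2 * m). g i) = g 0 * (\<Prod>j<m. g (Suc (2 * j)) * g (Suc (Suc (2 * j))))"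
  for g :: "nat \<Rightarrow> 'c :: comm_monoid_mult"
  by (induction m) (simp_all add: mult_ac)

lemma prod_even_interval: "(\<Prod>i<2 * m. g i) = (\<Prod>j<m. g (2 * j) * g (Suc (2 * j)))"
  for g :: "nat \<Rightarrow> 'c :: comm_monoid_mult"
  by (induction m) (simp_all add: mult_ac)

lemma Suc_mod_cancel: "Suc a mod n = Suc b mod n \<Longrightarrow> a mod n = b mod n" for a b n :: nat
  using cong_add_rcancel_nat[of a 1 b n] by (simp add: cong_def)

lemma edge_form_sum:
  fixes a :: "'a set \<Rightarrow> 'c :: comm_ring_1"
  assumes D: "orientation E D" and uv: "{u, v} \<in> E" and fin: "finite F"
  shows "(\<Sum>f\<in>F. of_int (edge_form D {u, v} f) * a f) \<in>
    {(\<Sum>f | f \<in> F \<and> u \<in> f. a f) - (\<Sum>f | f \<in> F \<and> v \<in> f. a f),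
     - ((\<Sum>f | f \<in> F \<and> u \<in> f. a f) - (\<Sum>f | f \<in> F \<and> v \<in> f. a f))}"
proof -
  have inc: "(\<Sum>f | f \<in> F \<and> x \<in> f. a f) = (\<Sum>f\<in>F. of_int (of_bool (x \<in> f)) * a f)" for x
    by (subst sum.inter_filter[OF fin]) (auto intro!: sum.cong)
  show ?thesis
    using orientation_cases[OF D uv]
    by cases (simp_all add: edge_form_def inc left_diff_distrib sum_subtractf)
qed

context halin
begin

text \<open>\<open>rho (i + n - 1)\<close> is the rim edge before \<open>lam i\<close>; adding
  \<open>n\<close> avoids truncated subtraction at \<open>i = 0\<close>.\<close>

lemma edges_at_leaf:
  "{f \<in> E. lam i \<in> f} = {rho i, rho (i + n - 1), {lam i, stem (lam i)}}"
proof -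
  have Suc: "Suc (i + n - 1) = i + n" using n3 by simp
  have "lam i = lam j \<or> lam i = lam (Suc j) \<longleftrightarrow> rho j = rho i \<or> rho j = rho (i + n - 1)" for j
  proof -
    have "lam i = lam j \<longleftrightarrow> rho j = rho i" by (auto simp: lam_eq rho_eq)
    moreover have "lam i = lam (Suc j) \<longleftrightarrow> Suc j mod n = Suc (i + n - 1) mod n"
      unfolding Suc by (auto simp: lam_eq)
    moreover have "\<dots> \<longleftrightarrow> rho j = rho (i + n - 1)"
      unfolding rho_eq by (metis Suc_mod_cancel mod_Suc_eq)
    ultimately show ?thesis by simp
  qed
  then have 1: "f \<in> rho ` {..<n} \<and> lam i \<in> f \<longleftrightarrow> f = rho i \<or> f = rho (i + n - 1)" for f
    using rho_E rho_T unfolding E_def by (auto simp: rho_def)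
  have 2: "f \<in> T \<and> lam i \<in> f \<longleftrightarrow> f = {lam i, stem (lam i)}" for f
  proof
    assume f: "f \<in> T \<and> lam i \<in> f"
    obtain u v where "f = {u, v}" using simple_graph_edgeE[OF sgT conjunct1[OF f]] .
    moreover then have "lam i = u \<or> lam i = v" using f by simp
    ultimately obtain w where w: "f = {lam i, w}" by (metis insert_commute)
    then show "f = {lam i, stem (lam i)}" using f stem[OF lam_L, of i w] by simp
  qed (simp add: stem_T)
  have "f \<in> E \<and> lam i \<in> f \<longleftrightarrow> f = rho i \<or> f = rho (i + n - 1) \<or> f = {lam i, stem (lam i)}" for f
    using 1[of f] 2[of f] unfolding E_def by blast
  then show ?thesis by (simp add: set_eq_iff)
qed

lemma rho_neq: "rho i \<noteq> {lam j, stem (lam j)}" "rho (i + n - 1) \<noteq> rho i"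
proof -
  show "rho i \<noteq> {lam j, stem (lam j)}" using rho_T[of i] stem_T[OF lam_L[of j]] by metis
  have "Suc (i + n - 1) = i + n" using n3 by simp
  then show "rho (i + n - 1) \<noteq> rho i"
    using lam_Suc(1)[of "i + n - 1"] by (auto simp: rho_eq lam_eq)
qed

lemma sum_edges_at_leaf:
  fixes a :: "'a set \<Rightarrow> 'c :: comm_ring_1"
  shows "(\<Sum>f | f \<in> E \<and> lam i \<in> f. a f) = a (rho i) + a (rho (i + n - 1)) + a {lam i, stem (lam i)}"
  unfolding edges_at_leaf
  using rho_neq(1)[of i i] rho_neq(1)[of "i + n - 1" i] not_sym[OF rho_neq(2)[of i]]
  by (simp add: add.assoc)

text \<open>The spoke values are chosen in cancelling pairs, so the hub sum is 0 and the row of a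
  spoke is just a leaf sum. There are 2n rows and n variables \<open>x j\<close>, \<open>z j\<close>
  and \<open>y\<close>, so the only monomial that can survive is the product of all squares.\<close>

lemma good_0_odd_wheel:
  assumes D: "orientation E D" and n: "n = Suc (2 * Suc m)" and V: "V = insert h L" "h \<notin> L"
  shows "good 0 E E (edge_form D)"
proof -
  have stem_h: "stem (lam i) = h" for i
    using stem_V[OF lam_L] stem_notin_L[OF lam_L] V by blast
  define q where "q i = {lam i, h}" for i
  have q: "q i = {lam i, stem (lam i)}" for i by (simp add: q_def stem_h)
  have inj_q: "inj_on q {..<n}" unfolding q by (rule inj_on_stem_edge)
  have E_eq: "E = rho ` {..<n} \<union> q ` {..<n}"
  proof -
    have "T = q ` {..<n}"
    proof
      show "q ` {..<n} \<subseteq> T" using stem_T[OF lam_L] by (auto simp: q)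
      show "T \<subseteq> q ` {..<n}"
      proof
        fix e assume e: "e \<in> T"
        then show "e \<in> q ` {..<n}"
        proof (cases rule: T_cases)
          case (1 v)
          then show ?thesis using L_lam[of v] by (auto simp: q)
        next
          case (2 u v)
          then show ?thesis using V edgeT e by blast
        qed
      qed
    qed
    then show ?thesis unfolding E_def by blast
  qed
  have disj: "rho i \<noteq> q j" for i j unfolding q by (rule rho_neq)
  define x z :: "nat \<Rightarrow> (nat \<times> nat) tpoly" where "x j = tvar (0, j)" and "z j = tvar (1, j)" for j
  define y :: "(nat \<times> nat) tpoly" where "y = tvar (2, 0)"
  \<comment> \<open>Every second rim edge gets a fresh variable; the odd length leaves the closing
    edge over, which gets \<open>y\<close>. All edge values are signed single variables or 0, as
    vanishing cubes require.\<close>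
  define cz where "cz i = (if i = 2 * Suc m then y else if odd i then z (i div 2) else 0)" for i
  define ct where "ct i = (if i = 0 then 0 else if odd i then x (i div 2) else - x (i div 2 - 1))" for i
  define a where "a f = (if f \<in> rho ` {..<n} then cz (inv_into {..<n} rho f) else ct (inv_into {..<n} q f))" for f
  have a_rho: "a (rho i) = cz i" if "i < n" for i
    using that inj_on_rho by (auto simp: a_def)
  have a_q: "a (q i) = ct i" if "i < n" for i
    using that inj_q disj by (auto simp: a_def)
  \<comment> \<open>\<open>S i\<close> will be the sum at \<open>lam i\<close>: the leaves after
    \<open>lam 0\<close> pair up with sums \<open>z j + x j\<close> and \<open>z j - x j\<close>,
    and the closing edge adds \<open>y\<close> at both of its ends.\<close>
  define S where "S i = (if i = 0 then y else if odd i then z (i div 2) + x (i div 2)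
      else z (i div 2 - 1) - x (i div 2 - 1) + (if i = 2 * Suc m then y else 0))" for i
  have S_odd: "S (Suc (2 * j)) = z j + x j" for j by (simp add: S_def)
  have S_even: "S (Suc (Suc (2 * j))) = z j - x j + (if j = m then y else 0)" for j by (simp add: S_def)
  have S_0: "S 0 = y" by (simp add: S_def)
  have leaf_sum: "(\<Sum>f | f \<in> E \<and> lam i \<in> f. a f) = S i" if i: "i < n" for i
  proof -
    have "rho (i + n - 1) = rho (if i = 0 then n - 1 else i - 1)"
      using i by (auto simp: rho_eq mod_if)
    then have "(\<Sum>f | f \<in> E \<and> lam i \<in> f. a f) = cz i + cz (if i = 0 then n - 1 else i - 1) + ct i"
      using i unfolding sum_edges_at_leaf q[symmetric] by (simp add: a_rho a_q)
    also consider "i = 0" | j where "i = Suc (2 * j)" "j \<le> m" | j where "i = Suc (Suc (2 * j))" "j \<le> m"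
    proof (cases i)
      case (Suc l)
      then show ?thesis
        using that(2)[of "l div 2"] that(3)[of "l div 2"] i n by (cases "even l") auto
    qed (use that in auto)
    then have "cz i + cz (if i = 0 then n - 1 else i - 1) + ct i = S i"
      by cases (auto simp: S_0 S_odd S_even cz_def ct_def n)
    finally show ?thesis .
  qed
  have hub_sum: "(\<Sum>f | f \<in> E \<and> h \<in> f. a f) = 0"
  proof -
    have "{f. f \<in> E \<and> h \<in> f} = q ` {..<n}"
      using V lam_L by (auto simp: E_eq rho_def q_def)
    then have "(\<Sum>f | f \<in> E \<and> h \<in> f. a f) = (\<Sum>i<n. ct i)"
      using inj_q a_q by (simp add: sum.reindex)
    moreover have "(\<Sum>i<Suc (2 * l). ct i) = 0" for l
      by (induction l) (simp_all add: ct_def)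
    ultimately show ?thesis by (simp only: n)
  qed
  define row where "row = case_sum rho q"
  define I where "I = {..<n} <+> {..<n}"
  define l where "l = case_sum (\<lambda>i. S (Suc i mod n) - S i) S"
  have inj_row: "inj_on row I"
    using inj_onD[OF inj_on_rho] inj_onD[OF inj_q] disj
    unfolding I_def row_def by (intro inj_onI) (auto; metis)
  show ?thesis
  proof (rule goodI_ring_indexed[OF _ finE inj_row, where a = a and l = l])
    show "E = row ` I" unfolding E_eq I_def row_def by (simp add: Plus_def image_Un image_image)
    have "a f ^ 3 = 0" for f
      by (simp add: a_def cz_def ct_def x_def y_def z_def tvar_cube)
    then show "of_int 0 dvd a f ^ 3" for f by simp
    show "(\<Sum>f\<in>E. of_int (edge_form D (row i) f) * a f) \<in> {l i, - l i}" if "i \<in> I" for i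
    proof (cases i)
      case (Inl j)
      then have j: "j < n" using that by (auto simp: I_def)
      have r: "rho j = {lam (Suc j mod n), lam j}" by (simp add: rho_def per insert_commute)
      have e: "{lam (Suc j mod n), lam j} \<in> E" using rho_E[of j] unfolding r .
      have j': "Suc j mod n < n" using n3 by simp
      show ?thesis
        using edge_form_sum[OF D e finE, of a]
        unfolding leaf_sum[OF j] leaf_sum[OF j'] r[symmetric] by (simp only: Inl row_def l_def sum.case)
    next
      case (Inr j)
      then have j: "j < n" using that by (auto simp: I_def)
      then have "q j \<in> E" by (auto simp: E_eq)
      then have e: "{lam j, h} \<in> E" by (simp only: q_def)
      show ?thesis
        using edge_form_sum[OF D e finE, of a]
        unfolding leaf_sum[OF j] hub_sum q_def[symmetric] diff_zero
        by (simp only: Inr row_def l_def sum.case)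
    qed
    define A :: "(nat \<times> nat) set" where "A = insert (2, 0) ({0, 1} \<times> {..<Suc m})"
    define W where "W j = S (2 * j)" for j
    define f where "f j = (z j + x j) * (z j - x j) * (z j + x j - W j) * ((z j - x j) - (z j + x j))" for j
    have lt: "S (Suc i mod n) = S (Suc i)" if "i < 2 * Suc m" for i using that n by simp
    have "(\<Prod>i<n. S (Suc i mod n) - S i) =
        (\<Prod>j<Suc m. (S (Suc (2 * j)) - S (2 * j)) * (S (Suc (Suc (2 * j))) - S (Suc (2 * j)))) * (y - S (2 * Suc m))"
    proof -
      define g where "g i = S (Suc i mod n) - S i" for i
      have "g (2 * Suc m) = y - S (2 * Suc m)" by (simp only: g_def n[symmetric] mod_self S_0)
      moreover have "(\<Prod>i<n. g i) = (\<Prod>i<2 * Suc m. g i) * g (2 * Suc m)"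
        by (subst n) (rule prod.lessThan_Suc)
      ultimately have "(\<Prod>i<n. S (Suc i mod n) - S i) = (\<Prod>i<2 * Suc m. S (Suc i mod n) - S i) * (y - S (2 * Suc m))"
        by (simp only: g_def)
      also have "(\<Prod>i<2 * Suc m. S (Suc i mod n) - S i) = (\<Prod>i<2 * Suc m. S (Suc i) - S i)"
        by (rule prod.cong) (simp_all add: lt)
      finally show ?thesis by (simp only: prod_even_interval)
    qed
    moreover have "(\<Prod>i<n. S i) = y * (\<Prod>j<Suc m. S (Suc (2 * j)) * S (Suc (Suc (2 * j))))"
      unfolding n prod_odd_interval S_0 ..
    ultimately have "(\<Prod>i\<in>I. l i) = y * (\<Prod>j<Suc m. S (Suc (2 * j)) * S (Suc (Suc (2 * j))) *
        (S (Suc (2 * j)) - S (2 * j)) * (S (Suc (Suc (2 * j))) - S (Suc (2 * j)))) * (y - S (2 * Suc m))"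
      unfolding I_def l_def by (simp add: prod.Plus prod.distrib mult_ac)
    also have "\<dots> = y * (\<Prod>j<m. f j) * ((z m + x m) * (z m - x m + y) * (z m + x m - W m) *
      ((z m - x m + y) - (z m + x m)) * (y - (z m - x m + y)))"
    proof -
      have "(\<Prod>j<m. S (Suc (2 * j)) * S (Suc (Suc (2 * j))) *
        (S (Suc (2 * j)) - S (2 * j)) * (S (Suc (Suc (2 * j))) - S (Suc (2 * j)))) = (\<Prod>j<m. f j)"
        by (rule prod.cong) (simp_all add: f_def W_def S_odd S_even)
      moreover have "S (2 * Suc m) = z m - x m + y" using S_even[of m] by simp
      ultimately show ?thesis
        by (simp only: prod.lessThan_Suc S_odd[of m] S_even[of m] W_def mult.assoc if_True simp_thms)
    qed
    also have "\<dots> = of_int (6 * (-2) ^ m) * (y ^ 2 * (\<Prod>j<Suc m. x j ^ 2 * z j ^ 2))"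
      unfolding f_def
    proof (rule wheel_product)
      show "W (Suc j) = z j - x j" if "j < m" for j using that S_even[of j] by (simp add: W_def)
    qed (simp_all add: x_def y_def z_def tvar_cube W_def S_def)
    also have "y ^ 2 * (\<Prod>j<Suc m. x j ^ 2 * z j ^ 2) = (\<Prod>v\<in>A. tvar v ^ 2)"
      unfolding A_def
      by (subst prod.insert) (auto simp: y_def x_def z_def prod.distrib prod.cartesian_product'
          simp del: prod.lessThan_Suc)
    finally have eq: "(\<Prod>i\<in>I. l i) = of_int (6 * (-2) ^ m) * (\<Prod>v\<in>A. tvar v ^ 2)" .
    show "\<not> of_int 0 dvd (\<Prod>i\<in>I. l i)"
    proof
      assume "of_int 0 dvd (\<Prod>i\<in>I. l i)"
      then have "(0 :: int) dvd 6 * (-2) ^ m"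
        unfolding eq by (rule dvd_squares_tvar[rotated]) (simp add: A_def)
      then show False by simp
    qed
  qed (simp add: I_def)
qed

end

section \<open>The boundary walk of a plane tree\<close>

lemma cycle_edgesI: "i < length xs \<Longrightarrow> {xs ! i, xs ! (Suc i mod length xs)} \<in> cycle_edges xs"
  by (auto simp: cycle_edges_def)

lemma cycle_edges_adjacent: "{a, b} \<in> cycle_edges (ys @ [a, b] @ zs)"
  using cycle_edgesI[of "length ys" "ys @ [a, b] @ zs"] by (simp add: nth_append)

lemma cycle_edges_last_hd:
  assumes "xs \<noteq> []"
  shows "{last xs, hd xs} \<in> cycle_edges xs"
  using cycle_edgesI[of "length xs - 1" xs] assms by (simp add: last_conv_nth hd_conv_nth)

lemma upt_split:
  assumes "k < m" "m \<le> t"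
  shows "[0..<t] = [0..<k] @ k # [Suc k..<m] @ [m..<t]"
proof -
  have "[0..<t] = [0..<k] @ [k..<t]" using upt_add_eq_append[of 0 k "t - k"] assms by simp
  also have "[k..<t] = [k..<m] @ [m..<t]" using upt_add_eq_append[of k m "t - m"] assms by simp
  also have "[k..<m] = k # [Suc k..<m]" using assms(1) by (rule upt_conv_Cons)
  finally show ?thesis by simp
qed

text \<open>Two marked positions with no marked position between them in a periodic sequence are
  neighbours in the filtered list, or its last and first entries.\<close>

lemma cycle_edges_filter_periodic:
  fixes g :: "nat \<Rightarrow> 'a"
  assumes xs: "xs = filter P (map g [0..<N])" "distinct xs" "2 \<le> length xs"
    and per: "\<And>k. g (k + t) = g k" "0 < t" "t \<le> N"
    and k: "k < N" "P (g k)" and K: "0 < K" "P (g (k + K))" "\<And>i. 0 < i \<Longrightarrow> i < K \<Longrightarrow> \<not> P (g (k + i))"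
  shows "{g k, g (k + K)} \<in> cycle_edges xs"
proof -
  have uniq: "i = j" if "i < N" "j < N" "P (g i)" "g i = g j" for i j
  proof (rule ccontr)
    assume "i \<noteq> j"
    have "\<not> distinct xs" if "i < j" "j < N" "P (g i)" "g i = g j" for i j
    proof -
      have "[0..<N] = [0..<i] @ i # [Suc i..<j] @ j # [Suc j..<N]"
        using upt_split[of i j N] upt_conv_Cons[of j N] that by simp
      then show ?thesis using that unfolding xs(1) by simp
    qed
    then show False using \<open>i \<noteq> j\<close> that xs(2) by (metis nat_neq_iff)
  qed
  \<comment> \<open>The listed range may exceed one period; a marked entry beyond the first period
    would repeat an earlier one, against distinctness.\<close>
  have none: "\<not> P (g i)" if "t \<le> i" "i < N" for i
  proof
    assume P: "P (g i)"
    have lt: "i - t < N" and eq: "i - t + t = i" and neq: "i \<noteq> i - t" using per(2) that by linarith+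
    have "g i = g (i - t)" using per(1)[of "i - t"] unfolding eq .
    then show False using uniq[OF that(2) lt P] neq by blast
  qed
  have xs_t: "xs = filter P (map g [0..<t])"
  proof -
    have "[0..<N] = [0..<t] @ [t..<N]" using upt_add_eq_append[of 0 t "N - t"] per(3) by simp
    then show ?thesis using none unfolding xs(1) by (simp add: filter_empty_conv)
  qed
  have kt: "k < t" using none k by (meson not_le)
  show ?thesis
  proof (cases "k + K < t")
    case True
    have "[0..<t] = [0..<k] @ k # [Suc k..<k + K] @ (k + K) # [Suc (k + K)..<t]"
      using upt_split[of k "k + K" t] upt_conv_Cons[of "k + K" t] K(1) True by simp
    moreover have "filter P (map g [Suc k..<k + K]) = []"
    proof -
      have "\<not> P (g i)" if "i \<in> set [Suc k..<k + K]" for i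
      proof -
        have "0 < i - k" "i - k < K" "k + (i - k) = i" using that by auto
        then show ?thesis using K(3) by metis
      qed
      then show ?thesis by (simp add: filter_empty_conv)
    qed
    ultimately have eq: "xs = filter P (map g [0..<k]) @ [g k, g (k + K)] @ filter P (map g [Suc (k + K)..<t])"
      unfolding xs_t using k K by simp
    show ?thesis by (subst eq) (rule cycle_edges_adjacent)
  next
    case False
    \<comment> \<open>The next marked position lies in the following period. Shifted back it heads
      the list, while \<open>k\<close> ends it, so the pair is the closing edge of the
      cycle.\<close>
    define j where "j = k + K - t"
    have jt: "j + t = k + K" using False by (simp add: j_def)
    have gj: "g j = g (k + K)" using per(1)[of j] unfolding jt by simp
    have before: "\<not> P (g i)" if "i < j" for i
    proof -
      have "0 < i + t - k" "i + t - k < K" "k + (i + t - k) = i + t" using kt that jt by linarith+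
      then show ?thesis using K(3)[of "i + t - k"] per(1)[of i] by simp
    qed
    have after: "\<not> P (g i)" if "k < i" "i < t" for i
    proof -
      have "0 < i - k" "i - k < K" "k + (i - k) = i" using that False by linarith+
      then show ?thesis using K(3) by metis
    qed
    have "j \<le> k" using before k(2) by (meson not_le)
    have "[0..<t] = [0..<j] @ j # [Suc j..<t]"
      using upt_split[of j "Suc j" t] \<open>j \<le> k\<close> kt by simp
    moreover have "filter P (map g [0..<j]) = []" using before by (simp add: filter_empty_conv)
    ultimately have hd: "xs = g j # filter P (map g [Suc j..<t])"
      unfolding xs_t using K(2) gj by simp
    have "[0..<t] = [0..<k] @ k # [Suc k..<t]"
      using upt_split[of k "Suc k" t] kt by simp
    moreover have "filter P (map g [Suc k..<t]) = []" using after by (simp add: filter_empty_conv)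
    ultimately have last: "xs = filter P (map g [0..<k]) @ [g k]"
      unfolding xs_t using k(2) by simp
    have "last xs = g k" by (subst last) simp
    moreover have "hd xs = g (k + K)" by (subst hd) (simp add: gj)
    moreover have "xs \<noteq> []" using xs(3) by auto
    ultimately show ?thesis using cycle_edges_last_hd by metis
  qed
qed

lemma cyclic_on_inj: "cyclic_on f S \<Longrightarrow> inj_on f S"
proof (rule finite_surj_inj)
  assume c: "cyclic_on f S"
  then show "finite S" by (rule finite_cyclic_on)
  show "S \<subseteq> f ` S"
  proof
    fix y assume y: "y \<in> S"
    then have S: "S = orbit f y" using c by (simp add: cyclic_on_alldef)
    then have "y \<in> orbit f y" using y by simp
    then show "y \<in> f ` S"
    proof cases
      case base
      then show ?thesis using y by (metis image_eqI)
    next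
      case (step x)
      then show ?thesis using S by (metis image_eqI)
    qed
  qed
qed

text \<open>These are the hanging paths of the overview: attached at \<open>v\<close>, with first
  vertex \<open>a\<close> and final leaf \<open>l\<close>, all vertices strictly between
  \<open>v\<close> and \<open>l\<close> having degree 2. The length \<open>k\<close> includes the
  edge at \<open>v\<close>.\<close>

inductive chain :: "'a set set \<Rightarrow> 'a \<Rightarrow> 'a \<Rightarrow> 'a \<Rightarrow> nat \<Rightarrow> bool" for T where
  base: "{v, a} \<in> T \<Longrightarrow> leaf T a \<Longrightarrow> chain T v a a 1"
| step: "{v, a} \<in> T \<Longrightarrow> neighbours T a = {v, b} \<Longrightarrow> b \<noteq> v \<Longrightarrow> chain T a b l k \<Longrightarrow> chain T v a l (Suc k)"

lemma chain_edge: "chain T v a l k \<Longrightarrow> {v, a} \<in> T"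
  by (induction rule: chain.induct)

lemma chain_colour:
  assumes "chain T v a l k" and "\<And>u v. {u, v} \<in> T \<Longrightarrow> col u \<noteq> (col v :: bool)"
  shows "col l = col v \<longleftrightarrow> even k"
  using assms(1)
proof (induction rule: chain.induct)
  case (base v a)
  then show ?case using assms(2)[of v a] by auto
next
  case (step v a b l k)
  then show ?case using assms(2)[of v a] by auto
qed

locale plane_tree =
  fixes V :: "'a set" and T :: "'a set set" and rot :: "'a \<Rightarrow> 'a \<Rightarrow> 'a" and xs :: "'a list"
  assumes sg: "simple_graph V T" and rots: "rotation_system V T rot"
    and order: "leaves_in_order T rot xs" and cyc: "cycle_seq xs" and set_xs: "set xs = {v \<in> V. leaf T v}"
begin

lemma edge: "{u, v} \<in> T \<Longrightarrow> u \<in> V \<and> v \<in> V \<and> u \<noteq> v"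
proof -
  assume uv: "{u, v} \<in> T"
  obtain x y where "x \<in> V" "y \<in> V" "x \<noteq> y" "{u, v} = {x, y}"
    using simple_graph_edgeE[OF sg uv] .
  then show ?thesis by (auto simp: doubleton_eq_iff)
qed

lemma cyclic: "v \<in> V \<Longrightarrow> cyclic_on (rot v) (neighbours T v)"
  using rots by (simp add: rotation_system_def)

lemma rot_edge: "{u, v} \<in> T \<Longrightarrow> {v, rot v u} \<in> T"
  using cyclic_on_inI[OF cyclic, of v u] edge[of u v] by (simp add: neighbours_def insert_commute)

text \<open>A cyclic permutation of two points swaps them, so the face walk passes straight through
  a vertex of degree 2.\<close>

lemma rot_two: "a \<in> V \<Longrightarrow> neighbours T a = {v, b} \<Longrightarrow> b \<noteq> v \<Longrightarrow> rot a v = b"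
proof (rule ccontr)
  assume a: "a \<in> V" and nb: "neighbours T a = {v, b}" "b \<noteq> v" and "rot a v \<noteq> b"
  then have fx: "rot a v = v" using cyclic_on_inI[OF cyclic[OF a], of v] by auto
  have "b \<in> orbit (rot a) v" using cyclic[OF a] nb by (auto simp: cyclic_on_alldef)
  moreover have "x = v" if "x \<in> orbit (rot a) v" for x
    using that by induction (simp_all add: fx)
  ultimately show False using nb by blast
qed

abbreviation F :: "'a \<times> 'a \<Rightarrow> 'a \<times> 'a" where
  "F \<equiv> face_step rot"

lemma F_simp [simp]: "F (a, b) = (b, rot b a)"
  by (simp add: face_step_def)

text \<open>The walk consists of directed edges. The one leaving \<open>l\<close> is number 0, so
  \<open>(a, v)\<close> is number \<open>k - 1\<close>, and \<open>v\<close> is the source of number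
  \<open>k\<close>.\<close>

lemma walk_up:
  assumes "chain T v a l k"
  shows "\<exists>p. {l, p} \<in> T \<and> (F ^^ (k - 1)) (l, p) = (a, v) \<and>
    (\<forall>i. 0 < i \<and> i < k \<longrightarrow> \<not> leaf T (fst ((F ^^ i) (l, p)))) \<and> 0 < k \<and> leaf T l \<and> l \<in> V"
  using assms
proof (induction rule: chain.induct)
  case (base v a)
  then show ?case using edge[of v a] by (intro exI[of _ v]) (auto simp: insert_commute)
next
  case (step v a b l k)
  then obtain p where p: "{l, p} \<in> T" "(F ^^ (k - 1)) (l, p) = (b, a)"
    "\<forall>i. 0 < i \<and> i < k \<longrightarrow> \<not> leaf T (fst ((F ^^ i) (l, p)))" "0 < k" "leaf T l" "l \<in> V" by blast
  have k: "(F ^^ k) (l, p) = F ((F ^^ (k - 1)) (l, p))"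
    using p(4) by (cases k) simp_all
  have nb: "neighbours T a = {b, v}" "v \<noteq> b" using step.hyps by auto
  have "a \<in> V" using edge[OF step.hyps(1)] by simp
  then have Fk: "(F ^^ k) (l, p) = (a, v)"
    unfolding k p(2) by (simp add: rot_two[OF _ nb])
  have "\<not> leaf T a" using nb by (simp add: leaf_def)
  then have "\<forall>i. 0 < i \<and> i < Suc k \<longrightarrow> \<not> leaf T (fst ((F ^^ i) (l, p)))"
    using p(3) Fk by (auto simp: less_Suc_eq)
  then show ?case using p Fk by (intro exI[of _ p]) simp
qed

lemma walk_down:
  assumes "chain T v a l k"
  shows "fst ((F ^^ k) (v, a)) = l \<and> (\<forall>i. 0 < i \<and> i < k \<longrightarrow> \<not> leaf T (fst ((F ^^ i) (v, a)))) \<and> leaf T l"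
  using assms
proof (induction rule: chain.induct)
  case (base v a)
  then show ?case by simp
next
  case (step v a b l k)
  have "a \<in> V" using edge[OF step.hyps(1)] by simp
  then have F1: "F (v, a) = (a, b)" using rot_two[OF _ step.hyps(2,3)] by simp
  have Fi: "(F ^^ Suc i) (v, a) = (F ^^ i) (a, b)" for i
    unfolding funpow_Suc_right comp_apply F1 ..
  have "\<not> leaf T a" using step.hyps(2,3) by (simp add: leaf_def)
  then have "\<not> leaf T (fst ((F ^^ i) (v, a)))" if "0 < i" "i < Suc k" for i
  proof (cases i)
    case (Suc j)
    then show ?thesis using step.IH that \<open>\<not> leaf T a\<close> unfolding Suc Fi by (cases "j = 0") auto
  qed (use that in simp)
  then show ?case using step.IH unfolding Fi by blast
qed

text \<open>\<open>face_step\<close> is injective on the directed edges, so a repetition can be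
  cancelled back to the start. The bound guarantees that \<open>boundary_walk\<close> covers a full
  period.\<close>

lemma periodic:
  assumes "{u, v} \<in> T"
  obtains t where "0 < t" "t \<le> 2 * card T" "(F ^^ t) (u, v) = (u, v)"
proof -
  define A where "A = {(a, b). {a, b} \<in> T}"
  have finT: "finite T" using sg by (rule simple_graph_finite_edges)
  have sub: "A \<subseteq> V \<times> V" unfolding A_def using edge by blast
  then have finA: "finite A" using sg finite_subset unfolding simple_graph_def by blast
  have "card A \<le> 2 * card T"
  proof -
    have "card A \<le> card (\<Union>e\<in>T. {d \<in> A. {fst d, snd d} = e})"
      using finT finA by (intro card_mono) (auto simp: A_def)
    also have "\<dots> \<le> (\<Sum>e\<in>T. card {d \<in> A. {fst d, snd d} = e})"
      by (rule card_UN_le[OF finT])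
    also have "\<dots> \<le> (\<Sum>e\<in>T. 2)"
    proof (rule sum_mono)
      fix e assume e: "e \<in> T"
      obtain x y where "e = {x, y}" using simple_graph_edgeE[OF sg e] .
      then have "{d \<in> A. {fst d, snd d} = e} \<subseteq> {(x, y), (y, x)}"
        by (auto simp: doubleton_eq_iff)
      then have "card {d \<in> A. {fst d, snd d} = e} \<le> card {(x, y), (y, x)}" by (rule card_mono[rotated]) simp
      also have "\<dots> \<le> 2" by (simp add: card_insert_le_m1)
      finally show "card {d \<in> A. {fst d, snd d} = e} \<le> 2" .
    qed
    finally show ?thesis by simp
  qed
  have FA: "F d \<in> A" if "d \<in> A" for d
    using that rot_edge by (cases d) (auto simp: A_def)
  have injF: "inj_on F A"
  proof (rule inj_onI)
    fix d d' assume d: "d \<in> A" "d' \<in> A" "F d = F d'"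
    obtain a b a' b' where ab: "d = (a, b)" "d' = (a', b')" by (cases d, cases d')
    then have "b = b'" "rot b a = rot b a'" using d by auto
    moreover have "a \<in> neighbours T b" "a' \<in> neighbours T b" "b \<in> V"
      using d(1,2) edge[of a b] unfolding ab \<open>b = b'\<close> A_def by (simp_all add: neighbours_def insert_commute)
    ultimately show "d = d'" using cyclic_on_inj[OF cyclic] ab by (metis inj_onD)
  qed
  let ?d = "\<lambda>i. (F ^^ i) (u, v)"
  have dA: "?d i \<in> A" for i by (induction i) (use assms FA in \<open>auto simp: A_def\<close>)
  have "\<not> inj_on ?d {..card A}"
  proof
    assume "inj_on ?d {..card A}"
    then have "card {..card A} \<le> card A" using dA finA by (intro card_inj_on_le) auto
    then show False by simp
  qed
  then obtain i j where ij: "i < j" "j \<le> card A" "?d i = ?d j"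
    unfolding inj_on_def by (metis atMost_iff nat_neq_iff)
  have cancel: "?d 0 = ?d m" if "?d i = ?d (i + m)" for i m
    using that
  proof (induction i)
    case (Suc i)
    then have "F (?d i) = F (?d (i + m))" by simp
    then show ?case using inj_onD[OF injF] dA Suc.IH by blast
  qed simp
  have "?d 0 = ?d (j - i)" using cancel[of i "j - i"] ij by simp
  then show ?thesis using that[of "j - i"] ij \<open>card A \<le> 2 * card T\<close> by simp
qed

text \<open>The face walk leaves \<open>l\<close>, climbs the first path, turns at \<open>v\<close>
  from \<open>a\<close> to \<open>rot v a\<close> and descends the second path, meeting no other
  leaf on the way. This ties the rim to the rotation system.\<close>

lemma consecutive_chains:
  assumes c: "chain T v a l k" and c': "chain T v (rot v a) l' k'" and neq: "rot v a \<noteq> a"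
  shows "{l, l'} \<in> cycle_edges xs"
proof -
  obtain p where p: "{l, p} \<in> T" "(F ^^ (k - 1)) (l, p) = (a, v)"
    "\<forall>i. 0 < i \<and> i < k \<longrightarrow> \<not> leaf T (fst ((F ^^ i) (l, p)))" "0 < k" "leaf T l" "l \<in> V"
    using walk_up[OF c] by blast
  have Fk: "(F ^^ k) (l, p) = (v, rot v a)"
    using p(2,4) by (cases k) simp_all
  have Fki: "(F ^^ (k + i)) (l, p) = (F ^^ i) (v, rot v a)" for i
    by (simp add: add.commute[of k] funpow_add Fk)
  note down = walk_down[OF c']
  have k': "0 < k'" using c' by cases auto
  have "\<not> leaf T v"
  proof
    assume "leaf T v"
    then obtain w where "neighbours T v = {w}" by (auto simp: leaf_def card_1_singleton_iff)
    moreover have "a \<in> neighbours T v" "rot v a \<in> neighbours T v"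
      using chain_edge[OF c] chain_edge[OF c'] by (auto simp: neighbours_def)
    ultimately show False using neq by simp
  qed
  then have none: "\<not> leaf T (fst ((F ^^ i) (l, p)))" if "0 < i" "i < k + k'" for i
  proof (cases "i < k")
    case False
    then obtain j where j: "i = k + j" using le_Suc_ex by (metis not_less)
    then show ?thesis using down that \<open>\<not> leaf T v\<close> unfolding j Fki by (cases "j = 0") auto
  qed (use p(3) that in blast)
  obtain u w where uw: "{u, w} \<in> T" "xs = filter (leaf T) (boundary_walk T rot (u, w))"
    using order by (auto simp: leaves_in_order_def)
  obtain t where t: "0 < t" "t \<le> 2 * card T" "(F ^^ t) (u, w) = (u, w)" using periodic[OF uw(1)] .
  define g where "g i = fst ((F ^^ i) (u, w))" for i
  have per: "g (i + t) = g i" for i by (simp add: g_def funpow_add t(3))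
  have xs: "xs = filter (leaf T) (map g [0..<2 * card T])"
    using uw(2) unfolding boundary_walk_def g_def[abs_def] .
  have "l \<in> set xs" using set_xs p(5,6) by simp
  then obtain m where m: "m < 2 * card T" "g m = l" unfolding xs by auto
  \<comment> \<open>Only one directed edge leaves a leaf, so meeting \<open>l\<close> determines the
    directed edge.\<close>
  have "(F ^^ m) (u, w) = (l, p)"
  proof -
    obtain q where q: "(F ^^ m) (u, w) = (l, q)" using m(2) by (cases "(F ^^ m) (u, w)") (simp add: g_def)
    have "{fst ((F ^^ i) (u, w)), snd ((F ^^ i) (u, w))} \<in> T" for i
      by (induction i) (use uw(1) rot_edge in \<open>auto simp: face_step_def\<close>)
    from this[of m] have "{l, q} \<in> T" by (simp add: q)
    moreover obtain z where "neighbours T l = {z}" using p(5) by (auto simp: leaf_def card_1_singleton_iff)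
    moreover have "{l, p} \<in> T" by (rule p(1))
    ultimately have "q \<in> {z}" "p \<in> {z}" by (auto simp: neighbours_def)
    then have "q = p" by simp
    then show ?thesis using q by simp
  qed
  then have gm: "g (m + i) = fst ((F ^^ i) (l, p))" for i
    by (simp add: g_def add.commute[of m] funpow_add)
  have "{g m, g (m + (k + k'))} \<in> cycle_edges xs"
  proof (rule cycle_edges_filter_periodic[OF xs])
    show "distinct xs" "2 \<le> length xs" using cyc by (auto simp: cycle_seq_def)
    show "leaf T (g (m + (k + k')))" unfolding gm Fki using down by simp
  qed (use per t m p none k' in \<open>auto simp: gm\<close>)
  then show ?thesis unfolding gm Fki using down m(2) by simp
qed

end

section \<open>The bipartite case\<close>

lemma (in rooted_tree) child_exists:
  assumes "u \<in> V" "u \<noteq> r" "\<not> leaf T u"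
  obtains c where "c \<in> V" "c \<noteq> r" "par c = u"
proof -
  have "neighbours T u \<noteq> {par u}" using assms(3) by (auto simp: leaf_def)
  moreover have "par u \<in> neighbours T u" using par[OF assms(1,2)] by (simp add: neighbours_def)
  ultimately obtain c where "{u, c} \<in> T" "c \<noteq> par u" by (auto simp: neighbours_def)
  then show ?thesis using that[of c] edge_par[of u c] edgeV[of u c] by auto
qed

lemma edge_form_pair:
  assumes "orientation E D" "{a, b} \<in> E"
  shows "\<exists>s\<in>{1, -1}. \<forall>f. edge_form D {a, b} f = s * (of_bool (a \<in> f) - of_bool (b \<in> f))"
  using orientation_cases[OF assms]
  by cases (auto simp: edge_form_def intro: bexI[of _ "-1"] bexI[of _ 1])

lemma edge_form_disjoint:
  assumes "orientation E D" "e \<in> E" "edge_form D e f \<noteq> 0"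
  shows "f \<noteq> e \<and> e \<inter> f \<noteq> {}"
proof -
  have "fst (D e) \<in> e" "snd (D e) \<in> e" using orientationD[OF assms(1,2)] by blast+
  then show ?thesis using assms(3) by (auto simp: edge_form_def of_bool_def split: if_splits)
qed

context halin
begin

lemma edge_form_adjacent:
  assumes D: "orientation E D" and e: "e \<in> E" "f \<in> E" "f \<noteq> e" "x \<in> e" "x \<in> f"
  shows "edge_form D e f \<noteq> 0"
proof -
  obtain a b where ab: "a \<noteq> b" "e = {a, b}" using simple_graph_edgeE[OF simple_graph_E e(1)] .
  have "\<not> (a \<in> f \<and> b \<in> f)"
    using simple_graph_edge_eq[OF simple_graph_E e(2), of a b] ab e(3) by blast
  moreover have "a \<in> f \<or> b \<in> f" using e(4,5) ab by auto
  ultimately show ?thesis using edge_form_pair[OF D, of a b] e(1) unfolding ab(2) by auto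
qed

lemma tree_edge_at_interior:
  assumes "f \<in> E" "x \<in> f" "x \<notin> L"
  shows "f \<in> T"
  using assms lam_L unfolding E_def rho_def by auto

lemma rho_pred: "0 < i \<Longrightarrow> lam i \<in> rho (i - 1)"
  by (simp add: rho_def)

text \<open>
  Once the two rim edges and the tree edge at \<open>lam 0\<close> are taken care of, each rim edge
  \<open>rho (i - 1)\<close> serves the rows of \<open>rho i\<close> and of the tree edge at \<open>lam i\<close>, and each inner
  tree edge is served by an edge one level further from the root.
\<close>

lemma good_0_peel:
  assumes D: "orientation E D" and rooted: "rooted_tree V T r par dep" and R: "R \<subseteq> E"
    and rim: "\<And>i. i < n \<Longrightarrow> rho i \<in> R \<Longrightarrow> 0 < i \<and> i < n - 1"
    and lf: "\<And>i. i < n \<Longrightarrow> {lam i, stem (lam i)} \<in> R \<Longrightarrow> 0 < i"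
  shows "\<exists>F \<subseteq> E. good 0 R F (edge_form D) \<and>
    (\<forall>f\<in>F. (\<exists>i<n. 0 < i \<and> f = rho (i - 1) \<and> (rho i \<in> R \<or> {lam i, stem (lam i)} \<in> R)) \<or>
      (\<exists>e\<in>R. \<exists>u c. u \<in> V \<and> u \<noteq> r \<and> e = {u, par u} \<and> c \<in> V \<and> c \<noteq> r \<and> par c = u \<and> f = {c, par c}))"
proof -
  interpret rooted_tree V T r par dep by (rule rooted)
  define B where "B = Suc (Max (dep ` V))"
  have dep_B: "dep v < B" if "v \<in> V" for v
    unfolding B_def using that finV by (simp add: less_Suc_eq_le)
  define ch where "ch e = (SOME c. c \<in> V \<and> c \<noteq> r \<and> par c = low e)" for e
  define ix where "ix e = (THE i. i < n \<and> (e = rho i \<or> e = {lam i, stem (lam i)}))" for e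
  define inner where "inner e \<longleftrightarrow> e \<in> T \<and> e \<inter> L = {}" for e
  define var where "var e = (if inner e then {ch e, par (ch e)} else rho (ix e - 1))" for e
  \<comment> \<open>Rim edges outweigh all tree edges and become lighter along the rim, so
    \<open>rho (i - 1)\<close> dominates the other variables at \<open>lam i\<close>. A tree edge
    weighs the depth of its lower end, so the child edges of an inner tree edge are heavier than the
    other edges it meets.\<close>
  define w where "w f = (if f \<in> T then dep (low f) else B + n - (THE j. j < n \<and> f = rho j))" for f
  have ix_rho: "ix (rho i) = i" if "i < n" for i
    unfolding ix_def using that rho_neq(1) by (intro the_equality) (auto simp: rho_eq)
  have ix_leaf: "ix {lam i, stem (lam i)} = i" if "i < n" for i
    unfolding ix_def
  proof (rule the_equality)
    fix j assume "j < n \<and> ({lam i, stem (lam i)} = rho j \<or> {lam i, stem (lam i)} = {lam j, stem (lam j)})"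
    then show "j = i" using rho_neq(1)[of j i] inj_onD[OF inj_on_stem_edge, of i j] that by auto
  qed (use that in auto)
  have w_rho: "w (rho j) = B + n - j" if "j < n" for j
  proof -
    have "(THE i. i < n \<and> rho j = rho i) = j"
      using that by (intro the_equality) (auto simp: rho_eq)
    then show ?thesis by (simp add: w_def rho_T)
  qed
  have w_T: "w f < B" if "f \<in> T" for f using that low[OF that] dep_B by (simp add: w_def)
  have ch: "ch e \<in> V" "ch e \<noteq> r" "par (ch e) = low e" if "inner e" for e
  proof -
    have "low e \<in> V" "low e \<noteq> r" "low e \<in> e" using low[of e] that unfolding inner_def by blast+
    then have "\<not> leaf T (low e)" using that L_leaf unfolding inner_def by blast
    then obtain c where "c \<in> V \<and> c \<noteq> r \<and> par c = low e"
      using child_exists \<open>low e \<in> V\<close> \<open>low e \<noteq> r\<close> by metis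
    then have "ch e \<in> V \<and> ch e \<noteq> r \<and> par (ch e) = low e" unfolding ch_def by (rule someI)
    then show "ch e \<in> V" "ch e \<noteq> r" "par (ch e) = low e" by auto
  qed
  have var_in: "{ch e, par (ch e)} \<in> T" "low {ch e, par (ch e)} = ch e" if "inner e" for e
    using par[OF ch(1,2)[OF that]] low_eq[OF ch(1,2)[OF that]] by blast+
  have cases: "inner e \<and> var e = {ch e, par (ch e)} \<or>
      (\<exists>i<n. 0 < i \<and> var e = rho (i - 1) \<and> lam i \<in> e \<and> (e = rho i \<and> i < n - 1 \<or> e = {lam i, stem (lam i)}))"
    if e: "e \<in> R" for e
  proof -
    consider i where "i < n" "e = rho i" | "e \<in> T" using e R unfolding E_def by blast
    then show ?thesis
    proof cases
      case (1 i)
      moreover have "\<not> inner e" using 1 by (auto simp: inner_def rho_def)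
      moreover have "0 < i \<and> i < n - 1" using rim[OF 1(1)] e 1(2) by simp
      moreover have "lam i \<in> e" using 1 by (simp add: rho_def)
      ultimately show ?thesis using ix_rho by (auto simp: var_def)
    next
      case 2
      then show ?thesis
      proof (cases rule: T_cases)
        case (1 v)
        then obtain i where i: "i < n" "v = lam i" using L_lam by blast
        moreover have "\<not> inner e" using 1 by (auto simp: inner_def)
        moreover have "0 < i" using lf[OF i(1)] e 1 i by simp
        ultimately show ?thesis using ix_leaf[OF i(1)] 1 by (auto simp: var_def)
      next
        case (2 u v)
        then show ?thesis using \<open>e \<in> T\<close> by (auto simp: var_def inner_def)
      qed
    qed
  qed
  have var_E: "var e \<in> E" if "e \<in> R" for e
    using cases[OF that] var_in(1)[of e] by (auto simp: E_def)
  have "good 0 R (var ` R) (edge_form D)"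
  proof (rule good_leading[where w = w])
    show "finite R" using R finE finite_subset by blast
    fix e assume e: "e \<in> R"
    then have eE: "e \<in> E" using R by blast
    show "\<not> 0 dvd edge_form D e (var e)"
    proof -
      have "\<exists>x. x \<in> e \<and> x \<in> var e \<and> var e \<noteq> e"
        using cases[OF e]
      proof (elim disjE exE conjE)
        assume i: "inner e" "var e = {ch e, par (ch e)}"
        have "low e \<in> e" using low[of e] i(1) unfolding inner_def by blast
        moreover have "low (var e) \<noteq> low e"
          using var_in(2)[OF i(1)] i(2) ch[OF i(1)] dep_par[of "ch e"] by auto
        ultimately show ?thesis using i ch(3)[OF i(1)] by auto
      next
        fix i assume i: "i < n" "0 < i" "var e = rho (i - 1)" "lam i \<in> e" "e = rho i" "i < n - 1"
        then have "rho (i - 1) \<noteq> rho i" by (simp add: rho_eq)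
        then show ?thesis using i rho_pred[OF i(2)] by auto
      next
        fix i assume i: "i < n" "0 < i" "var e = rho (i - 1)" "lam i \<in> e" "e = {lam i, stem (lam i)}"
        then show ?thesis using rho_pred[OF i(2)] rho_neq(1)[of "i - 1" i] by auto
      qed
      then show ?thesis using edge_form_adjacent[OF D eE var_E[OF e]] by auto
    qed
    fix e' assume e': "e' \<in> R" and nz: "edge_form D e (var e') \<noteq> 0" and neq: "var e' \<noteq> var e"
    have adj: "var e' \<noteq> e" "e \<inter> var e' \<noteq> {}" using edge_form_disjoint[OF D eE nz] by auto
    show "w (var e') < w (var e)"
      using cases[OF e]
    proof (elim disjE exE conjE)
      assume i: "inner e" "var e = {ch e, par (ch e)}"
      define u where "u = low e"
      have u: "u \<in> V" "u \<noteq> r" "e = {u, par u}"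
        unfolding u_def using low[of e] i(1) unfolding inner_def by blast+
      have "var e' \<in> T"
        using adj(2) i(1) var_E[OF e'] tree_edge_at_interior unfolding inner_def by blast
      then have "inner e'" "var e' = {ch e', par (ch e')}"
        using cases[OF e'] rho_T by auto
      note ce' = ch[OF this(1)] var_in[OF this(1)] this
      have we: "w (var e) = Suc (dep u)"
        using i var_in[OF i(1)] ch[OF i(1)] par[of "ch e"] by (simp add: w_def u_def)
      have we': "w (var e') = dep (ch e')" using ce' by (simp add: w_def)
      \<comment> \<open>Of the child edges of \<open>u\<close> only the one chosen for
        \<open>e\<close> serves as a variable.\<close>
      have "par (ch e') \<noteq> u"
      proof
        assume "par (ch e') = u"
        then have "low e' = low e" using ce'(3) u_def by simp
        then have "e' = e" using inj_on_low ce'(6) i(1) unfolding inner_def inj_on_def by blast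
        then show False using neq by simp
      qed
      moreover have "ch e' \<noteq> u" using adj(1) ce' u by auto
      moreover obtain x where "x \<in> e" "x \<in> var e'" using adj(2) by blast
      then have "x = u \<or> x = par u" "x = ch e' \<or> x = par (ch e')" unfolding u(3) ce'(7) by simp_all
      ultimately have "par u = ch e' \<or> par u = par (ch e')" by metis
      then have "dep (ch e') \<le> dep u" using dep_par[OF u(1,2)] par[OF u(1,2)] par[OF ce'(1,2)] by auto
      then show ?thesis using we we' by simp
    next
      fix i assume i: "i < n" "0 < i" "var e = rho (i - 1)" "lam i \<in> e" "e = rho i" "i < n - 1"
      have we: "w (var e) = B + n - (i - 1)" using i by (simp add: w_rho)
      show ?thesis
      proof (cases "var e' \<in> T")
        case True
        then show ?thesis using w_T[OF True] we i by linarith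
      next
        case False
        then obtain j where j: "j < n" "0 < j" "var e' = rho (j - 1)"
          using cases[OF e'] var_in(1) by metis
        define k where "k = j - 1"
        have k: "Suc k = j" "Suc k < n" "var e' = rho k" using j by (simp_all add: k_def)
        obtain x where "x \<in> rho i" "x \<in> rho k" using adj(2) unfolding i(5) k(3) by blast
        then have "lam i = lam k \<or> lam i = lam (Suc k) \<or> lam (Suc i) = lam k \<or> lam (Suc i) = lam (Suc k)"
          unfolding rho_def by auto
        then have "i = k \<or> i = Suc k \<or> Suc i = k" using i(6) k(2) by (auto simp: lam_eq)
        moreover have "i \<noteq> k" using adj(1) unfolding k(3) i(5) by auto
        moreover have "i \<noteq> Suc k" using neq unfolding k(3) i(3) by auto
        ultimately have "Suc i = k" by blast
        then have "w (var e') = B + n - Suc i" using k w_rho[of k] by simp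
        then show ?thesis using we i by linarith
      qed
    next
      fix i assume i: "i < n" "0 < i" "var e = rho (i - 1)" "lam i \<in> e" "e = {lam i, stem (lam i)}"
      have we: "w (var e) = B + n - (i - 1)" using i by (simp add: w_rho)
      show ?thesis
      proof (cases "var e' \<in> T")
        case True
        then show ?thesis using w_T[OF True] we i by linarith
      next
        case False
        then obtain j where j: "j < n" "0 < j" "var e' = rho (j - 1)"
          using cases[OF e'] var_in(1) by metis
        have "stem (lam i) \<notin> rho (j - 1)" using stem_notin_L[OF lam_L, of i] lam_L by (auto simp: rho_def)
        define k where "k = j - 1"
        have k: "Suc k = j" "Suc k < n" "var e' = rho k" using j by (simp_all add: k_def)
        obtain x where "x \<in> {lam i, stem (lam i)}" "x \<in> rho k" using adj(2) unfolding i(5) k(3) by blast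
        then have "lam i \<in> rho k" using \<open>stem (lam i) \<notin> rho (j - 1)\<close> by (auto simp: k_def)
        then have "lam i = lam k \<or> lam i = lam (Suc k)" unfolding rho_def by simp
        then have "i = k \<or> i = Suc k" using i(1) k(2) by (simp add: lam_eq)
        moreover have "i \<noteq> Suc k" using neq unfolding k(3) i(3) by auto
        ultimately have "w (var e') = B + n - i" using k w_rho[of k] by simp
        then show ?thesis using we i by linarith
      qed
    qed
  next
    show "card {e \<in> R. var e = f} \<le> 2" for f
    proof (cases "\<exists>j. f = rho j")
      case True
      then obtain j where j: "f = rho j" "j < n"
      proof -
        obtain i where "f = rho i" using True by blast
        then have "f = rho (i mod n)" "i mod n < n" using n3 by (auto simp: rho_eq)
        then show thesis using that by blast
      qed
      have "{e \<in> R. var e = f} \<subseteq> {rho (Suc j), {lam (Suc j), stem (lam (Suc j))}}"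
      proof
        fix e assume "e \<in> {e \<in> R. var e = f}"
        then have e: "e \<in> R" "var e = rho j" using j by auto
        then obtain i where i: "i < n" "0 < i" "rho j = rho (i - 1)" "e = rho i \<or> e = {lam i, stem (lam i)}"
          using cases[OF e(1)] var_in(1) rho_T by metis
        then have "i = Suc j" using j by (auto simp: rho_eq)
        then show "e \<in> {rho (Suc j), {lam (Suc j), stem (lam (Suc j))}}" using i by simp
      qed
      then have "card {e \<in> R. var e = f} \<le> card {rho (Suc j), {lam (Suc j), stem (lam (Suc j))}}"
        by (rule card_mono[rotated]) simp
      also have "\<dots> \<le> 2" by (simp add: card_insert_le_m1)
      finally show ?thesis .
    next
      case False
      have "card {e \<in> R. var e = f} \<le> Suc 0"
      proof (subst card_le_Suc0_iff_eq)
        show "finite {e \<in> R. var e = f}" using finite_subset[OF R finE] by simp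
        have "low e = low e'" if "e \<in> R" "e' \<in> R" "var e = f" "var e' = f" for e e'
        proof -
          have "inner e" "f = {ch e, par (ch e)}" "inner e'" "f = {ch e', par (ch e')}"
            using cases[OF that(1)] cases[OF that(2)] that False by metis+
          then show ?thesis using ch(3) var_in(2) by metis
        qed
        moreover have "inner e" if "e \<in> R" "var e = f" for e using cases[OF that(1)] that False by metis
        ultimately show "\<forall>e\<in>{e \<in> R. var e = f}. \<forall>e'\<in>{e \<in> R. var e = f}. e = e'"
          using inj_on_low unfolding inner_def inj_on_def by blast
      qed
      then show ?thesis by simp
    qed
  qed simp
  moreover have "(\<exists>i<n. 0 < i \<and> var e = rho (i - 1) \<and> (rho i \<in> R \<or> {lam i, stem (lam i)} \<in> R)) \<or>
      (\<exists>e\<in>R. \<exists>u c. u \<in> V \<and> u \<noteq> r \<and> e = {u, par u} \<and> c \<in> V \<and> c \<noteq> r \<and> par c = u \<and> var e' = {c, par c})"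
    if "e \<in> R" "e' = e" for e e'
    using cases[OF that(1)]
  proof (elim disjE exE conjE)
    assume i: "inner e" "var e = {ch e, par (ch e)}"
    have "low e \<in> V" "low e \<noteq> r" "e = {low e, par (low e)}" using low[of e] i(1) unfolding inner_def by blast+
    then show ?thesis using i ch[OF i(1)] that by blast
  qed (use that in auto)
  ultimately show ?thesis using var_E by (intro exI[of _ "var ` R"]) blast
qed

end

section \<open>Neighbouring hanging paths of lengths 1 and 2\<close>

lemma local_product:
  fixes X Y C :: "'c :: comm_ring_1"
  assumes "X ^ 3 = 0" "Y ^ 3 = 0" "C ^ 3 = 0"
  shows "(Y + C) * (Y + X) * (C - X) * (C - X) * (C - X) * (Y + X) = of_int (- 3) * (X ^ 2 * Y ^ 2 * C ^ 2)"
proof -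
  have z: "X * (X * X) = 0" "X * (X * (X * u)) = 0" "Y * (Y * Y) = 0" "Y * (Y * (Y * u)) = 0"
    "C * (C * C) = 0" "C * (C * (C * u)) = 0" for u
    using assms by (simp_all add: power3_eq_cube mult.assoc[symmetric])
  show ?thesis by (simp add: algebra_simps power2_eq_square z)
qed

context halin
begin

text \<open>
  The edges \<open>{v, p}\<close> and \<open>{v, lam 1}\<close> receive opposite values, so that
  no other row at \<open>v\<close> is affected.
\<close>

lemma good_0_short_pair:
  assumes D: "orientation E D" and v: "v \<notin> L" "stem (lam 1) = v"
    and p: "{v, p} \<in> T" "neighbours T p = {v, lam 0}"
  shows "good 0 E E (edge_form D)"
proof -
  define y where "y = {lam 0, p}"
  define vp where "vp = {v, p}"
  define va where "va = {lam 1, v}"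
  define c where "c = rho 0"
  have pV: "p \<in> V" "v \<in> V" "p \<noteq> v" using edgeT[OF p(1)] by auto
  have "v \<noteq> lam 0" using v(1) lam_L by metis
  then have "\<not> leaf T p" unfolding leaf_def p(2) by simp
  then have pL: "p \<notin> L" using L_leaf by simp
  have p0: "{lam 0, p} \<in> T" using p(2) by (auto simp: neighbours_def insert_commute)
  then have stem0: "stem (lam 0) = p" using stem[OF lam_L] by metis
  have ne: "p \<noteq> lam i" "v \<noteq> lam i" "lam i \<noteq> p" "lam i \<noteq> v" for i using pL v(1) lam_L by metis+
  have lam01: "lam 0 \<noteq> lam 1" "lam 0 \<noteq> lam (n - 1)" "lam 1 \<noteq> lam (n - 1)" "lam 1 \<noteq> lam 2" "lam 0 \<noteq> lam 2"
    using n3 by (auto simp: lam_eq)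
  have vaT: "va \<in> T" using stem_T[OF lam_L, of 1] v(2) by (simp add: va_def)
  have inE: "y \<in> E" "vp \<in> E" "va \<in> E" "c \<in> E"
    using p(1) p0 vaT rho_E by (simp_all add: E_def y_def vp_def c_def)
  have distinct: "y \<noteq> vp" "y \<noteq> c" "vp \<noteq> c" "va \<noteq> vp" "va \<noteq> y" "va \<noteq> c"
    using ne lam01 pV(3) by (auto simp: y_def vp_def va_def c_def rho_def doubleton_eq_iff)
  \<comment> \<open>The coefficients after the variable \<open>va\<close> has been replaced by
    \<open>- vp\<close>.\<close>
  define M where "M r g = edge_form D r g - (if g = vp then edge_form D r va else 0)" for r g
  \<comment> \<open>All edges at \<open>lam 0\<close>, \<open>lam 1\<close> and \<open>p\<close>,
    the only vertices where the chosen values have a nonzero sum: six rows for three squared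
    variables.\<close>
  define R1 where "R1 = {rho (n - 1), rho 0, rho 1, y, va, vp}"
  define F1 where "F1 = {y, vp, c}"
  have R1E: "R1 \<subseteq> E" using inE rho_E by (auto simp: R1_def)
  have at0: "f \<in> R1" if "f \<in> E" "lam 0 \<in> f" for f
  proof -
    have "f \<in> {rho 0, rho (0 + n - 1), {lam 0, stem (lam 0)}}" using edges_at_leaf[of 0] that by blast
    then show ?thesis unfolding R1_def y_def stem0 by auto
  qed
  have at1: "f \<in> R1" if "f \<in> E" "lam 1 \<in> f" for f
  proof -
    have "rho (1 + n - 1) = rho 0" by (simp add: rho_eq)
    moreover have "f \<in> {rho 1, rho (1 + n - 1), {lam 1, stem (lam 1)}}" using edges_at_leaf[of 1] that by blast
    ultimately show ?thesis unfolding R1_def va_def v(2) by auto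
  qed
  have atp: "f \<in> R1" if f: "f \<in> E" "p \<in> f" for f
  proof -
    have fT: "f \<in> T" using tree_edge_at_interior[OF f pL] .
    obtain a b where "f = {a, b}" using simple_graph_edgeE[OF sgT fT] .
    moreover then have "p = a \<or> p = b" using f(2) by simp
    ultimately obtain x where x: "f = {p, x}" by (metis insert_commute)
    then have "x \<in> neighbours T p" using fT by (simp add: neighbours_def)
    then have "x = v \<or> x = lam 0" using p(2) by simp
    then have "f = vp \<or> f = y" unfolding x vp_def y_def by (metis insert_commute)
    then show ?thesis by (auto simp: R1_def)
  qed
  have 1: "good 0 R1 F1 M"
  proof -
    define X Y C where "X = tvar vp" and "Y = tvar y" and "C = tvar c"
    \<comment> \<open>The vertex sums for the values \<open>Y\<close>, \<open>X\<close>,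
      \<open>- X\<close>, \<open>C\<close> on the edges \<open>y\<close>, \<open>vp\<close>,
      \<open>va\<close>, \<open>c\<close>, which form a 4-cycle; at \<open>v\<close> they
      cancel.\<close>
    define S where "S x = of_bool (x = lam 0 \<or> x = p) * Y + (of_bool (x = p) - of_bool (x = lam 1)) * X +
        of_bool (x = lam 0 \<or> x = lam 1) * C" for x
    have form: "(\<Sum>f\<in>F1. of_int (M {a, b} f) * tvar f) \<in> {S a - S b, - (S a - S b)}" if ab: "{a, b} \<in> E" for a b
    proof -
      obtain s where s: "s \<in> {1, -1}"
        "\<And>f. edge_form D {a, b} f = s * (of_bool (a \<in> f) - of_bool (b \<in> f))"
        using edge_form_pair[OF D ab] by blast
      have "(\<Sum>f\<in>F1. of_int (M {a, b} f) * tvar f) =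
          of_int (M {a, b} y) * Y + of_int (M {a, b} vp) * X + of_int (M {a, b} c) * C"
        using distinct by (simp add: F1_def X_def Y_def C_def add.assoc)
      also have "of_int (M {a, b} y) = of_int s * (of_bool (a = lam 0 \<or> a = p) - of_bool (b = lam 0 \<or> b = p) :: 'a set tpoly)"
        using distinct by (simp add: M_def s(2) y_def)
      also have "of_int (M {a, b} c) = of_int s * (of_bool (a = lam 0 \<or> a = lam 1) - of_bool (b = lam 0 \<or> b = lam 1) :: 'a set tpoly)"
        using distinct by (simp add: M_def s(2) c_def rho_def)
      also have "of_int (M {a, b} vp) = of_int s * ((of_bool (a = p) - of_bool (a = lam 1)) - (of_bool (b = p) - of_bool (b = lam 1)) :: 'a set tpoly)"
      proof -
        have "of_bool (x \<in> vp) - of_bool (x \<in> va) = (of_bool (x = p) - of_bool (x = lam 1) :: int)" for x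
          using pV(3) ne by (auto simp: vp_def va_def)
        moreover have "M {a, b} vp = s * ((of_bool (a \<in> vp) - of_bool (a \<in> va)) - (of_bool (b \<in> vp) - of_bool (b \<in> va)))"
          by (simp add: M_def s(2) right_diff_distrib)
        ultimately show ?thesis by (simp only: of_int_mult of_int_diff of_int_of_bool)
      qed
      also have "of_int s * (of_bool (a = lam 0 \<or> a = p) - of_bool (b = lam 0 \<or> b = p)) * Y +
          of_int s * ((of_bool (a = p) - of_bool (a = lam 1)) - (of_bool (b = p) - of_bool (b = lam 1))) * X +
          of_int s * (of_bool (a = lam 0 \<or> a = lam 1) - of_bool (b = lam 0 \<or> b = lam 1)) * C = of_int s * (S a - S b)"
        by (simp add: S_def algebra_simps)
      finally show ?thesis using s(1) by auto
    qed
    have S: "S (lam 0) = Y + C" "S (lam 1) = C - X" "S p = Y + X" "S v = 0" "S (lam (n - 1)) = 0" "S (lam 2) = 0"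
      using lam01 ne pV(3) not_sym[OF lam01(1)] not_sym[OF lam01(2)] not_sym[OF lam01(3)] not_sym[OF lam01(4)]
        not_sym[OF lam01(5)] by (simp_all add: S_def)
    define row where "row = (!) [rho (n - 1), rho 0, rho 1, y, va, vp]"
    define l where "l = (!) [Y + C, Y + X, C - X, C - X, C - X, Y + X]"
    have I: "{..<6} = {0, 1, 2, 3, 4, 5 :: nat}" by auto
    have rn: "rho (n - 1) = {lam (n - 1), lam 0}" using n3 by (simp add: rho_def)
    have r1: "rho 0 = {lam 0, lam 1}" "rho 1 = {lam 1, lam 2}" by (simp_all add: rho_def numeral_2_eq_2)
    show ?thesis
    proof (rule goodI_ring_indexed[where I = "{..<6}" and row = row and a = tvar and l = l])
      have "distinct [rho (n - 1), rho 0, rho 1, y, va, vp]"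
        unfolding rn r1 y_def va_def vp_def
        using ne lam01 pV(3) by (auto simp: doubleton_eq_iff)
      then show "inj_on row {..<6}" unfolding row_def inj_on_def by (auto simp: nth_eq_iff_index_eq)
      show "R1 = row ` {..<6}" unfolding I R1_def row_def by simp
      show "of_int 0 dvd tvar f ^ 3" for f :: "'a set" by (simp add: tvar_cube)
      show "(\<Sum>f\<in>F1. of_int (M (row i) f) * tvar f) \<in> {l i, - l i}" if "i \<in> {..<6}" for i
      proof -
        have g: "(\<Sum>f\<in>F1. of_int (M {a, b} f) * tvar f) \<in> {L, - L}"
          if "{a, b} \<in> R1" "S a - S b = L \<or> S a - S b = - L" for a b L
        proof -
          have "{a, b} \<in> E" using that(1) R1E by blast
          note m = form[OF this]
          from that(2) show ?thesis
          proof
            assume e: "S a - S b = L"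
            show ?thesis using m unfolding e .
          next
            assume e: "S a - S b = - L"
            show ?thesis using m unfolding e by auto
          qed
        qed
        have 0: "(\<Sum>f\<in>F1. of_int (M (rho (n - 1)) f) * tvar f) \<in> {Y + C, - (Y + C)}"
          unfolding rn by (rule g) (simp_all only: S R1_def rn, simp_all)
        have 1: "(\<Sum>f\<in>F1. of_int (M (rho 0) f) * tvar f) \<in> {Y + X, - (Y + X)}"
          unfolding r1 by (rule g) (simp_all only: S R1_def r1, simp_all)
        have 2: "(\<Sum>f\<in>F1. of_int (M (rho 1) f) * tvar f) \<in> {C - X, - (C - X)}"
          unfolding r1 by (rule g) (simp_all only: S R1_def r1, simp_all)
        have 3: "(\<Sum>f\<in>F1. of_int (M y f) * tvar f) \<in> {C - X, - (C - X)}"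
          unfolding y_def by (rule g) (simp_all only: S R1_def y_def, simp_all)
        have 4: "(\<Sum>f\<in>F1. of_int (M va f) * tvar f) \<in> {C - X, - (C - X)}"
          unfolding va_def by (rule g) (simp_all only: S R1_def va_def, simp_all)
        have 5: "(\<Sum>f\<in>F1. of_int (M vp f) * tvar f) \<in> {Y + X, - (Y + X)}"
          unfolding vp_def by (rule g) (simp_all only: S R1_def vp_def, simp_all)
        have "i \<in> {0, 1, 2, 3, 4, 5}" using that unfolding I .
        then show ?thesis
          using 0 1 2 3 4 5 unfolding row_def l_def by (elim insertE emptyE) (simp_all only: nth_Cons' list.simps if_True if_False, simp_all)
      qed
      have "(\<Prod>i<6. l i) = (Y + C) * (Y + X) * (C - X) * (C - X) * (C - X) * (Y + X)"
        unfolding I l_def by (simp add: mult.assoc)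
      also have "\<dots> = of_int (- 3) * (X ^ 2 * Y ^ 2 * C ^ 2)"
        by (rule local_product) (simp_all add: X_def Y_def C_def tvar_cube)
      also have "X ^ 2 * Y ^ 2 * C ^ 2 = (\<Prod>f\<in>F1. tvar f ^ 2)"
        using distinct by (simp add: F1_def X_def Y_def C_def mult_ac)
      finally have eq: "(\<Prod>i<6. l i) = of_int (- 3) * (\<Prod>f\<in>F1. tvar f ^ 2)" .
      show "\<not> of_int 0 dvd (\<Prod>i<6. l i)"
      proof
        assume "of_int 0 dvd (\<Prod>i<6. l i)"
        then have "(0 :: int) dvd - 3" unfolding eq by (rule dvd_squares_tvar[rotated]) (simp add: F1_def)
        then show False by simp
      qed
    qed (simp_all add: F1_def)
  qed
  define R2 where "R2 = E - R1"
  \<comment> \<open>Rooted at \<open>v\<close>, the edges \<open>vp\<close> and \<open>va\<close>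
    hang from the root, and the peeling never takes such edges as variables.\<close>
  obtain par dep where rooted: "rooted_tree V T v par dep"
    using tree_graph_rooted[OF tree pV(2)] by blast
  then interpret rooted_tree V T v par dep .
  have par_p: "par p = v" and par_1: "par (lam 1) = v" and par_0: "par (lam 0) = p"
  proof -
    show "par p = v" using edge_par[OF p(1)] by auto
    show "par (lam 1) = v" using edge_par[of "lam 1" v] vaT by (auto simp: va_def)
    show "par (lam 0) = p" using edge_par[OF p0] \<open>par p = v\<close> ne by auto
  qed
  have low': "low vp = p" "low va = lam 1" "low y = lam 0"
    using low_eq[of p] low_eq[of "lam 1"] low_eq[of "lam 0"] par_p par_1 par_0 pV ne
    by (auto simp: vp_def va_def y_def insert_commute)
  have ex: "\<exists>F \<subseteq> E. good 0 R2 F (edge_form D) \<and>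
    (\<forall>f\<in>F. (\<exists>i<n. 0 < i \<and> f = rho (i - 1) \<and> (rho i \<in> R2 \<or> {lam i, stem (lam i)} \<in> R2)) \<or>
      (\<exists>e\<in>R2. \<exists>u c. u \<in> V \<and> u \<noteq> v \<and> e = {u, par u} \<and> c \<in> V \<and> c \<noteq> v \<and> par c = u \<and> f = {c, par c}))"
  proof (rule good_0_peel[OF D rooted])
    show "R2 \<subseteq> E" by (auto simp: R2_def)
    fix i assume i: "i < n"
    show "0 < i \<and> i < n - 1" if "rho i \<in> R2"
    proof -
      have "rho i \<noteq> rho 0" "rho i \<noteq> rho (n - 1)" using that unfolding R2_def R1_def by auto
      then have "i \<noteq> 0" "i \<noteq> n - 1" by metis+
      then show ?thesis using i by linarith
    qed
    show "0 < i" if "{lam i, stem (lam i)} \<in> R2"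
    proof -
      have "{lam i, stem (lam i)} \<noteq> y" using that unfolding R2_def R1_def by auto
      then show ?thesis using stem0 unfolding y_def by (metis gr0I)
    qed
  qed
  then obtain F2 where F2: "F2 \<subseteq> E" "good 0 R2 F2 (edge_form D)"
    "\<forall>f\<in>F2. (\<exists>i<n. 0 < i \<and> f = rho (i - 1) \<and> (rho i \<in> R2 \<or> {lam i, stem (lam i)} \<in> R2)) \<or>
      (\<exists>e\<in>R2. \<exists>u c. u \<in> V \<and> u \<noteq> v \<and> e = {u, par u} \<and> c \<in> V \<and> c \<noteq> v \<and> par c = u \<and> f = {c, par c})"
    by (elim exE conjE)
  have F2': "y \<notin> F2 \<and> vp \<notin> F2 \<and> c \<notin> F2 \<and> va \<notin> F2"
  proof -
    have "f \<noteq> y \<and> f \<noteq> vp \<and> f \<noteq> c \<and> f \<noteq> va" if "f \<in> F2" for f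
      using F2(3)[rule_format, OF that]
    proof
      assume "\<exists>i<n. 0 < i \<and> f = rho (i - 1) \<and> (rho i \<in> R2 \<or> {lam i, stem (lam i)} \<in> R2)"
      then obtain i where i: "i < n" "0 < i" "f = rho (i - 1)" "rho i \<in> R2 \<or> {lam i, stem (lam i)} \<in> R2"
        by (elim exE conjE)
      have "rho 1 \<notin> R2" "{lam 1, stem (lam 1)} \<notin> R2" unfolding R2_def R1_def va_def v(2) by auto
      then have "i \<noteq> 1" using i(4) by metis
      then have "f \<noteq> c" using i by (auto simp: c_def rho_eq)
      moreover have "f \<notin> T" using i(3) rho_T by simp
      ultimately show ?thesis using p(1) p0 vaT by (auto simp: vp_def y_def)
    next
      assume "\<exists>e\<in>R2. \<exists>u c. u \<in> V \<and> u \<noteq> v \<and> e = {u, par u} \<and> c \<in> V \<and> c \<noteq> v \<and> par c = u \<and> f = {c, par c}"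
      then obtain e u d where d: "e \<in> R2" "u \<in> V" "u \<noteq> v" "e = {u, par u}" "d \<in> V" "d \<noteq> v" "par d = u" "f = {d, par d}"
        by (elim bexE exE conjE)
      have fT: "f \<in> T" and lowf: "low f = d" using par[OF d(5,6)] low_eq[OF d(5,6)] d(8) by simp_all
      have "vp = {p, par p}" unfolding vp_def par_p by (rule insert_commute)
      then have "u \<noteq> p" using d(1,4) unfolding R2_def R1_def by auto
      then have "d \<noteq> lam 0" using par_0 d(7) by auto
      moreover have "d \<noteq> p" "d \<noteq> lam 1" using par_p par_1 d(3,7) by auto
      ultimately show ?thesis using lowf low' fT rho_T by (auto simp: c_def)
    qed
    then show ?thesis by blast
  qed
  have finF2: "finite F2" using F2(1) finE finite_subset by blast
  have 2: "good 0 R2 F2 M"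
  proof (rule good_cong[OF F2(2)])
    fix r f assume "r \<in> R2" "f \<in> F2"
    then have "f \<noteq> vp" using F2' by blast
    then show "[edge_form D r f = M r f] (mod 0)" by (simp add: M_def)
  qed
  have "good 0 (R1 \<union> R2) (F1 \<union> F2) M"
  proof (rule good_triangular[OF _ _ _ _ finF2 _ _ _ 1 2])
    show "finite R2" using finE by (simp add: R2_def)
    show "M r f = 0" if "r \<in> R2" "f \<in> F1" for r f
    proof -
      have rE: "r \<in> E" and rR: "r \<notin> R1" using that by (auto simp: R2_def)
      have notin: "lam 0 \<notin> r" "lam 1 \<notin> r" "p \<notin> r" using at0 at1 atp rE rR by blast+
      have ends: "fst (D r) \<in> r" "snd (D r) \<in> r" using orientationD[OF D rE] by blast+
      then have "fst (D r) \<notin> {lam 0, lam 1, p}" "snd (D r) \<notin> {lam 0, lam 1, p}" using notin by auto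
      then show ?thesis using that(2) distinct
        by (auto simp: M_def edge_form_def F1_def y_def vp_def va_def c_def rho_def)
    qed
    show "F1 \<inter> F2 = {}" using F2' by (auto simp: F1_def)
  qed (auto simp: R1_def R2_def F1_def)
  moreover have "R1 \<union> R2 = E" using R1E by (auto simp: R2_def)
  moreover have "F1 \<union> F2 \<subseteq> E - {va}"
    using F2(1) F2' inE distinct by (auto simp: F1_def)
  ultimately have good: "good 0 E (E - {va}) M" using good_superset finE by metis
  show ?thesis
  proof (rule good_0_identification[OF good finE finE, where h = "\<lambda>f. if f = va then vp else f"
        and b = "\<lambda>f. if f = va then -1 else 1"])
    show "finite (E - {va})" using finE by simp
    show "(\<lambda>f. if f = va then vp else f) ` E \<subseteq> E - {va}" using inE distinct by auto
    fix r g assume g: "r \<in> E" "g \<in> E - {va}"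
    have "{f \<in> E. (if f = va then vp else f) = g} = (if g = vp then {va, vp} else {g})"
      using g inE distinct by auto
    then show "M r g = (\<Sum>f | f \<in> E \<and> (if f = va then vp else f) = g. edge_form D r f * (if f = va then -1 else 1))"
      using g distinct by (simp add: M_def)
  qed
qed

end

section \<open>Hanging paths of lengths 2 and 3 only\<close>

lemma chain_pos: "chain T v a l k \<Longrightarrow> 0 < k"
  by (induction rule: chain.induct) simp_all

lemma chain_one:
  assumes "chain T v a l (Suc 0)"
  shows "a = l \<and> leaf T l"
  using assms
proof cases
  case base
  then show ?thesis by simp
next
  case (step b)
  then show ?thesis using chain_pos by fastforce
qed

lemma chain_Suc:
  assumes "chain T v a l (Suc (Suc k))"
  obtains b where "neighbours T a = {v, b}" "b \<noteq> v" "chain T a b l (Suc k)"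
  using assms
proof cases
  case (step b)
  then show ?thesis using that by simp
qed simp

text \<open>A cyclic shift of an enumeration moves every point as soon as there are two points;
  otherwise the identity serves.\<close>

lemma fixpoint_free_bij:
  assumes "finite A"
  obtains \<pi> where "bij_betw \<pi> A A" "2 \<le> card A \<Longrightarrow> \<forall>x\<in>A. \<pi> x \<noteq> x"
proof (cases "2 \<le> card A")
  case True
  define m where "m = card A"
  obtain h where h: "bij_betw h {0..<m} A" using ex_bij_betw_nat_finite[OF assms] m_def by blast
  define s where "s i = Suc i mod m" for i
  have m: "0 < m" using True by (simp add: m_def)
  have "inj_on s {0..<m}" 
  proof (rule inj_onI)
    fix i j assume ij: "i \<in> {0..<m}" "j \<in> {0..<m}" "s i = s j"
    then have "Suc i mod m = Suc j mod m" by (simp only: s_def)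
    then have "i mod m = j mod m" by (rule Suc_mod_cancel)
    then show "i = j" using ij by simp
  qed
  moreover have "s ` {0..<m} \<subseteq> {0..<m}" using m by (auto simp: s_def)
  ultimately have s: "bij_betw s {0..<m} {0..<m}" by (simp add: bij_betw_def endo_inj_surj)
  let ?g = "inv_into {0..<m} h"
  have g: "bij_betw ?g A {0..<m}" by (rule bij_betw_inv_into[OF h])
  have bij: "bij_betw (h \<circ> s \<circ> ?g) A A"
    using bij_betw_trans[OF bij_betw_trans[OF g s] h] by (simp add: comp_assoc)
  have "(h \<circ> s \<circ> ?g) x \<noteq> x" if x: "x \<in> A" for x
  proof
    assume eq: "(h \<circ> s \<circ> ?g) x = x"
    have gx: "?g x < m" "h (?g x) = x"
      using bij_betwE[OF g] x bij_betw_inv_into_right[OF h x] by auto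
    have "h (s (?g x)) = h (?g x)" using eq gx(2) by simp
    moreover have "s (?g x) < m" using m by (simp add: s_def)
    ultimately have "s (?g x) = ?g x"
      using inj_onD[OF bij_betw_imp_inj_on[OF h]] gx(1) by simp
    then show False using gx(1) True unfolding s_def m_def[symmetric]
      by (cases "Suc (?g x) = m") auto
  qed
  then show ?thesis using that bij by blast
next
  case False
  then show ?thesis using that[of id] by auto
qed

context halin
begin

text \<open>A path of length 3 creates slack: its middle edge can serve both outer edges, so its top
  edge is free to serve other rows around \<open>b\<close>. This makes room for the edge above
  \<open>b\<close>, and the edge at the leaf \<open>lam 0\<close> is free to serve both rim edges
  there, as the peeling requires.\<close>

lemma good_0_long_chains:
  assumes D: "orientation E D" and rooted: "rooted_tree V T r par dep" and b: "b \<in> V" "b \<noteq> r"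
    and kids: "\<And>c. c \<in> V \<Longrightarrow> c \<noteq> r \<Longrightarrow> par c = b \<Longrightarrow> \<exists>l. chain T b c l 2 \<or> chain T b c l 3"
    and c1: "c1 \<in> V" "c1 \<noteq> r" "par c1 = b" "chain T b c1 (lam 0) 3"
  shows "good 0 E E (edge_form D)"
proof -
  interpret rooted_tree V T r par dep by (rule rooted)
  define ed where "ed x = {x, par x}" for x
  define Ch where "Ch = {c \<in> V. c \<noteq> r \<and> par c = b}"
  have edT: "ed x \<in> T" "ed x \<in> E" if "x \<in> V" "x \<noteq> r" for x using par[OF that] by (auto simp: ed_def E_def)
  have ed_inj: "x = y" if "ed x = ed y" "x \<in> V" "x \<noteq> r" "y \<in> V" "y \<noteq> r" for x y
    using low_eq[OF that(2,3)] low_eq[OF that(4,5)] that(1) unfolding ed_def by metis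
  have ex_d: "\<exists>d. neighbours T c = {b, d} \<and> d \<noteq> b \<and> (d \<in> L \<or> (\<exists>l\<in>L. neighbours T d = {c, l} \<and> l \<noteq> c))"
    if c: "c \<in> Ch" for c
  proof -
    have leafL: "l \<in> L" if "leaf T l" "{x, l} \<in> T" for l x using that L_leaf edgeT by blast
    have "(\<exists>l. chain T b c l 2) \<or> (\<exists>l. chain T b c l 3)" using kids c unfolding Ch_def by blast
    then show ?thesis
    proof
      assume "\<exists>l. chain T b c l 2"
      then obtain l where "chain T b c l (Suc (Suc 0))" by (auto simp: numeral_2_eq_2)
      then obtain d where d: "neighbours T c = {b, d}" "d \<noteq> b" "chain T c d l (Suc 0)" by (rule chain_Suc)
      then have "d \<in> L" using chain_one[OF d(3)] leafL chain_edge[OF d(3)] by blast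
      then show ?thesis using d by blast
    next
      assume "\<exists>l. chain T b c l 3"
      then obtain l where "chain T b c l (Suc (Suc (Suc 0)))" by (auto simp: numeral_3_eq_3)
      then obtain d where d: "neighbours T c = {b, d}" "d \<noteq> b" "chain T c d l (Suc (Suc 0))" by (rule chain_Suc)
      obtain l' where l': "neighbours T d = {c, l'}" "l' \<noteq> c" "chain T d l' l (Suc 0)"
        using d(3) by (rule chain_Suc)
      then have "l' \<in> L" using chain_one[OF l'(3)] leafL chain_edge[OF l'(3)] by blast
      then show ?thesis using d l' by blast
    qed
  qed
  then obtain d where d: "\<And>c. c \<in> Ch \<Longrightarrow> neighbours T c = {b, d c} \<and> d c \<noteq> b \<and>
      (d c \<in> L \<or> (\<exists>l\<in>L. neighbours T (d c) = {c, l} \<and> l \<noteq> c))"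
    by metis
  define C3 where "C3 = {c \<in> Ch. d c \<notin> L}"
  have "\<exists>l. l \<in> L \<and> neighbours T (d c) = {c, l} \<and> l \<noteq> c" if "c \<in> C3" for c
    using d[of c] that unfolding C3_def by blast
  then obtain ec where ec: "\<And>c. c \<in> C3 \<Longrightarrow> ec c \<in> L \<and> neighbours T (d c) = {c, ec c} \<and> ec c \<noteq> c"
    by metis
  have nbI: "y \<in> neighbours T x \<longleftrightarrow> {x, y} \<in> T" for x y by (simp add: neighbours_def)
  have Ch: "c \<in> V" "c \<noteq> r" "par c = b" "c \<notin> L" "c \<noteq> b" if c: "c \<in> Ch" for c
  proof -
    show "c \<in> V" "c \<noteq> r" "par c = b" using c by (auto simp: Ch_def)
    then show "c \<noteq> b" using dep_par[of c] by auto
    have "neighbours T c = {b, d c}" "b \<noteq> d c" using d[OF c] by blast+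
    then have "\<not> leaf T c" by (simp add: leaf_def)
    then show "c \<notin> L" by (simp add: L_leaf)
  qed
  have dc: "d c \<in> V" "d c \<noteq> r" "par (d c) = c" "d c \<noteq> c" if c: "c \<in> Ch" for c
  proof -
    have nb: "neighbours T c = {b, d c}" "d c \<noteq> b" using d[OF c] by blast+
    then have "d c \<in> neighbours T c" by simp
    then have e: "{c, d c} \<in> T" by (simp only: nbI)
    show "d c \<in> V" "d c \<noteq> c" using edgeT[OF e] by auto
    show "d c \<noteq> r" "par (d c) = c" using edge_par[OF e] Ch(3)[OF c] nb(2) by auto
  qed
  have C3: "c \<in> Ch" "d c \<notin> L" if "c \<in> C3" for c using that by (auto simp: C3_def)
  have ecc: "ec c \<in> V" "ec c \<noteq> r" "par (ec c) = d c" "ec c \<in> L" if c: "c \<in> C3" for c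
  proof -
    have nb: "neighbours T (d c) = {c, ec c}" "ec c \<noteq> c" using ec[OF c] by blast+
    then have "ec c \<in> neighbours T (d c)" by simp
    then have e: "{d c, ec c} \<in> T" by (simp only: nbI)
    show "ec c \<in> V" using edgeT[OF e] by auto
    show "ec c \<noteq> r" "par (ec c) = d c" using edge_par[OF e] dc(3)[OF C3(1)[OF c]] nb(2) by auto
    show "ec c \<in> L" using ec[OF c] by simp
  qed
  have c1C: "c1 \<in> Ch" using c1 by (simp add: Ch_def)
  have c13: "c1 \<in> C3" "ec c1 = lam 0"
  proof -
    obtain d' where d': "neighbours T c1 = {b, d'}" "d' \<noteq> b" "chain T c1 d' (lam 0) (Suc (Suc 0))"
      using c1(4) unfolding numeral_3_eq_3 by (rule chain_Suc)
    obtain l where l: "neighbours T d' = {c1, l}" "l \<noteq> c1" "chain T d' l (lam 0) (Suc 0)"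
      using d'(3) by (rule chain_Suc)
    have "d c1 = d'" using d[OF c1C] d'(1,2) by (auto simp: doubleton_eq_iff)
    moreover have "\<not> leaf T d'" using l(1,2) by (simp add: leaf_def)
    ultimately show c13: "c1 \<in> C3" using c1C L_leaf by (simp add: C3_def)
    have "l = lam 0" using chain_one[OF l(3)] by simp
    then show "ec c1 = lam 0"
      using ec[OF c13] l(1,2) \<open>d c1 = d'\<close> by (auto simp: doubleton_eq_iff)
  qed
  have bL: "b \<notin> L"
  proof
    assume "b \<in> L"
    moreover have "{b, c1} \<in> T" "{b, par b} \<in> T" using edT(1)[OF c1(1,2)] c1(3) par[OF b] by (auto simp: ed_def insert_commute)
    ultimately have "c1 = par b" using stem by metis
    then show False using dep_par[OF b] dep_par[OF c1(1,2)] c1(3) by simp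
  qed
  have at: "\<exists>y. f = {x, y} \<and> y \<in> neighbours T x" if f: "f \<in> E" "x \<in> f" and x: "x \<notin> L" for f x
  proof -
    have fT: "f \<in> T" using tree_edge_at_interior[OF f x] .
    obtain a b where "f = {a, b}" using simple_graph_edgeE[OF sgT fT] .
    moreover then have "x = a \<or> x = b" using f(2) by simp
    ultimately obtain y where "f = {x, y}" by (metis insert_commute)
    then show ?thesis using fT by (auto simp: neighbours_def)
  qed
  have at_c: "f = ed c \<or> f = ed (d c)" if f: "f \<in> E" "c \<in> f" and c: "c \<in> Ch" for f c
  proof -
    obtain y where y: "f = {c, y}" "y \<in> neighbours T c" using at[OF f Ch(4)[OF c]] by blast
    then have "y = b \<or> y = d c" using d[OF c] by simp
    then show ?thesis using y(1) Ch(3)[OF c] dc(3)[OF c] unfolding ed_def by (metis insert_commute)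
  qed
  have at_d: "f = ed (d c) \<or> f = ed (ec c)" if f: "f \<in> E" "d c \<in> f" and c: "c \<in> C3" for f c
  proof -
    obtain y where y: "f = {d c, y}" "y \<in> neighbours T (d c)" using at[OF f C3(2)[OF c]] by blast
    then have "y = c \<or> y = ec c" using ec[OF c] by simp
    then show ?thesis using y(1) dc(3)[OF C3(1)[OF c]] ecc(3)[OF c] unfolding ed_def by (metis insert_commute)
  qed
  have at_b: "f = ed b \<or> f \<in> ed ` Ch" if f: "f \<in> E" "b \<in> f" for f
  proof -
    obtain y where y: "f = {b, y}" "y \<in> neighbours T b" using at[OF f bL] by blast
    then have e: "{b, y} \<in> T" by (simp add: neighbours_def)
    from edge_par[OF e] show ?thesis
    proof
      assume "b \<noteq> r \<and> par b = y"
      then show ?thesis using y(1) by (simp add: ed_def)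
    next
      assume y': "y \<noteq> r \<and> par y = b"
      then have "y \<in> Ch" using edgeT[OF e] by (simp add: Ch_def)
      moreover have "f = ed y" using y(1) y' by (auto simp: ed_def)
      ultimately show ?thesis by blast
    qed
  qed
  \<comment> \<open>The blocks are ordered so that later rows avoid earlier variables.
    \<open>RA\<close>: the outer edges of the paths of length 3, two for each middle edge.
    \<open>RB\<close>: the second edges of all paths, the top edges of the paths of length 2 and the
    edge above \<open>b\<close>, served by the top edges; they number at most
    \<open>2 * card Ch\<close> because \<open>C3\<close> is nonempty. \<open>RC\<close>: the rim
    edges at \<open>lam 0\<close>. \<open>RD\<close>: the rest.\<close>
  define RA where "RA = ed ` C3 \<union> (\<lambda>c. ed (ec c)) ` C3"
  define FA where "FA = (\<lambda>c. ed (d c)) ` C3"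
  define RB where "RB = (\<lambda>c. ed (d c)) ` Ch \<union> ed ` (Ch - C3) \<union> {ed b}"
  define FB where "FB = ed ` Ch"
  define RC where "RC = {rho 0, rho (n - 1)}"
  define FC where "FC = {ed (lam 0)}"
  define RD where "RD = E - (RA \<union> RB \<union> RC)"
  have finCh: "finite Ch" using finV by (simp add: Ch_def)
  have subE: "RA \<subseteq> E" "RB \<subseteq> E" "RC \<subseteq> E" "FA \<subseteq> E" "FB \<subseteq> E" "FC \<subseteq> E"
    using edT(2) Ch dc ecc C3 b c13 rho_E
    by (auto simp: RA_def RB_def RC_def FA_def FB_def FC_def) (metis c13(1) c13(2) ecc(1,2))+
  have fin: "finite RA" "finite RB" "finite RC" "finite RD" "finite FA" "finite FB" "finite FC"
    using finite_subset[OF _ finE] subE by (auto simp: RD_def)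
  have dC: "d c \<notin> Ch" "d c \<noteq> b" if "c \<in> Ch" for c
    using dc(3)[OF that] Ch(5)[OF that] d[OF that] by (auto simp: Ch_def)
  have d_inj: "c = c'" if "d c = d c'" "c \<in> Ch" "c' \<in> Ch" for c c' using dc(3) that by metis
  have ec_d: "ec c \<noteq> d c'" if "c \<in> C3" "c' \<in> Ch" for c c'
  proof
    assume "ec c = d c'"
    then have "d c = c'" using ecc(3)[OF that(1)] dc(3)[OF that(2)] by simp
    then show False using dC[OF C3(1)[OF that(1)]] that by auto
  qed
  have disjAB: "RA \<inter> RB = {}"
  proof -
    have "ed c \<noteq> ed (d c')" "ed c \<noteq> ed b" "ed (ec c) \<noteq> ed (d c')" "ed (ec c) \<noteq> ed b"
      if "c \<in> C3" "c' \<in> Ch" for c c'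
      using ed_inj[of c "d c'"] ed_inj[of c b] ed_inj[of "ec c" "d c'"] ed_inj[of "ec c" b]
        Ch[OF C3(1)[OF that(1)]] ecc[OF that(1)] dc[OF that(2)] dC[OF that(2)] C3(1)[OF that(1)] b bL ec_d[OF that]
      by auto
    moreover have "ed c \<noteq> ed c'" "ed (ec c) \<noteq> ed c'" if "c \<in> C3" "c' \<in> Ch - C3" for c c'
      using ed_inj[of c c'] ed_inj[of "ec c" c'] Ch[OF C3(1)[OF that(1)]] ecc[OF that(1)] Ch[of c'] that by auto
    ultimately show ?thesis using c1C unfolding RA_def RB_def by blast
  qed
  have ABT: "RA \<subseteq> T" "RB \<subseteq> T"
    using edT(1) Ch dc ecc C3 b by (auto simp: RA_def RB_def)
  have A: "good 0 RA FA (edge_form D)"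
  proof -
    define var where "var e = (if low e \<in> C3 then ed (d (low e)) else ed (par (low e)))" for e
    have var1: "var (ed c) = ed (d c)" if "c \<in> C3" for c
      using low_eq[OF Ch(1,2)[OF C3(1)[OF that]]] that by (simp add: var_def ed_def)
    have var2: "var (ed (ec c)) = ed (d c)" if "c \<in> C3" for c
      using low_eq[OF ecc(1,2)[OF that]] ecc[OF that] Ch(4)[OF C3(1), of "ec c"] by (auto simp: var_def ed_def)
    have im: "var ` RA = FA" unfolding RA_def FA_def image_Un image_image using var1 var2 by auto
    have adj: "var e = ed (d c)" if "e \<in> RA" "c \<in> C3" "edge_form D e (ed (d c)) \<noteq> 0" for e c
    proof -
      have eE: "e \<in> E" using that subE by blast
      have "ed (d c) \<noteq> e" "e \<inter> ed (d c) \<noteq> {}" using edge_form_disjoint[OF D eE that(3)] by auto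
      then have "e = ed c \<or> e = ed (ec c)"
        using at_c[OF eE _ C3(1)[OF that(2)]] at_d[OF eE _ that(2)] dc(3)[OF C3(1)[OF that(2)]]
        unfolding ed_def[of "d c"] by auto
      then show ?thesis using var1 var2 that(2) by auto
    qed
    have "good 0 RA (var ` RA) (edge_form D)"
    proof (rule good_leading[where w = "\<lambda>_. 0"])
      fix e assume e: "e \<in> RA"
      then obtain c where c: "c \<in> C3" "e = ed c \<or> e = ed (ec c)" by (auto simp: RA_def)
      note cC = C3(1)[OF c(1)]
      have v: "var e = ed (d c)" using c var1 var2 by auto
      have neq: "ed (d c) \<noteq> e"
        using c ed_inj[of "d c" c] ed_inj[of "d c" "ec c"] dc[OF cC] Ch[OF cC] ecc[OF c(1)] C3(2)[OF c(1)] by auto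
      have "\<exists>x. x \<in> e \<and> x \<in> ed (d c)" using c(2) dc(3)[OF cC] ecc(3)[OF c(1)] by (auto simp: ed_def)
      then have "edge_form D e (var e) \<noteq> 0"
        using edge_form_adjacent[OF D, of e "ed (d c)"] e subE edT(2)[OF dc(1,2)[OF cC]] neq v by auto
      then show "\<not> 0 dvd edge_form D e (var e)" by simp
      fix e' assume e': "e' \<in> RA" "edge_form D e (var e') \<noteq> 0" "var e' \<noteq> var e"
      then have "var e' \<in> FA" using im by blast
      then obtain c' where "c' \<in> C3" "var e' = ed (d c')" by (auto simp: FA_def)
      then show "(0 :: nat) < 0" using adj[OF e] e'(2,3) by metis
    next
      show "card {e \<in> RA. var e = f} \<le> 2" for f
      proof (cases "f \<in> FA")
        case True
        then obtain c where c: "c \<in> C3" "f = ed (d c)" by (auto simp: FA_def)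
        have "{e \<in> RA. var e = f} \<subseteq> {ed c, ed (ec c)}"
        proof
          fix e assume "e \<in> {e \<in> RA. var e = f}"
          then obtain c' where c': "c' \<in> C3" "e = ed c' \<or> e = ed (ec c')" "var e = f" by (auto simp: RA_def)
          then have "ed (d c') = ed (d c)" using var1 var2 c by auto
          then have "d c' = d c" using ed_inj dc C3(1) c(1) c'(1) by metis
          then have "c' = c" using d_inj C3(1) c(1) c'(1) by blast
          then show "e \<in> {ed c, ed (ec c)}" using c'(2) by auto
        qed
        then have "card {e \<in> RA. var e = f} \<le> card {ed c, ed (ec c)}" by (rule card_mono[rotated]) simp
        also have "\<dots> \<le> 2" by (simp add: card_insert_le_m1)
        finally show ?thesis .
      next
        case False
        then have "{e \<in> RA. var e = f} = {}" using im by blast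
        then show ?thesis by (metis card.empty zero_le)
      qed
    qed (use fin in auto)
    then show ?thesis unfolding im .
  qed
  have B: "good 0 RB FB (edge_form D)"
  proof -
    \<comment> \<open>All top edges contain \<open>b\<close>. A row of \<open>RB\<close> has
      constant sign on them because it has an end on none of them or has \<open>b\<close> as an
      end.\<close>
    have "\<forall>e\<in>RB. \<exists>s\<in>{1, -1}. \<forall>f\<in>FB. 0 \<le> s * edge_form D e f"
    proof
      fix e assume e: "e \<in> RB"
      have sgn: "\<exists>s\<in>{1, -1}. \<forall>f\<in>FB. 0 \<le> s * edge_form D e f"
        if "e = {x, y}" "\<And>c. c \<in> Ch \<Longrightarrow> x \<notin> ed c \<Longrightarrow> y \<notin> ed c" for x y
      proof -
        have "{x, y} \<in> E" using e subE that(1) by blast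
        from edge_form_pair[OF D this] obtain s where
          s: "s \<in> {1, -1}" "\<And>f. edge_form D {x, y} f = s * (of_bool (x \<in> f) - of_bool (y \<in> f))" by blast
        have "0 \<le> s * edge_form D e f" if "f \<in> FB" for f
          using s(1) that \<open>\<And>c. c \<in> Ch \<Longrightarrow> x \<notin> ed c \<Longrightarrow> y \<notin> ed c\<close>
          unfolding \<open>e = {x, y}\<close> s(2) FB_def by (auto simp: of_bool_def)
        then show ?thesis using s(1) by blast
      qed
      have bc: "b \<in> ed c" if "c \<in> Ch" for c using Ch(3)[OF that] by (simp add: ed_def)
      consider c where "c \<in> Ch" "e = ed (d c)" | c where "c \<in> Ch" "e = ed c" | "e = ed b"
        using e unfolding RB_def by blast
      then show "\<exists>s\<in>{1, -1}. \<forall>f\<in>FB. 0 \<le> s * edge_form D e f"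
      proof cases
        case (1 c)
        show ?thesis
        proof (rule sgn)
          show "e = {c, d c}" using 1 dc(3) by (auto simp: ed_def)
          show "d c \<notin> ed c'" if "c' \<in> Ch" for c'
            using dC[OF 1(1)] that Ch(3)[OF that] by (auto simp: ed_def)
        qed
      next
        case (2 c)
        show ?thesis
        proof (rule sgn)
          show "e = {b, c}" using 2 Ch(3) by (auto simp: ed_def)
        qed (use bc in blast)
      next
        case 3
        show ?thesis
        proof (rule sgn)
          show "e = {b, par b}" using 3 by (simp add: ed_def)
        qed (use bc in blast)
      qed
    qed
    then have "\<forall>e\<in>RB. \<exists>s. s \<in> {1, -1} \<and> (\<forall>f\<in>FB. 0 \<le> s * edge_form D e f)" by blast
    from bchoice[OF this] obtain sg where
      sg: "\<forall>e\<in>RB. sg e \<in> {1, -1} \<and> (\<forall>f\<in>FB. 0 \<le> sg e * edge_form D e f)" by blast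
    \<comment> \<open>The row of \<open>ed c\<close> vanishes at \<open>ed c\<close> itself, so the
      rows of the paths of length 2 are moved to other top edges by a permutation without fixed
      points. The row of \<open>ed c1\<close> lies in \<open>RA\<close>; its place in the
      permutation is given to \<open>ed b\<close>.\<close>
    define P where "P = insert c1 (Ch - C3)"
    have finP: "finite P" using finCh by (simp add: P_def)
    obtain \<pi> where \<pi>: "bij_betw \<pi> P P" "2 \<le> card P \<Longrightarrow> \<forall>x\<in>P. \<pi> x \<noteq> x"
      using fixpoint_free_bij[OF finP] by blast
    have P_Ch: "P \<subseteq> Ch" using c1C by (auto simp: P_def)
    have \<pi>P: "\<pi> x \<in> P" if "x \<in> P" for x using \<pi>(1) that by (auto simp: bij_betw_def)
    have \<pi>_neq: "\<pi> c \<noteq> c" if "c \<in> Ch - C3" for c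
    proof -
      have "{c, c1} \<subseteq> P" "c \<noteq> c1" using that c13(1) by (auto simp: P_def)
      then have "2 \<le> card P" using card_mono[OF finP, of "{c, c1}"] by simp
      then show ?thesis using \<pi>(2) that by (simp add: P_def)
    qed
    define var where "var e = (let x = low e in if x = b then ed (\<pi> c1) else if x \<in> Ch then ed (\<pi> x) else ed (par x))" for e
    have var_d: "var (ed (d c)) = ed c" if "c \<in> Ch" for c
      using low_eq[OF dc(1,2)[OF that]] dC[OF that] dc(3)[OF that] by (simp add: var_def ed_def)
    have var_c: "var (ed c) = ed (\<pi> c)" if "c \<in> Ch" for c
      using low_eq[OF Ch(1,2)[OF that]] Ch(5)[OF that] that by (simp add: var_def ed_def)
    have var_b: "var (ed b) = ed (\<pi> c1)"
      using low_eq[OF b] by (simp add: var_def ed_def)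
    have c1P: "c1 \<in> P" by (simp add: P_def)
    have \<pi>Ch: "\<pi> c1 \<in> Ch" using \<pi>P[OF c1P] P_Ch by blast
    have \<pi>Ch': "\<pi> c \<in> Ch" if "c \<in> Ch - C3" for c
    proof -
      have "c \<in> P" using that by (simp add: P_def)
      then show ?thesis using \<pi>P P_Ch by blast
    qed
    show ?thesis
    proof (rule good_positive[where sg = sg and var = var])
      fix e assume e: "e \<in> RB"
      have "var e \<in> FB \<and> var e \<noteq> e \<and> (\<exists>x. x \<in> e \<and> x \<in> var e)"
      proof -
        consider c where "c \<in> Ch" "e = ed (d c)" | c where "c \<in> Ch - C3" "e = ed c" | "e = ed b"
          using e unfolding RB_def by blast
        then show ?thesis
        proof cases
          case (1 c)
          have "ed c \<noteq> ed (d c)" using ed_inj[of c "d c"] Ch[OF 1(1)] dc[OF 1(1)] by auto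
          moreover have "c \<in> ed (d c)" "c \<in> ed c" using dc(3)[OF 1(1)] by (auto simp: ed_def)
          ultimately show ?thesis using 1 var_d by (auto simp: FB_def)
        next
          case (2 c)
          then have cC: "c \<in> Ch" by blast
          have "ed (\<pi> c) \<noteq> ed c" using ed_inj[of "\<pi> c" c] Ch[OF cC] Ch[OF \<pi>Ch'[OF 2(1)]] \<pi>_neq[OF 2(1)] by auto
          moreover have "b \<in> ed (\<pi> c)" "b \<in> ed c" using Ch(3)[OF cC] Ch(3)[OF \<pi>Ch'[OF 2(1)]] by (auto simp: ed_def)
          ultimately show ?thesis using 2 var_c[OF cC] \<pi>Ch'[OF 2(1)] by (auto simp: FB_def)
        next
          case 3
          have "ed (\<pi> c1) \<noteq> ed b" using ed_inj[of "\<pi> c1" b] b Ch[OF \<pi>Ch] by auto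
          moreover have "b \<in> ed (\<pi> c1)" "b \<in> ed b" using Ch(3)[OF \<pi>Ch] by (auto simp: ed_def)
          ultimately show ?thesis using 3 var_b \<pi>Ch by (auto simp: FB_def)
        qed
      qed
      then show "var e \<in> FB" "edge_form D e (var e) \<noteq> 0"
        using edge_form_adjacent[OF D, of e "var e"] e subE by blast+
    next
      show "card {e \<in> RB. var e = f} \<le> 2" for f
      proof (cases "f \<in> FB")
        case True
        then obtain c where c: "c \<in> Ch" "f = ed c" by (auto simp: FB_def)
        define z where "z = inv_into P \<pi> c"
        have z: "z = x" if "\<pi> x = c" "x \<in> P" for x
          unfolding z_def using that \<pi>(1) by (auto simp: bij_betw_def)
        have "{e \<in> RB. var e = f} \<subseteq> {ed (d c), if z = c1 then ed b else ed z}"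
        proof
          fix e assume "e \<in> {e \<in> RB. var e = f}"
          then have e: "e \<in> RB" "var e = ed c" using c by auto
          consider c' where "c' \<in> Ch" "e = ed (d c')" | c' where "c' \<in> Ch - C3" "e = ed c'" | "e = ed b"
            using e(1) unfolding RB_def by blast
          then show "e \<in> {ed (d c), if z = c1 then ed b else ed z}"
          proof cases
            case (1 c')
            then have "c' = c" using e(2) var_d[OF 1(1)] ed_inj Ch(1,2) c(1) by metis
            then show ?thesis using 1 by simp
          next
            case (2 c')
            then have "c' \<in> Ch" "c' \<in> P" "c' \<noteq> c1" using c13(1) by (auto simp: P_def)
            moreover then have "\<pi> c' = c" using e(2) 2 var_c ed_inj Ch(1,2) c(1) \<pi>Ch' by metis
            ultimately show ?thesis using 2 z by auto
          next
            case 3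
            then have "\<pi> c1 = c" using e(2) var_b ed_inj Ch(1,2) c(1) \<pi>Ch by metis
            then show ?thesis using 3 z c1P by auto
          qed
        qed
        then have "card {e \<in> RB. var e = f} \<le> card {ed (d c), if z = c1 then ed b else ed z}"
          by (rule card_mono[rotated]) simp
        also have "\<dots> \<le> 2" by (simp add: card_insert_le_m1)
        finally show ?thesis .
      next
        case False
        have "{e \<in> RB. var e = f} = {}"
        proof -
          have "var e \<in> FB" if "e \<in> RB" for e
            using that var_d var_c var_b \<pi>Ch \<pi>Ch' unfolding RB_def FB_def by auto
          then show ?thesis using False by blast
        qed
        then show ?thesis by (metis card.empty zero_le)
      qed
    qed (use fin sg in auto)
  qed
  have par0: "par (lam 0) = d c1" "lam 0 \<noteq> r" using ecc[OF c13(1)] c13(2) by auto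
  have lam0: "ed (lam 0) = {lam 0, stem (lam 0)}"
    using stem[OF lam_L, of 0 "par (lam 0)"] edT(1)[OF lam_V par0(2)] by (simp add: ed_def)
  have lam0A: "ed (lam 0) \<in> RA" using c13 unfolding RA_def by (metis (no_types, lifting) UnI1 UnI2 imageI)
  have rho_AB: "rho i \<notin> RA" "rho i \<notin> RB" for i using ABT rho_T by blast+
  have rho_last: "rho (0 + n - 1) = rho (n - 1)" by simp
  have C: "good 0 RC FC (edge_form D)"
  proof -
    have *: "edge_form D e (ed (lam 0)) \<noteq> 0" if "e \<in> RC" for e
    proof -
      have "lam 0 \<in> e" using that n3 by (auto simp: RC_def rho_def)
      moreover have "ed (lam 0) \<noteq> e" using that edT(1)[OF lam_V par0(2)] rho_T by (auto simp: RC_def)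
      ultimately show ?thesis
        using edge_form_adjacent[OF D, of e "ed (lam 0)" "lam 0"] that subE by (auto simp: FC_def ed_def)
    qed
    have "good 0 RC ((\<lambda>_. ed (lam 0)) ` RC) (edge_form D)"
    proof (rule good_leading[where w = "\<lambda>_. 0"])
      have "card {e \<in> RC. ed (lam 0) = f} \<le> card RC" for f using fin by (intro card_mono) auto
      also have "card RC \<le> 2" by (simp add: RC_def card_insert_le_m1)
      finally show "card {e \<in> RC. ed (lam 0) = f} \<le> 2" for f .
    qed (use fin * in auto)
    moreover have "(\<lambda>_. ed (lam 0)) ` RC = FC" by (auto simp: RC_def FC_def)
    ultimately show ?thesis by simp
  qed
  have ex: "\<exists>F \<subseteq> E. good 0 RD F (edge_form D) \<and>
    (\<forall>f\<in>F. (\<exists>i<n. 0 < i \<and> f = rho (i - 1) \<and> (rho i \<in> RD \<or> {lam i, stem (lam i)} \<in> RD)) \<or>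
      (\<exists>e\<in>RD. \<exists>u c. u \<in> V \<and> u \<noteq> r \<and> e = {u, par u} \<and> c \<in> V \<and> c \<noteq> r \<and> par c = u \<and> f = {c, par c}))"
  proof (rule good_0_peel[OF D rooted])
    show "RD \<subseteq> E" by (auto simp: RD_def)
    fix i assume i: "i < n"
    show "0 < i \<and> i < n - 1" if "rho i \<in> RD"
    proof -
      have "rho i \<noteq> rho 0" "rho i \<noteq> rho (n - 1)" using that unfolding RD_def RC_def by auto
      then have "i \<noteq> 0" "i \<noteq> n - 1" by metis+
      then show ?thesis using i by linarith
    qed
    show "0 < i" if "{lam i, stem (lam i)} \<in> RD"
    proof -
      have "{lam i, stem (lam i)} \<noteq> ed (lam 0)" using that lam0A unfolding RD_def by auto
      then show ?thesis using lam0 by (metis gr0I)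
    qed
  qed
  then obtain FD where FD: "FD \<subseteq> E" "good 0 RD FD (edge_form D)"
    "\<forall>f\<in>FD. (\<exists>i<n. 0 < i \<and> f = rho (i - 1) \<and> (rho i \<in> RD \<or> {lam i, stem (lam i)} \<in> RD)) \<or>
      (\<exists>e\<in>RD. \<exists>u c. u \<in> V \<and> u \<noteq> r \<and> e = {u, par u} \<and> c \<in> V \<and> c \<noteq> r \<and> par c = u \<and> f = {c, par c})"
    by (elim exE conjE)
  have finFD: "finite FD" using finite_subset[OF FD(1) finE] .
  have FD_notin: "ed x \<notin> FD" if x: "x \<in> V" "x \<noteq> r" and px: "ed (par x) \<in> RA \<union> RB" for x
  proof
    assume "ed x \<in> FD"
    from FD(3)[rule_format, OF this] show False
    proof
      assume "\<exists>i<n. 0 < i \<and> ed x = rho (i - 1) \<and> (rho i \<in> RD \<or> {lam i, stem (lam i)} \<in> RD)"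
      then show False using edT(1)[OF x] rho_T by metis
    next
      assume "\<exists>e\<in>RD. \<exists>u c. u \<in> V \<and> u \<noteq> r \<and> e = {u, par u} \<and> c \<in> V \<and> c \<noteq> r \<and> par c = u \<and> ed x = {c, par c}"
      then obtain e u c where c: "e \<in> RD" "e = {u, par u}" "c \<in> V" "c \<noteq> r" "par c = u" "ed x = {c, par c}"
        by (elim bexE exE conjE)
      have "x = c" using ed_inj[of x c] c x by (simp add: ed_def)
      then have "e = ed (par x)" using c by (simp add: ed_def)
      then show False using px c(1) by (auto simp: RD_def)
    qed
  qed
  have edc_AB: "ed c \<in> RA \<union> RB" if "c \<in> Ch" for c using that by (auto simp: RA_def RB_def)
  have "good 0 (RC \<union> RD) (FC \<union> FD) (edge_form D)"
  proof (rule good_triangular[OF _ fin(3,4,7) finFD _ _ _ C FD(2)])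
    show "RC \<inter> RD = {}" by (auto simp: RD_def)
    have "ed (d c1) \<in> RB" using c1C by (auto simp: RB_def)
    then show "FC \<inter> FD = {}" using FD_notin[OF lam_V par0(2)] par0(1) by (auto simp: FC_def)
    show "edge_form D e f = 0" if "e \<in> RD" "f \<in> FC" for e f
    proof (rule ccontr)
      assume nz: "edge_form D e f \<noteq> 0"
      have eE: "e \<in> E" and e: "e \<notin> RA" "e \<notin> RB" "e \<notin> RC" using that by (auto simp: RD_def)
      have "f = {lam 0, d c1}" using that by (simp add: FC_def ed_def par0)
      then have "lam 0 \<in> e \<or> d c1 \<in> e" using edge_form_disjoint[OF D eE nz] by auto
      then show False
      proof
        assume "lam 0 \<in> e"
        then have "e \<in> {rho 0, rho (0 + n - 1), {lam 0, stem (lam 0)}}" using edges_at_leaf[of 0] eE by blast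
        then show False using e lam0A lam0 unfolding RC_def rho_last by auto
      next
        assume "d c1 \<in> e"
        then have "e = ed (d c1) \<or> e = ed (ec c1)" using at_d[OF eE _ c13(1)] by blast
        then show False using e lam0A c13(2) \<open>ed (d c1) \<in> RB\<close> by auto
      qed
    qed
  qed simp
  then have CD: "good 0 (RC \<union> RD) (FC \<union> FD) (edge_form D)" .
  have BCD: "good 0 (RB \<union> (RC \<union> RD)) (FB \<union> (FC \<union> FD)) (edge_form D)"
  proof (rule good_triangular[OF _ fin(2) _ fin(6) _ _ _ _ B CD])
    show "RB \<inter> (RC \<union> RD) = {}" using rho_AB(2) by (auto simp: RD_def RC_def)
    have "ed c \<notin> FC" if "c \<in> Ch" for c
      using ed_inj[of c "lam 0"] Ch[OF that] par0(2) lam_L[of 0] by (auto simp: FC_def)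
    moreover have "ed c \<notin> FD" if "c \<in> Ch" for c
      using FD_notin[OF Ch(1,2)[OF that]] Ch(3)[OF that] by (auto simp: RB_def)
    ultimately show "FB \<inter> (FC \<union> FD) = {}" by (auto simp: FB_def)
    show "edge_form D e f = 0" if "e \<in> RC \<union> RD" "f \<in> FB" for e f
    proof (rule ccontr)
      assume nz: "edge_form D e f \<noteq> 0"
      have eE: "e \<in> E" and e: "e \<notin> RA" "e \<notin> RB" using that rho_AB subE by (auto simp: RD_def RC_def)
      have "f \<in> FB" by fact
      then obtain c where c: "c \<in> Ch" "f = {c, b}" using Ch(3) by (auto simp: FB_def ed_def)
      then have "c \<in> e \<or> b \<in> e" using edge_form_disjoint[OF D eE nz] by auto
      moreover have "ed b \<in> RB" "ed (d c) \<in> RB" using c(1) by (auto simp: RB_def)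
      ultimately show False
        using at_c[OF eE _ c(1)] at_b[OF eE] edc_AB c(1) e by blast
    qed
  qed (use fin finFD in auto)
  have ABCD: "good 0 (RA \<union> (RB \<union> (RC \<union> RD))) (FA \<union> (FB \<union> (FC \<union> FD))) (edge_form D)"
  proof (rule good_triangular[OF _ fin(1) _ fin(5) _ _ _ _ A BCD])
    show "RA \<inter> (RB \<union> (RC \<union> RD)) = {}" using rho_AB(1) disjAB by (auto simp: RD_def RC_def)
    have "ed (d c) \<notin> FC" "ed (d c) \<notin> FB" "ed (d c) \<notin> FD" if c: "c \<in> C3" for c
    proof -
      note cC = C3(1)[OF c]
      show "ed (d c) \<notin> FC" using ed_inj[of "d c" "lam 0"] dc[OF cC] par0(2) C3(2)[OF c] by (auto simp: FC_def)
      show "ed (d c) \<notin> FB"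
      proof
        assume "ed (d c) \<in> FB"
        then obtain c' where "c' \<in> Ch" "ed (d c) = ed c'" by (auto simp: FB_def)
        then show False using ed_inj[of "d c" c'] dc[OF cC] Ch dC(1)[OF cC] by auto
      qed
      show "ed (d c) \<notin> FD" using FD_notin[OF dc(1,2)[OF cC]] dc(3)[OF cC] edc_AB[OF cC] by auto
    qed
    then show "FA \<inter> (FB \<union> (FC \<union> FD)) = {}" by (auto simp: FA_def)
    show "edge_form D e f = 0" if "e \<in> RB \<union> (RC \<union> RD)" "f \<in> FA" for e f
    proof (rule ccontr)
      assume nz: "edge_form D e f \<noteq> 0"
      have eE: "e \<in> E" and e: "e \<notin> RA" using that rho_AB subE disjAB by (auto simp: RD_def RC_def)
      have "f \<in> FA" by fact
      then obtain c where c: "c \<in> C3" "f = ed (d c)" by (auto simp: FA_def)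
      note cC = C3(1)[OF c(1)]
      have "f \<noteq> e" "c \<in> e \<or> d c \<in> e"
        using edge_form_disjoint[OF D eE nz] dc(3)[OF cC] unfolding c(2) ed_def by auto
      then have "e = ed c \<or> e = ed (ec c)" using at_c[OF eE _ cC] at_d[OF eE _ c(1)] c(2) by blast
      then show False using e c(1) by (auto simp: RA_def)
    qed
  qed (use fin finFD in auto)
  have "RA \<union> (RB \<union> (RC \<union> RD)) = E" using subE by (auto simp: RD_def)
  moreover have "FA \<union> (FB \<union> (FC \<union> FD)) \<subseteq> E" using subE FD(1) by blast
  ultimately show ?thesis using good_superset[OF ABCD _ finite_subset[OF _ finE]] by simp
qed

end

section \<open>Uniqueness of hanging paths and relabelling of the rim\<close>

lemma chain_unique:
  assumes "chain T v a l k" "chain T v a l' k'"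
  shows "l = l' \<and> k = k'"
  using assms
proof (induction arbitrary: k' rule: chain.induct)
  case (base v a)
  from base.prems show ?case
  proof cases
    case (step b)
    then show ?thesis using base.hyps(2) by (auto simp: leaf_def card_insert_if split: if_splits)
  qed simp
next
  case (step v a b l k)
  from step.prems show ?case
  proof cases
    case base
    then show ?thesis using step.hyps by (auto simp: leaf_def card_insert_if split: if_splits)
  next
    case (step b' k'')
    then have "b' = b" using \<open>neighbours T a = {v, b}\<close> \<open>b \<noteq> v\<close> by (auto simp: doubleton_eq_iff)
    then show ?thesis using step \<open>\<And>k'. chain T a b l' k' \<Longrightarrow> l = l' \<and> k = k'\<close> by simp
  qed
qed

text \<open>\<open>S\<close> consists of the vertices of the path after \<open>v\<close>: it can be
  left only through \<open>v\<close>, and \<open>l\<close> is its only leaf. This shows later that a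
  path hanging from a root leaf would be the whole tree.\<close>

lemma chain_closed:
  assumes "chain T v a l k"
  shows "\<exists>S. a \<in> S \<and> (\<forall>x\<in>S. neighbours T x \<subseteq> insert v S) \<and> (\<forall>x\<in>S. leaf T x \<longrightarrow> x = l)"
  using assms
proof (induction rule: chain.induct)
  case (base v a)
  obtain w where w: "neighbours T a = {w}" using base by (auto simp: leaf_def card_1_singleton_iff)
  moreover have "v \<in> neighbours T a" using base by (simp add: neighbours_def insert_commute)
  ultimately show ?case by (intro exI[of _ "{a}"]) auto
next
  case (step v a b l k)
  then obtain S where S: "b \<in> S" "\<forall>x\<in>S. neighbours T x \<subseteq> insert a S" "\<forall>x\<in>S. leaf T x \<longrightarrow> x = l" by blast
  have "v \<noteq> b" using step by auto
  then have "\<not> leaf T a" using step by (simp add: leaf_def)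
  then show ?case using S step by (intro exI[of _ "insert a S"]) auto
qed

lemma cyclic_on_no_fixpoint:
  assumes "cyclic_on f S" "x \<in> S" "y \<in> S" "y \<noteq> x"
  shows "f x \<noteq> x"
proof
  assume fx: "f x = x"
  have "y \<in> orbit f x" using assms by (auto simp: cyclic_on_alldef)
  moreover have "z = x" if "z \<in> orbit f x" for z using that by induction (simp_all add: fx)
  ultimately show False using assms by blast
qed

lemma cyclic_on_no_swap:
  assumes "cyclic_on f S" "x \<in> S" "z \<in> S" "z \<noteq> x" "z \<noteq> y" "f x = y"
  shows "f y \<noteq> x"
proof
  assume fy: "f y = x"
  have "z \<in> orbit f x" using assms by (auto simp: cyclic_on_alldef)
  moreover have "w = x \<or> w = y" if "w \<in> orbit f x" for w
    using that by induction (auto simp: fy assms)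
  ultimately show False using assms by blast
qed

lemma cyclic_on_surj:
  assumes "cyclic_on f S" "y \<in> S"
  shows "\<exists>x\<in>S. f x = y"
proof -
  have "f ` S \<subseteq> S" using cyclic_on_inI[OF assms(1)] by blast
  then have "f ` S = S"
    using endo_inj_surj[OF finite_cyclic_on[OF assms(1)]] cyclic_on_inj[OF assms(1)] by blast
  then show ?thesis using assms(2) by (metis imageE)
qed

context halin
begin

text \<open>The alternatives of \<open>step\<close> are rotations and reflections of the rim. They
  change the labelling but not the graph, and so justify placing chosen leaves at prescribed
  indices.\<close>

lemma reindex:
  assumes per': "\<And>k. f (k mod n) mod n = f k mod n"
    and inj': "\<And>k k'. k < n \<Longrightarrow> k' < n \<Longrightarrow> f k mod n = f k' mod n \<Longrightarrow> k = k'"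
    and step: "(\<forall>k. f (Suc k) mod n = Suc (f k) mod n) \<or> (\<forall>k. Suc (f (Suc k)) mod n = f k mod n)"
  shows "halin V T (\<lambda>k. lam (f k)) n" "halin.E T (\<lambda>k. lam (f k)) n = E"
proof -
  have inj_f: "inj_on (\<lambda>k. lam (f k)) {..<n}" unfolding inj_on_def lam_eq using inj' by blast
  have "(\<lambda>k. lam (f k)) ` {..<n} \<subseteq> lam ` {..<n}" using lam_L unfolding L_def by blast
  moreover have "card ((\<lambda>k. lam (f k)) ` {..<n}) = card (lam ` {..<n})"
    using inj_f inj by (simp add: card_image)
  ultimately have im: "(\<lambda>k. lam (f k)) ` {..<n} = lam ` {..<n}" by (simp add: card_subset_eq)
  show H: "halin V T (\<lambda>k. lam (f k)) n"
    using tree n3 inj_f im leaves per' by unfold_locales (simp_all add: lam_eq)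
  then interpret H: halin V T "\<lambda>k. lam (f k)" n .
  have "H.rho k \<in> rho ` {..<n}" for k
  proof -
    have "H.rho k = rho (f k) \<or> H.rho k = rho (f (Suc k))"
      using step
    proof
      assume "\<forall>k. f (Suc k) mod n = Suc (f k) mod n"
      then have "lam (f (Suc k)) = lam (Suc (f k))" by (simp add: lam_eq)
      then show ?thesis by (simp add: H.rho_def rho_def)
    next
      assume "\<forall>k. Suc (f (Suc k)) mod n = f k mod n"
      then have "lam (f k) = lam (Suc (f (Suc k)))" by (simp add: lam_eq)
      then show ?thesis by (simp add: H.rho_def rho_def insert_commute)
    qed
    moreover have "rho i \<in> rho ` {..<n}" for i using rho_E[of i] rho_T[of i] unfolding E_def by blast
    ultimately show ?thesis by metis
  qed
  then have "H.rho ` {..<n} \<subseteq> rho ` {..<n}" by blast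
  moreover have "card (H.rho ` {..<n}) = card (rho ` {..<n})"
    using H.inj_on_rho inj_on_rho by (simp add: card_image)
  ultimately have "H.rho ` {..<n} = rho ` {..<n}" by (simp add: card_subset_eq)
  then show "H.E = E" by (simp add: H.E_def E_def)
qed

lemma shift:
  shows "halin V T (\<lambda>k. lam (c + k)) n" "halin.E T (\<lambda>k. lam (c + k)) n = E"
proof -
  have inj': "k = k'" if "k < n" "k' < n" "(c + k) mod n = (c + k') mod n" for k k'
    using cong_add_lcancel_nat[of c k k' n] that by (simp add: cong_def)
  show "halin V T (\<lambda>k. lam (c + k)) n" "halin.E T (\<lambda>k. lam (c + k)) n = E"
    by (rule reindex[of "\<lambda>k. c + k"]; simp add: mod_simps inj')+
qed

text \<open>\<open>(n - 1) * k\<close> is -k modulo \<open>n\<close>, kept within the natural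
  numbers.\<close>

lemma reverse:
  shows "halin V T (\<lambda>k. lam (c + (n - 1) * k)) n" "halin.E T (\<lambda>k. lam (c + (n - 1) * k)) n = E"
proof -
  have inj': "k = k'" if "k < n" "k' < n" "(c + (n - 1) * k) mod n = (c + (n - 1) * k') mod n" for k k'
  proof -
    have 1: "[(n - 1) * k = (n - 1) * k'] (mod n)"
      using cong_add_lcancel_nat[of c "(n - 1) * k" "(n - 1) * k'" n] that by (simp add: cong_def)
    have 2: "j + (n - 1) * j = n * j" for j using n3 by (cases n) auto
    have "[k + (n - 1) * k = k' + (n - 1) * k'] (mod n)" unfolding 2 by (simp add: cong_def)
    also have "[k' + (n - 1) * k' = k' + (n - 1) * k] (mod n)" using 1 by (intro cong_add cong_refl) (rule cong_sym)
    finally have "[k = k'] (mod n)" by (simp only: cong_add_rcancel_nat)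
    then show ?thesis using that by (simp add: cong_def)
  qed
  have step: "Suc (c + (n - 1) * Suc k) mod n = (c + (n - 1) * k) mod n" for k
  proof -
    have "Suc (c + (n - 1) * Suc k) = c + (n - 1) * k + n" using n3 by (cases n) simp_all
    then show ?thesis by (simp only: mod_add_self2)
  qed
  have per': "(c + (n - 1) * (k mod n)) mod n = (c + (n - 1) * k) mod n" for k
    by (metis mod_add_right_eq mod_mult_right_eq)
  show "halin V T (\<lambda>k. lam (c + (n - 1) * k)) n" "halin.E T (\<lambda>k. lam (c + (n - 1) * k)) n = E"
    using reindex[of "\<lambda>k. c + (n - 1) * k", OF per' inj'] step by blast+
qed

text \<open>The parent \<open>p\<close> of a deepest leaf has only leaves as children, and the root
  leaf \<open>lam 0\<close> does not hang from it, so the rim leaves the set of leaves at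
  \<open>p\<close> somewhere.\<close>

lemma good_3_not_wheel:
  assumes D: "orientation E D" and not_wheel: "\<And>h. h \<notin> L \<Longrightarrow> V \<noteq> insert h L"
  shows "good 3 E V (vertex_form D)"
proof -
  obtain par dep where rooted: "rooted_tree V T (lam 0) par dep"
    using tree_graph_rooted[OF tree lam_V] by blast
  then interpret rooted_tree V T "lam 0" par dep .
  have "Max (dep ` V) \<in> dep ` V" using finV rV by (intro Max_in) blast+
  then obtain x where x: "x \<in> V" "dep x = Max (dep ` V)" by force
  have max: "dep v \<le> dep x" if "v \<in> V" for v using that finV x by simp
  have leaf_max: "v \<in> L" if v: "v \<in> V" "v \<noteq> lam 0" "dep v = dep x" for v
  proof (rule ccontr)
    assume "v \<notin> L"
    then have "\<not> leaf T v" using that by (simp add: L_leaf)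
    then obtain c where c: "c \<in> V" "c \<noteq> lam 0" "par c = v" using child_exists[OF v(1,2)] by blast
    show False using dep_par[OF c(1,2)] max[OF c(1)] v(3) unfolding c(3) by linarith
  qed
  have x0: "x \<noteq> lam 0"
  proof
    assume "x = lam 0"
    then have "dep (lam 1) = 0" using max[of "lam 1"] dep_r by simp
    then show False using par[of "lam 1"] by simp
  qed
  have xL: "x \<in> L" using leaf_max x x0 by simp
  define p where "p = par x"
  have xp: "{x, p} \<in> T" "p \<in> V" "dep x = Suc (dep p)" using par[OF x(1) x0] by (auto simp: p_def)
  then have stem_x: "stem x = p" using stem[OF xL] by simp
  then have pL: "p \<notin> L" using stem_notin_L[OF xL] by simp
  then have p0: "p \<noteq> lam 0" using lam_L by metis
  \<comment> \<open>If \<open>par p\<close> were a leaf, it would be the root and \<open>p\<close>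
    its only neighbour; all vertices other than \<open>p\<close> would then be leaves, and the graph
    a wheel.\<close>
  have ppL: "par p \<notin> L"
  proof
    assume pp: "par p \<in> L"
    have e: "{par p, p} \<in> T" "par p \<in> V" using par[OF xp(2) p0] by (auto simp: insert_commute)
    have "par p = lam 0"
    proof (rule ccontr)
      assume "par p \<noteq> lam 0"
      then have "{par p, par (par p)} \<in> T" "dep (par (par p)) < dep p"
        using par[OF e(2)] par[OF xp(2) p0] by auto
      then show False using stem[OF pp, of p] stem[OF pp, of "par (par p)"] e(1) by auto
    qed
    then have dp: "dep p = 1" "stem (lam 0) = p" using par[OF xp(2) p0] dep_r stem[OF pp, of p] e(1) by auto
    have "v \<in> insert p L" if "v \<in> V" for v
    proof (cases "v = lam 0 \<or> dep v = dep x")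
      case True
      then show ?thesis using leaf_max[OF that] lam_L[of 0] by blast
    next
      case False
      then have "v \<noteq> lam 0" "dep v \<le> 1" using max[OF that] xp(3) dp by auto
      moreover then have "dep (par v) = 0" "par v \<in> V" "{par v, v} \<in> T" using par[OF that] by (auto simp: insert_commute)
      moreover then have "par v = lam 0" using par[of "par v"] by auto
      ultimately show ?thesis using stem[OF lam_L, of 0 v] dp(2) by simp
    qed
    then have "V = insert p L" using xp(2) L_V by blast
    then show False using not_wheel[OF pL] by simp
  qed
  have nb: "y = par p \<or> y \<in> L" if "{p, y} \<in> T" for y
    using edge_par[OF that] leaf_max[of y] edgeT[OF that] par[of y] xp(3) by auto
  have stem0: "stem (lam 0) \<noteq> p"
  proof
    assume "stem (lam 0) = p"
    then have "{lam 0, p} \<in> T" using stem[OF lam_L] by simp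
    then have "par p = lam 0" using edge_par by blast
    then show False using ppL by simp
  qed
  \<comment> \<open>The end of a run of leaves at \<open>p\<close>; otherwise all leaves, including
    \<open>lam 0\<close>, would hang from \<open>p\<close>.\<close>
  obtain i where i: "stem (lam i) = p" "stem (lam (Suc i)) \<noteq> p"
  proof (rule ccontr)
    assume no: "\<not> thesis"
    obtain i where "x = lam i" using L_lam[OF xL] by blast
    then have i: "stem (lam i) = p" using stem_x by simp
    have all: "stem (lam (i + k)) = p" for k
    proof (induction k)
      case (Suc k)
      then show ?case using no that[of "i + k"] by auto
    qed (simp add: i)
    have "stem (lam (n * i)) = p" using all[of "(n - 1) * i"] n3 by (cases n) (auto simp: algebra_simps)
    moreover have "lam (n * i) = lam 0" by (simp add: lam_eq)
    ultimately show False using stem0 by simp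
  qed
  define mu where "mu k = lam (Suc i + k)" for k
  have mu: "halin V T mu n" "halin.E T mu n = E" using shift[of "Suc i"] unfolding mu_def[abs_def] by auto
  interpret H: halin V T mu n by (rule mu(1))
  note HE = mu(2)
  have HL: "H.L = L" using H.L_leaf L_leaf by blast
  have "good 3 H.E V (vertex_form D)"
  proof (rule H.good_3_boundary[OF _ rooted])
    have "mu (n - 1) = lam i" using n3 by (simp add: mu_def lam_eq)
    then show "H.stem (mu (n - 1)) = p" using i(1) by (simp add: H.stem_def stem_def)
    show "H.stem (mu 0) \<noteq> p" using i(2) by (simp add: mu_def H.stem_def stem_def)
  qed (use D xp(2) pL p0 ppL nb in \<open>auto simp: HE HL\<close>)
  then show ?thesis unfolding HE .
qed

end

section \<open>Deepest leaves and the final case distinction\<close>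

lemma cycle_seq_halin:
  assumes "tree_graph V T" "cycle_seq xs" "set xs = {v \<in> V. leaf T v}"
  shows "halin V T (\<lambda>i. xs ! (i mod length xs)) (length xs)"
    "halin.E T (\<lambda>i. xs ! (i mod length xs)) (length xs) = T \<union> cycle_edges xs"
proof -
  have len: "3 \<le> length xs" "distinct xs" using assms(2) by (auto simp: cycle_seq_def)
  have im: "(\<lambda>i. xs ! (i mod length xs)) ` {..<length xs} = set xs"
    by (force simp: set_conv_nth)
  show "halin V T (\<lambda>i. xs ! (i mod length xs)) (length xs)"
  proof
    show "inj_on (\<lambda>i. xs ! (i mod length xs)) {..<length xs}"
      using len(2) by (auto simp: inj_on_def nth_eq_iff_index_eq)
  qed (use assms len im in auto)
  then interpret halin V T "\<lambda>i. xs ! (i mod length xs)" "length xs" .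
  have "rho ` {..<length xs} = cycle_edges xs"
    unfolding cycle_edges_def rho_def by (auto simp: image_iff)
  then show "E = T \<union> cycle_edges xs" by (simp add: E_def)
qed

text \<open>Rotation-consecutive hanging paths at one vertex have lengths of different parity. One
  level above the deepest leaves all lengths are 1, so there is at most one child. Two levels above,
  lengths are 1 or 2, and two children would give the short pair. Three levels above, a path of
  length 1 would again have a neighbour of length 2, so only lengths 2 and 3 remain, and the path to
  \<open>z\<close> has length 3.\<close>

lemma (in plane_tree) good_0_bipartite:
  assumes tree: "tree_graph V T" and E: "E = T \<union> cycle_edges xs" and D: "orientation E D"
    and col: "\<And>u v. {u, v} \<in> E \<Longrightarrow> col u \<noteq> (col v :: bool)"
  shows "good 0 E E (edge_form D)"
proof (rule ccontr)
  assume bad: "\<not> good 0 E E (edge_form D)"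
  define n where "n = length xs"
  define lam where "lam i = xs ! (i mod n)" for i
  have H: "halin V T lam n" "halin.E T lam n = E"
    using cycle_seq_halin[OF tree cyc set_xs] unfolding lam_def[abs_def] n_def E by auto
  interpret H: halin V T lam n by (rule H(1))
  obtain par dep where rooted: "rooted_tree V T (lam 0) par dep"
    using tree_graph_rooted[OF tree H.lam_V] by blast
  then interpret rooted_tree V T "lam 0" par dep .
  have colT: "col u \<noteq> col v" if "{u, v} \<in> T" for u v using col[of u v] that E by simp
  define kids where "kids v = {x \<in> V. x \<noteq> lam 0 \<and> par x = v}" for v
  have nbs: "neighbours T v = insert (par v) (kids v)" "par v \<notin> kids v" if v: "v \<in> V" "v \<noteq> lam 0" for v
  proof -
    show "neighbours T v = insert (par v) (kids v)"
    proof (intro equalityI subsetI)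
      fix x assume "x \<in> neighbours T v"
      then have "{v, x} \<in> T" by (simp add: neighbours_def)
      then show "x \<in> insert (par v) (kids v)" using edge_par[of v x] edge[of v x] by (auto simp: kids_def)
    next
      fix x assume "x \<in> insert (par v) (kids v)"
      then show "x \<in> neighbours T v" using par[OF v] par[of x] by (auto simp: neighbours_def kids_def insert_commute)
    qed
    show "par v \<notin> kids v" using dep_par[OF v] dep_par[of "par v"] by (auto simp: kids_def)
  qed
  \<comment> \<open>The root is a leaf, so a path hanging from it would be the whole tree, with only
    two leaves. Hence the ancestors \<open>p\<close>, \<open>q\<close>, \<open>b\<close> of
    \<open>z\<close> differ from the root.\<close>
  have no_root: "\<not> chain T (lam 0) a l k" for a l k
  proof
    assume c: "chain T (lam 0) a l k"
    obtain S where S: "a \<in> S" "\<forall>x\<in>S. neighbours T x \<subseteq> insert (lam 0) S" "\<forall>x\<in>S. leaf T x \<longrightarrow> x = l"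
      using chain_closed[OF c] by blast
    have a: "a = H.stem (lam 0)" using H.stem[OF H.lam_L] chain_edge[OF c] by simp
    have "v \<in> insert (lam 0) S" if "(\<lambda>x y. {x, y} \<in> T)\<^sup>*\<^sup>* (lam 0) v" for v
      using that
    proof induction
      case (step x y)
      show ?case
      proof (cases "x = lam 0")
        case True
        then show ?thesis using step.hyps(2) H.stem[OF H.lam_L] a S(1) by simp
      next
        case False
        then show ?thesis using step S(2) by (auto simp: neighbours_def)
      qed
    qed simp
    then have "V \<subseteq> insert (lam 0) S"
      using tree H.lam_V unfolding tree_graph_def connected_graph_def by blast
    then have "H.L \<subseteq> {lam 0, l}" using S(3) H.L_leaf by blast
    then have "card H.L \<le> card {lam 0, l}" by (rule card_mono[rotated]) simp
    also have "\<dots> \<le> 2" by (simp add: card_insert_le_m1)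
    finally show False using H.card_L H.n3 by simp
  qed
  \<comment> \<open>The child \<open>x0\<close> is paired with its successor in the rotation or, if
    that is the parent, with its predecessor. Both cannot be the parent, because \<open>x1\<close>
    is a third neighbour.\<close>
  have pair: "\<exists>x\<in>kids v. \<exists>x'\<in>kids v. \<exists>l l' k k'. chain T v x l k \<and> chain T v x' l' k' \<and>
      {l, l'} \<in> cycle_edges xs \<and> odd (k + k') \<and> (x0 = x \<or> x0 = x')"
    if v: "v \<in> V" "v \<noteq> lam 0" and ch: "\<And>x. x \<in> kids v \<Longrightarrow> \<exists>l k. chain T v x l k"
      and x0: "x0 \<in> kids v" "x1 \<in> kids v" "x1 \<noteq> x0" for v x0 x1
  proof -
    note c = cyclic[OF v(1)]
    have in_nb: "x0 \<in> neighbours T v" "x1 \<in> neighbours T v" "par v \<in> neighbours T v" using x0 nbs[OF v] by auto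
    have "\<exists>x\<in>kids v. rot v x \<in> kids v \<and> rot v x \<noteq> x \<and> (x0 = x \<or> x0 = rot v x)"
    proof (cases "rot v x0 = par v")
      case False
      then have "rot v x0 \<in> kids v" using cyclic_on_inI[OF c in_nb(1)] nbs(1)[OF v] by auto
      moreover have "rot v x0 \<noteq> x0" using cyclic_on_no_fixpoint[OF c in_nb(1,2) x0(3)] .
      ultimately show ?thesis using x0(1) by blast
    next
      case True
      obtain y where y: "y \<in> neighbours T v" "rot v y = x0" using cyclic_on_surj[OF c in_nb(1)] by blast
      have "x1 \<noteq> par v" using x0(2) nbs(2)[OF v] by blast
      then have "rot v (par v) \<noteq> x0" using cyclic_on_no_swap[OF c in_nb(1,2) x0(3) _ True] by blast
      then have "y \<in> kids v" using y nbs(1)[OF v] by auto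
      moreover have "rot v y \<noteq> y"
        using y x0 in_nb cyclic_on_no_fixpoint[OF c y(1)] by (metis nbs(2)[OF v])
      ultimately show ?thesis using y(2) x0(1) by blast
    qed
    then obtain x where x: "x \<in> kids v" "rot v x \<in> kids v" "rot v x \<noteq> x" "x0 = x \<or> x0 = rot v x" by blast
    obtain l k where lk: "chain T v x l k" using ch[OF x(1)] by blast
    obtain l' k' where lk': "chain T v (rot v x) l' k'" using ch[OF x(2)] by blast
    have rim: "{l, l'} \<in> cycle_edges xs" by (rule consecutive_chains[OF lk lk' x(3)])
    then have "col l \<noteq> col l'" using col E by blast
    then have "odd (k + k')"
      using chain_colour[OF lk, of col] chain_colour[OF lk', of col] colT by auto
    then show ?thesis using x lk lk' rim by blast
  qed
  have no_short: False if c: "chain T v x l 1" "chain T v x' l' 2" and rim: "{l, l'} \<in> cycle_edges xs" for v x x' l l'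
  proof -
    have x: "x = l" "leaf T l" using chain_one[of T v x l] c(1) by simp_all
    obtain b where b: "neighbours T x' = {v, b}" "b \<noteq> v" "chain T x' b l' (Suc 0)"
      using c(2) unfolding numeral_2_eq_2 by (rule chain_Suc)
    have "b = l'" using chain_one[OF b(3)] by simp
    have e: "{v, l} \<in> T" "{v, x'} \<in> T" using chain_edge[OF c(1)] chain_edge[OF c(2)] x by auto
    have vL: "v \<notin> H.L"
    proof
      assume "v \<in> H.L"
      then have "x' = l" using H.stem e by metis
      moreover have "\<not> leaf T x'" using b by (simp add: leaf_def card_insert_if)
      ultimately show False using x by simp
    qed
    have "{l', l} \<in> H.E" "{l', l} \<notin> T"
    proof -
      show "{l', l} \<in> H.E" using rim H(2) E by (auto simp: insert_commute)
      have "l \<in> H.L" using x(2) edge[OF e(1)] by (simp add: H.L_leaf)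
      moreover have "l' \<noteq> v" using b(2) \<open>b = l'\<close> by simp
      ultimately show "{l', l} \<notin> T" using H.stem[of l l'] H.stem[of l v] e(1) by (auto simp: insert_commute)
    qed
    then obtain i where i: "{l', l} = H.rho i" unfolding H.E_def by blast
    then consider "l' = lam i" "l = lam (Suc i)" | "l' = lam (Suc i)" "l = lam i"
      unfolding H.rho_def by (auto simp: doubleton_eq_iff)
    \<comment> \<open>A rotation of the rim, or a reflection if the leaves come in the opposite
      order, puts \<open>l'\<close> and \<open>l\<close> at indices 0 and 1.\<close>
    then obtain mu where mu: "halin V T mu n" "halin.E T mu n = E" "mu 0 = l'" "mu 1 = l"
    proof cases
      case 1
      then show ?thesis using that[of "\<lambda>k. lam (i + k)"] H.shift[of i] H(2) by simp
    next
      case 2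
      have "lam (Suc i + (n - 1) * 1) = lam i" using H.n3 H.lam_n(2)[of i] by simp
      then show ?thesis using that[of "\<lambda>k. lam (Suc i + (n - 1) * k)"] H.reverse[of "Suc i"] H(2) 2 by simp
    qed
    interpret M: halin V T mu n by (rule mu(1))
    have LM: "M.L = H.L" using M.L_leaf H.L_leaf by blast
    have "good 0 M.E M.E (edge_form D)"
    proof (rule M.good_0_short_pair[where v = v and p = x'])
      show "M.stem (mu 1) = v" using M.stem[OF M.lam_L, of 1 v] e(1) mu(4) by (simp add: insert_commute)
      show "neighbours T x' = {v, mu 0}" using b(1) \<open>b = l'\<close> mu(3) by simp
    qed (use D mu(2) vL LM e in auto)
    then show False using bad mu(2) by simp
  qed
  have "Max (dep ` V) \<in> dep ` V" using finV rV by (intro Max_in) blast+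
  then obtain z where z: "z \<in> V" "dep z = Max (dep ` V)" by force
  have max: "dep v \<le> dep z" if "v \<in> V" for v using that finV z by simp
  have kidsD: "x \<in> V" "x \<noteq> lam 0" "par x = v" "dep x = Suc (dep v)" "{v, x} \<in> T" if "x \<in> kids v" for x v
    using that par[of x] by (auto simp: kids_def insert_commute)
  have leaf_chain: "chain T (par v) v v 1" if v: "v \<in> V" "v \<noteq> lam 0" and "kids v = {}" for v
  proof -
    have "leaf T v" using nbs(1)[OF v] that(3) by (simp add: leaf_def)
    then show ?thesis using chain.base[of "par v" v T] par[OF v] by (simp add: insert_commute)
  qed
  have step_chain: "chain T (par v) v l (Suc k)"
    if v: "v \<in> V" "v \<noteq> lam 0" and K: "kids v = {x}" and c: "chain T v x l k" for v x l k
  proof (rule chain.step)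
    show "neighbours T v = {par v, x}" "x \<noteq> par v" using nbs[OF v] K by auto
    show "{par v, v} \<in> T" using par[OF v] by (simp add: insert_commute)
  qed (rule c)
  have sing: "kids v = {} \<or> (\<exists>x. kids v = {x})"
    if "\<And>x0 x1. x0 \<in> kids v \<Longrightarrow> x1 \<in> kids v \<Longrightarrow> x1 \<noteq> x0 \<Longrightarrow> False" for v
    using that by blast
  have A1: "chain T (par v) v v 1" if v: "v \<in> V" "v \<noteq> lam 0" "dep v = dep z" for v
  proof (rule leaf_chain[OF v(1,2)])
    show "kids v = {}" using kidsD(1,4)[of _ v] max v(3) by fastforce
  qed
  have A2: "kids v = {} \<or> (\<exists>x. kids v = {x} \<and> chain T (par v) v x 2)"
    if v: "v \<in> V" "v \<noteq> lam 0" "Suc (dep v) = dep z" for v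
  proof -
    have ch: "chain T v x x 1" if "x \<in> kids v" for x using A1[of x] kidsD[OF that] v by simp
    have "False" if x: "x0 \<in> kids v" "x1 \<in> kids v" "x1 \<noteq> x0" for x0 x1
    proof -
      have "\<exists>l k. chain T v x l k" if "x \<in> kids v" for x using ch[OF that] by blast
      from pair[OF v(1,2) this x] obtain y y' l l' k k' where
        "y \<in> kids v" "y' \<in> kids v" "chain T v y l k" "chain T v y' l' k'" "odd (k + k')" by blast
      then have "k = 1" "k' = 1" using chain_unique ch by metis+
      then show False using \<open>odd (k + k')\<close> by simp
    qed
    then consider "kids v = {}" | x where "kids v = {x}" using sing[of v] by blast
    then show ?thesis
    proof cases
      case (2 x)
      then show ?thesis using step_chain[OF v(1,2) 2 ch[of x]] by (simp add: numeral_2_eq_2)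
    qed simp
  qed
  have A2': "\<exists>l. chain T (par v) v l 1 \<or> chain T (par v) v l 2"
    if v: "v \<in> V" "v \<noteq> lam 0" "Suc (dep v) = dep z" for v
    using A2[OF v] leaf_chain[OF v(1,2)] by blast
  have A3: "kids v = {} \<or> (\<exists>x. kids v = {x})"
    if v: "v \<in> V" "v \<noteq> lam 0" "Suc (Suc (dep v)) = dep z" for v
  proof (rule sing)
    have ch: "\<exists>l. chain T v x l 1 \<or> chain T v x l 2" if "x \<in> kids v" for x
      using A2'[of x] kidsD[OF that] v by simp
    fix x0 x1 assume x: "x0 \<in> kids v" "x1 \<in> kids v" "x1 \<noteq> x0"
    have "\<exists>l k. chain T v x l k" if "x \<in> kids v" for x using ch[OF that] by blast
    from pair[OF v(1,2) this x] obtain y y' l l' k k' where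
      y: "y \<in> kids v" "y' \<in> kids v" "chain T v y l k" "chain T v y' l' k'" "{l, l'} \<in> cycle_edges xs" "odd (k + k')"
      by blast
    have "k = 1 \<or> k = 2" "k' = 1 \<or> k' = 2" using ch[OF y(1)] ch[OF y(2)] y(3,4) chain_unique by metis+
    then consider "k = 1" "k' = 2" | "k = 2" "k' = 1" using y(6) by auto
    then show False
    proof cases
      case 1
      then show False using no_short[of v y l y' l'] y by simp
    next
      case 2
      then show False using no_short[of v y' l' y l] y by (simp add: insert_commute)
    qed
  qed
  have z0: "z \<noteq> lam 0"
  proof
    assume "z = lam 0"
    then have "dep (lam 1) = 0" using max[of "lam 1"] H.lam_V dep_r by simp
    then show False using par[of "lam 1"] H.lam_V H.lam_Suc(1)[of 0] by simp
  qed
  define p where "p = par z"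
  have cz: "chain T p z z 1" using A1[OF z(1) z0] by (simp add: p_def)
  have p0: "p \<noteq> lam 0" using no_root cz by metis
  have p: "p \<in> V" "Suc (dep p) = dep z" "z \<in> kids p" using par[OF z(1) z0] z z0 by (auto simp: p_def kids_def)
  define q where "q = par p"
  have cp: "chain T q p z 2" using A2[OF p(1) p0 p(2)] p(3) by (auto simp: q_def)
  have q0: "q \<noteq> lam 0" using no_root cp by metis
  have q: "q \<in> V" "Suc (Suc (dep q)) = dep z" "p \<in> kids q" using par[OF p(1) p0] p p0 by (auto simp: q_def kids_def)
  define b where "b = par q"
  have cq: "chain T b q z 3"
  proof -
    have "kids q = {p}" using A3[OF q(1) q0 q(2)] q(3) by auto
    from step_chain[OF q(1) q0 this cp] show ?thesis by (simp add: b_def numeral_3_eq_3 numeral_2_eq_2)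
  qed
  have b0: "b \<noteq> lam 0" using no_root cq by metis
  have b: "b \<in> V" "Suc (Suc (Suc (dep b))) = dep z" "q \<in> kids b" using par[OF q(1) q0] q q0 by (auto simp: b_def kids_def)
  have ch: "\<exists>l. chain T b x l 1 \<or> chain T b x l 2 \<or> chain T b x l 3" if x: "x \<in> kids b" for x
  proof -
    have xV: "x \<in> V" "x \<noteq> lam 0" "par x = b" "Suc (Suc (dep x)) = dep z" using kidsD[OF x] b by auto
    from A3[OF xV(1,2,4)] consider "kids x = {}" | y where "kids x = {y}" by blast
    then show ?thesis
    proof cases
      case 1
      then show ?thesis using leaf_chain[OF xV(1,2)] xV(3) by auto
    next
      case (2 y)
      have "\<exists>l. chain T x y l 1 \<or> chain T x y l 2" using A2'[of y] kidsD[of y x] 2 xV by simp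
      then show ?thesis
        using step_chain[OF xV(1,2) 2, of _ 1] step_chain[OF xV(1,2) 2, of _ 2] xV(3)
        by (auto simp: numeral_3_eq_3 numeral_2_eq_2)
    qed
  qed
  have no1: "\<not> chain T b x0 l0 1" if x0: "x0 \<in> kids b" for x0 l0
  proof
    assume c0: "chain T b x0 l0 1"
    have "q \<noteq> x0" using chain_unique[OF c0, of z 3] cq by auto
    have "\<exists>l k. chain T b x l k" if "x \<in> kids b" for x using ch[OF that] by blast
    from pair[OF b(1) b0 this x0 b(3) \<open>q \<noteq> x0\<close>] obtain y y' l l' k k' where
      y: "y \<in> kids b" "y' \<in> kids b" "chain T b y l k" "chain T b y' l' k'" "{l, l'} \<in> cycle_edges xs" "odd (k + k')"
        "x0 = y \<or> x0 = y'" by blast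
    have k: "k = 1 \<or> k = 2 \<or> k = 3" "k' = 1 \<or> k' = 2 \<or> k' = 3"
      using ch[OF y(1)] ch[OF y(2)] y(3,4) chain_unique by metis+
    from y(7) show False
    proof
      assume "x0 = y"
      then have "k = 1" using chain_unique[OF c0] y(3) by metis
      moreover then have "k' = 2" using k y(6) by auto
      ultimately show False using no_short[of b y l y' l'] y by simp
    next
      assume "x0 = y'"
      then have "k' = 1" using chain_unique[OF c0] y(4) by metis
      moreover then have "k = 2" using k y(6) by auto
      ultimately show False using no_short[of b y' l' y l] y by (simp add: insert_commute)
    qed
  qed
  have "z \<in> H.L" using chain_one[of T p z z] cz z(1) by (simp add: H.L_leaf)
  then obtain i where i: "z = lam i" using H.L_lam by blast
  define mu where "mu k = lam (i + k)" for k
  have mu: "halin V T mu n" "halin.E T mu n = E"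
    using H.shift[of i] H(2) unfolding mu_def[abs_def] by auto
  interpret M: halin V T mu n by (rule mu(1))
  have "good 0 M.E M.E (edge_form D)"
  proof (rule M.good_0_long_chains[OF _ rooted b(1) b0])
    show "orientation M.E D" using D mu(2) by simp
    show "chain T b q (mu 0) 3" using cq i by (simp add: mu_def)
    show "\<exists>l. chain T b c l 2 \<or> chain T b c l 3" if "c \<in> V" "c \<noteq> lam 0" "par c = b" for c
      using ch[of c] no1[of c] that by (auto simp: kids_def)
  qed (use q q0 b_def in auto)
  then show False using bad mu(2) by simp
qed

theorem theorem1:
  fixes V :: "'a set" and E :: "'a set set" and D :: "'a set \<Rightarrow> 'a \<times> 'a"
  assumes "generalized_halin V E"
    and "orientation E D"
  shows "has_perm_nonsingular_matrix V E D 0 2"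
proof -
  obtain T rot xs where T: "tree_graph V T" "rotation_system V T rot" "cycle_seq xs"
    "set xs = {v \<in> V. leaf T v}" "leaves_in_order T rot xs" and E: "E = T \<union> cycle_edges xs"
    using assms(1) unfolding generalized_halin_def by blast
  define n where "n = length xs"
  define lam where "lam i = xs ! (i mod n)" for i
  have H: "halin V T lam n" "halin.E T lam n = E"
    using cycle_seq_halin[OF T(1,3,4)] unfolding lam_def[abs_def] n_def E by auto
  interpret H: halin V T lam n by (rule H(1))
  note D = assms(2)
  have sgE: "simple_graph V E" and conE: "connected_graph V E"
    using H.simple_graph_E H.connected_E H(2) by auto
  have HD: "orientation H.E D" using D H(2) by simp
  have "good 0 E E (edge_form D)"
  proof (cases "\<exists>h. h \<notin> H.L \<and> V = insert h H.L")
    case True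
    then obtain h where h: "h \<notin> H.L" "V = insert h H.L" by blast
    show ?thesis
    proof (cases "even n")
      case True
      have "H.stem (lam i) = h" for i using H.stem_V[OF H.lam_L] H.stem_notin_L[OF H.lam_L] h by blast
      then have "{lam i, h} \<in> E" for i using H.stem_T[OF H.lam_L, of i] E by simp
      then have "{lam 0, h} \<in> E" "{h, lam 1} \<in> E" by (auto simp: insert_commute)
      \<comment> \<open>The hub and two consecutive leaves form a triangle, which provides the odd
        closed walk.\<close>
      then have "((\<lambda>x y. {x, y} \<in> E) ^^ 2) (lam 0) (lam 1)"
        by (auto simp: numeral_2_eq_2 eq_OO)
      moreover have "{lam 0, lam 1} \<in> E" using H.rho_E[of 0] H(2) by (simp add: H.rho_def)
      moreover have "good 3 E V (vertex_form D)" using H.good_3_even[OF HD True] H(2) by simp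
      ultimately show ?thesis by (intro good_3_vertex_form[OF sgE conE D, where k = 2]) auto
    next
      case False
      then obtain k where "n = Suc (2 * k)" by (metis oddE Suc_eq_plus1)
      moreover then obtain m where "k = Suc m" using H.n3 by (cases k) auto
      ultimately show ?thesis using H.good_0_odd_wheel[OF HD _ h(2,1), of m] H(2) by simp
    qed
  next
    case False
    have edgeV: "u \<in> V \<and> v \<in> V" if "{u, v} \<in> E" for u v using H.edgeE[of u v] that H(2) by simp
    show ?thesis
    proof (rule two_colouring_or_odd_walk[OF conE edgeV])
      fix a b k assume odd: "{a, b} \<in> E" "even k" "((\<lambda>x y. {x, y} \<in> E) ^^ k) a b"
      have "good 3 E V (vertex_form D)" using H.good_3_not_wheel[OF HD] False H(2) by auto
      then show ?thesis by (rule good_3_vertex_form[OF sgE conE D odd])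
    next
      fix col :: "'a \<Rightarrow> bool" assume col: "\<And>u v. {u, v} \<in> E \<Longrightarrow> col u \<noteq> col v"
      interpret plane_tree V T rot xs
        using T H.sgT by unfold_locales auto
      show ?thesis by (rule good_0_bipartite[OF T(1) E D col])
    qed
  qed
  then show ?thesis by (rule has_perm_nonsingular_matrixI[OF sgE D])
qed

end
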